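(* Let $k\ge1$, let $\mathcal{M}^{(0)},\dots,\mathcal{M}^{(k)}$ and $\mathcal{N}^{(0)}$ be vector spaces over $\mathbb{C}$, and let $\Omega^{(j)}$ be a nc set over $\mathcal{M}^{(j)}$ for $j=0,\dots,k$. For every $f\in\mathcal{T}^{(k)}(\Omega^{(0)},\dots,\Omega^{(k)};\mathcal{N}^{(0)}_{\mathrm{nc}},\mathbb{C}_{\mathrm{nc}},\dots,\mathbb{C}_{\mathrm{nc}})$, the family $\rho^{[k]}(f)=(\rho^{[k]}(f)_{n_0;\dots;n_k})_{n_0,\dots,n_k\in\mathbb{N}}$ is a $(k+1)$-variable tensorial nc $\mathcal{N}^{(0)}$-valued function on $\Omega^{(0)}\times\cdots\times\Omega^{(k)}$. Moreover, $\rho^{[k]}$ defines a linear isomorphism $$\mathcal{T}^{(k)}(\Omega^{(0)},\dots,\Omega^{(k)};\mathcal{N}^{(0)}_{\mathrm{nc}},\mathbb{C}_{\mathrm{nc}},\dots,\mathbb{C}_{\mathrm{nc}})\to\mathcal{F}^{(k+1)}(\Omega^{(0)};\dots;\Omega^{(k)}:\mathcal{N}^{(0)}).$$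
   Context: For a complex vector space $\mathcal{M}$, $M_n(\mathcal{M})=M_n(\mathbb{C})\otimes\mathcal{M}$ and $\mathcal{M}_{\mathrm{nc}}=\bigsqcup_{n\ge1}M_n(\mathcal{M})$. A nc set over $\mathcal{M}$ is $\Omega\subset\mathcal{M}_{\mathrm{nc}}$ such that, with $\Omega_n=\Omega\cap M_n(\mathcal{M})$, $X\in\Omega_n$, $Y\in\Omega_m$ imply $X\oplus Y\in\Omega_{n+m}$. A nc $\mathcal{N}$-valued function on $\Omega$ is a map $f:\Omega\to\mathcal{N}_{\mathrm{nc}}$ with $f(\Omega_n)\subset M_n(\mathcal{N})$, $f(X\oplus Y)=f(X)\oplus f(Y)$, and $f(SXS^{-1})=Sf(X)S^{-1}$ whenever $X,SXS^{-1}\in\Omega_n$, $S\in GL_n(\mathbb{C})$. $\mathcal{T}^{(k)}(\Omega^{(0)},\dots,\Omega^{(k)};\mathcal{N}^{(0)}_{\mathrm{nc}},\mathbb{C}_{\mathrm{nc}},\dots,\mathbb{C}_{\mathrm{nc}})$ (nc functions of order $k$) is the vector space of maps $f$ assigning to each $(X^{(0)},\dots,X^{(k)})$ with $X^{(j)}\in\Omega^{(j)}_{n_j}$ a $k$-linear map $f(X^{(0)};\dots;X^{(k)}):M_{n_0,n_1}(\mathbb{C})\times\cdots\times M_{n_{k-1},n_k}(\mathbb{C})\to M_{n_0,n_k}(\mathcal{N}^{(0)})$ such that, for all sizes and all arguments of compatible sizes: Direct sums. (0) $f(X'^{(0)}\oplus X''^{(0)};X^{(1)};\dots)\big(\left[\begin{smallmatrix}Z'^{(1)}\\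 Z''^{(1)}\end{smallmatrix}\right];Z^{(2)};\dots\big)=\left[\begin{smallmatrix}f(X'^{(0)};X^{(1)};\dots)(Z'^{(1)};Z^{(2)};\dots)\\ f(X''^{(0)};X^{(1)};\dots)(Z''^{(1)};Z^{(2)};\dots)\end{smallmatrix}\right]$. ($j$), $1\le j\le k-1$: $f(\dots;X'^{(j)}\oplus X''^{(j)};\dots)\big(\dots;[Z'^{(j)}\ Z''^{(j)}];\left[\begin{smallmatrix}Z'^{(j+1)}\\ Z''^{(j+1)}\end{smallmatrix}\right];\dots\big)=f(\dots;X'^{(j)};\dots)(\dots;Z'^{(j)};Z'^{(j+1)};\dots)+f(\dots;X''^{(j)};\dots)(\dots;Z''^{(j)};Z''^{(j+1)};\dots)$. ($k$) $f(\dots;X'^{(k)}\oplus X''^{(k)})(\dots;[Z'^{(k)}\ Z''^{(k)}])=\big[f(\dots;X'^{(k)})(\dots;Z'^{(k)})\ \ f(\dots;X''^{(k)})(\dots;Z''^{(k)})\big]$. Similarities (for $S_j\in GL_{n_j}(\mathbb{C})$ with $X^{(j)},S_jX^{(j)}S_j^{-1}\in\Omega^{(j)}_{n_j}$). (0) $f(S_0X^{(0)}S_0^{-1};X^{(1)};\dots)(S_0Z^{(1)};Z^{(2)};\dots)=S_0f(X^{(0)};\dots)(Z^{(1)};\dots)$. ($j$), $1\le j\le k-1$: $f(\dots;S_jX^{(j)}S_j^{-1};\dots)(\dots;Z^{(j)}S_j^{-1};S_jZ^{(j+1)};\dots)=f(X^{(0)};\dots;X^{(k)})(Z^{(1)};\dots;Z^{(k)})$.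 ($k$) $f(\dots;S_kX^{(k)}S_k^{-1})(\dots;Z^{(k)}S_k^{-1})=f(X^{(0)};\dots;X^{(k)})(Z^{(1)};\dots;Z^{(k)})S_k^{-1}$. $\mathcal{F}^{(k+1)}(\Omega^{(0)};\dots;\Omega^{(k)}:\mathcal{N}^{(0)})$ is the vector space of $(k+1)$-variable tensorial nc $\mathcal{N}^{(0)}$-valued functions: families $F=(F_{n_0;\dots;n_k})$ of maps $F_{n_0;\dots;n_k}:\Omega^{(0)}_{n_0}\times\cdots\times\Omega^{(k)}_{n_k}\to M_{n_0}(\mathbb{C})\otimes\cdots\otimes M_{n_k}(\mathbb{C})\otimes\mathcal{N}^{(0)}$ such that for each $j$ and each fixed choice of the variables $X^{(i)}\in\Omega^{(i)}_{n_i}$, $i\ne j$, the family in $n=n_j$ of maps of the $j$-th variable is a nc $\mathcal{U}$-valued function on $\Omega^{(j)}$ with $\mathcal{U}=\bigotimes_{i\ne j}M_{n_i}(\mathbb{C})\otimes\mathcal{N}^{(0)}$ (identifying the target with $M_n(\mathbb{C})\otimes\mathcal{U}$). $\iota_{n_0;\dots;n_k}:\mathrm{Hom}_{\mathbb{C}}(M_{n_0,n_1}(\mathbb{C})\otimes\cdots\otimes M_{n_{k-1},n_k}(\mathbb{C}),M_{n_0,n_k}(\mathbb{C})\otimes\mathcal{N}^{(0)})\to M_{n_0}(\mathbb{C})\otimes\cdots\otimes M_{n_k}(\mathbb{C})\otimes\mathcal{N}^{(0)}$ is the linear isomorphism with $(\iota_{n_0;\dots;n_k})^{-1}(A^{(0)}\otimes\cdots\otimes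 A^{(k)}\otimes V)(Z^{(1)};\dots;Z^{(k)})=A^{(0)}Z^{(1)}A^{(1)}\cdots Z^{(k)}A^{(k)}\otimes V$. Then $\rho^{[k]}(f)_{n_0;\dots;n_k}:=\iota_{n_0;\dots;n_k}\circ f$ on $\Omega^{(0)}_{n_0}\times\cdots\times\Omega^{(k)}_{n_k}$. *)

theory Defs
  imports Complex_Main "HOL-Library.FuncSet" "HOL-Library.Function_Algebras"
    "Jordan_Normal_Form.Matrix"
begin

text \<open>
  A complex vector space is given by a scalar multiplication on an abelian group type
  (locale \<^locale>\<open>vector_space\<close>), or is a linear subspace of such a type. A finite family
  of vector spaces is represented by subspaces of one ambient space, which is no restriction since
  the ambient space can be taken to be the direct sum of the family.

  Matrices over a vector space are the matrices of the entry \<open>Jordan_Normal_Form\<close>; a matrix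
  carries its size, so the disjoint union over all sizes of square matrices is an ordinary union.
\<close>

section \<open>Matrices over a vector space\<close>

definition mats_over :: "'a set \<Rightarrow> nat \<Rightarrow> nat \<Rightarrow> 'a mat set" where
  "mats_over V n m = {A \<in> carrier_mat n m. elements_mat A \<subseteq> V}"

definition nc_space :: "'a set \<Rightarrow> 'a mat set" where
  "nc_space V = (\<Union>n\<in>{1..}. mats_over V n n)"

definition dsum :: "'a::zero mat \<Rightarrow> 'a mat \<Rightarrow> 'a mat" where
  "dsum X Y = four_block_mat X (0\<^sub>m (dim_row X) (dim_col Y)) (0\<^sub>m (dim_row Y) (dim_col X)) Y"

definition append_cols :: "'a::zero mat \<Rightarrow> 'a mat \<Rightarrow> 'a mat" (infixr \<open>@\<^sub>c\<close> 65) where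
  "A @\<^sub>c B = four_block_mat A B (0\<^sub>m 0 (dim_col A)) (0\<^sub>m 0 (dim_col B))"

text \<open>Products of a scalar matrix with a matrix over the space with scalar multiplication \<open>s\<close>.\<close>

definition lmul :: "(complex \<Rightarrow> 'a::comm_monoid_add \<Rightarrow> 'a) \<Rightarrow> complex mat \<Rightarrow> 'a mat \<Rightarrow> 'a mat" where
  "lmul s S X = mat (dim_row S) (dim_col X) (\<lambda>(i, j). \<Sum>l<dim_row X. s (S $$ (i, l)) (X $$ (l, j)))"

definition rmul :: "(complex \<Rightarrow> 'a::comm_monoid_add \<Rightarrow> 'a) \<Rightarrow> 'a mat \<Rightarrow> complex mat \<Rightarrow> 'a mat" where
  "rmul s X S = mat (dim_row X) (dim_col S) (\<lambda>(i, j). \<Sum>l<dim_col X. s (S $$ (l, j)) (X $$ (i, l)))"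

text \<open>\<open>GL_inv n S S'\<close>: \<open>S\<close> is in \<open>GL\<^sub>n\<close> and \<open>S'\<close> is its inverse.\<close>

definition GL_inv :: "nat \<Rightarrow> complex mat \<Rightarrow> complex mat \<Rightarrow> bool" where
  "GL_inv n S S' \<longleftrightarrow> S \<in> carrier_mat n n \<and> S' \<in> carrier_mat n n \<and> inverts_mat S S' \<and> inverts_mat S' S"

abbreviation conjug ::
  "(complex \<Rightarrow> 'a::comm_monoid_add \<Rightarrow> 'a) \<Rightarrow> complex mat \<Rightarrow> 'a mat \<Rightarrow> complex mat \<Rightarrow> 'a mat" where
  "conjug s S X S' \<equiv> rmul s (lmul s S X) S'"

section \<open>Nc sets and nc functions\<close>

definition nc_set :: "'a::zero set \<Rightarrow> 'a mat set \<Rightarrow> bool" where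
  "nc_set V \<Omega> \<longleftrightarrow> \<Omega> \<subseteq> nc_space V \<and> (\<forall>X\<in>\<Omega>. \<forall>Y\<in>\<Omega>. dsum X Y \<in> \<Omega>)"

text \<open>\<open>sM\<close> is the scalar multiplication of the space over which \<open>\<Omega>\<close> is a nc set, and \<open>U\<close> with
  \<open>sU\<close> is the space of values.\<close>

definition nc_function ::
  "(complex \<Rightarrow> 'm::ab_group_add \<Rightarrow> 'm) \<Rightarrow> (complex \<Rightarrow> 'u::ab_group_add \<Rightarrow> 'u) \<Rightarrow> 'u set \<Rightarrow>
   'm mat set \<Rightarrow> ('m mat \<Rightarrow> 'u mat) \<Rightarrow> bool" where
  "nc_function sM sU U \<Omega> f \<longleftrightarrow>
     (\<forall>n. \<forall>X\<in>\<Omega> \<inter> carrier_mat n n. f X \<in> mats_over U n n) \<and>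
     (\<forall>X\<in>\<Omega>. \<forall>Y\<in>\<Omega>. f (dsum X Y) = dsum (f X) (f Y)) \<and>
     (\<forall>n. \<forall>X\<in>\<Omega> \<inter> carrier_mat n n. \<forall>S S'. GL_inv n S S' \<longrightarrow> conjug sM S X S' \<in> \<Omega> \<longrightarrow>
        f (conjug sM S X S') = conjug sU S (f X) S')"

section \<open>Linear isomorphisms between spaces given by carrier sets\<close>

definition linear_iso ::
  "('a \<Rightarrow> 'a \<Rightarrow> 'a) \<Rightarrow> (complex \<Rightarrow> 'a \<Rightarrow> 'a) \<Rightarrow> 'a set \<Rightarrow>
   ('b \<Rightarrow> 'b \<Rightarrow> 'b) \<Rightarrow> (complex \<Rightarrow> 'b \<Rightarrow> 'b) \<Rightarrow> 'b set \<Rightarrow> ('a \<Rightarrow> 'b) \<Rightarrow> bool" where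
  "linear_iso addV sV V addW sW W \<phi> \<longleftrightarrow>
     bij_betw \<phi> V W \<and>
     (\<forall>x\<in>V. \<forall>y\<in>V. \<phi> (addV x y) = addW (\<phi> x) (\<phi> y)) \<and>
     (\<forall>c. \<forall>x\<in>V. \<phi> (sV c x) = sW c (\<phi> x))"

section \<open>Multilinear maps of matrices\<close>

text \<open>For sizes \<open>ns = [n\<^sub>0, \<dots>, n\<^sub>k]\<close>, tuples \<open>(Z\<^sup>(\<^sup>1\<^sup>), \<dots>, Z\<^sup>(\<^sup>k\<^sup>))\<close> are lists of length \<open>k\<close>, so
  that \<open>Z\<^sup>(\<^sup>j\<^sup>)\<close> is the list element \<open>Zs ! (j - 1)\<close>.\<close>

definition ztuples :: "nat list \<Rightarrow> complex mat list set" where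
  "ztuples ns = {Zs. length Zs = length ns - 1 \<and>
     (\<forall>i<length ns - 1. Zs ! i \<in> carrier_mat (ns ! i) (ns ! Suc i))}"

text \<open>Linear maps on the tensor product of the spaces of matrices \<open>Z\<^sup>(\<^sup>j\<^sup>)\<close> are represented by
  multilinear maps.\<close>

definition hom_space ::
  "(complex \<Rightarrow> 'n::ab_group_add \<Rightarrow> 'n) \<Rightarrow> nat list \<Rightarrow> (complex mat list \<Rightarrow> 'n mat) set" where
  "hom_space sN ns = {\<phi> \<in> ztuples ns \<rightarrow>\<^sub>E carrier_mat (hd ns) (last ns).
     \<forall>Zs\<in>ztuples ns. \<forall>i<length ns - 1. \<forall>A\<in>carrier_mat (ns ! i) (ns ! Suc i).
       (\<forall>B\<in>carrier_mat (ns ! i) (ns ! Suc i). \<phi> (Zs[i := A + B]) = \<phi> (Zs[i := A]) + \<phi> (Zs[i := B])) \<and>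
       (\<forall>c. \<phi> (Zs[i := c \<cdot>\<^sub>m A]) = map_mat (sN c) (\<phi> (Zs[i := A])))}"

definition hom_add ::
  "nat list \<Rightarrow> (complex mat list \<Rightarrow> 'n::ab_group_add mat) \<Rightarrow> (complex mat list \<Rightarrow> 'n mat) \<Rightarrow>
   (complex mat list \<Rightarrow> 'n mat)" where
  "hom_add ns \<phi> \<psi> = (\<lambda>Zs\<in>ztuples ns. \<phi> Zs + \<psi> Zs)"

definition hom_scale ::
  "(complex \<Rightarrow> 'n \<Rightarrow> 'n) \<Rightarrow> nat list \<Rightarrow> complex \<Rightarrow> (complex mat list \<Rightarrow> 'n mat) \<Rightarrow>
   (complex mat list \<Rightarrow> 'n mat)" where
  "hom_scale sN ns c \<phi> = (\<lambda>Zs\<in>ztuples ns. map_mat (sN c) (\<phi> Zs))"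

section \<open>Tensor products of matrix algebras\<close>

text \<open>The tensor product of the algebras of \<open>n\<^sub>l \<times> n\<^sub>l\<close> matrices, \<open>l = 0, \<dots>, k\<close>, and of a
  vector space \<open>N\<close> is modelled by the \<open>N\<close>-valued arrays indexed by lists
  \<open>[(p\<^sub>0, q\<^sub>0), \<dots>, (p\<^sub>k, q\<^sub>k)]\<close> of row and column indices, in the same way as the tensor product
  of a single matrix algebra with \<open>N\<close> is the space of matrices over \<open>N\<close>.\<close>

type_synonym 'n tensor = "(nat \<times> nat) list \<Rightarrow> 'n"

definition tensor_index :: "nat list \<Rightarrow> (nat \<times> nat) list set" where
  "tensor_index ns = {is. length is = length ns \<and>
     (\<forall>l<length ns. fst (is ! l) < ns ! l \<and> snd (is ! l) < ns ! l)}"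

definition tensor_space :: "nat list \<Rightarrow> 'n::zero tensor set" where
  "tensor_space ns = {T. \<forall>is. is \<notin> tensor_index ns \<longrightarrow> T is = 0}"

definition tensor_scale :: "(complex \<Rightarrow> 'n \<Rightarrow> 'n) \<Rightarrow> complex \<Rightarrow> 'n tensor \<Rightarrow> 'n tensor" where
  "tensor_scale sN c T = (\<lambda>is. sN c (T is))"

text \<open>\<open>elem_tensor sN [A\<^sub>0, \<dots>, A\<^sub>k] v\<close> is the elementary tensor \<open>A\<^sub>0 \<otimes> \<dots> \<otimes> A\<^sub>k \<otimes> v\<close>.\<close>

definition elem_tensor ::
  "(complex \<Rightarrow> 'n::zero \<Rightarrow> 'n) \<Rightarrow> complex mat list \<Rightarrow> 'n \<Rightarrow> 'n tensor" where
  "elem_tensor sN As v = (\<lambda>is. if is \<in> tensor_index (map dim_row As)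
     then sN (\<Prod>l<length As. As ! l $$ (is ! l)) v else 0)"

text \<open>The identification with \<open>n \<times> n\<close> matrices over the tensor product of the factors other than
  the \<open>j\<close>-th one, where \<open>n\<close> is the \<open>j\<close>-th size.\<close>

definition tensor_as_mat :: "nat \<Rightarrow> nat \<Rightarrow> 'n tensor \<Rightarrow> 'n tensor mat" where
  "tensor_as_mat j n T = mat n n (\<lambda>pq is. T (take j is @ pq # drop j is))"

abbreviation remove_nth :: "nat \<Rightarrow> 'a list \<Rightarrow> 'a list" where
  "remove_nth j xs \<equiv> take j xs @ drop (Suc j) xs"

section \<open>The isomorphism \<open>\<iota>\<close>\<close>

text \<open>\<open>interlace [A\<^sub>0, \<dots>, A\<^sub>k] [Z\<^sub>1, \<dots>, Z\<^sub>k] = A\<^sub>0 Z\<^sub>1 A\<^sub>1 \<dots> Z\<^sub>k A\<^sub>k\<close>\<close>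

definition interlace :: "complex mat list \<Rightarrow> complex mat list \<Rightarrow> complex mat" where
  "interlace As Zs = foldl (\<lambda>P (Z, A). P * Z * A) (hd As) (zip Zs (tl As))"

text \<open>The linear isomorphism \<open>\<iota>\<^sup>-\<^sup>1\<close> is determined by its values on elementary tensors.\<close>

definition iota_inv ::
  "(complex \<Rightarrow> 'n::ab_group_add \<Rightarrow> 'n) \<Rightarrow> nat list \<Rightarrow> 'n tensor \<Rightarrow> (complex mat list \<Rightarrow> 'n mat)" where
  "iota_inv sN ns = (THE \<kappa>. \<kappa> \<in> extensional (tensor_space ns) \<and>
     linear_iso (+) (tensor_scale sN) (tensor_space ns)
       (hom_add ns) (hom_scale sN ns) (hom_space sN ns) \<kappa> \<and>
     (\<forall>As v. length As = length ns \<and> (\<forall>l<length ns. As ! l \<in> carrier_mat (ns ! l) (ns ! l)) \<longrightarrow>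
        (\<forall>Zs\<in>ztuples ns. \<kappa> (elem_tensor sN As v) Zs = map_mat (\<lambda>a. sN a v) (interlace As Zs))))"

definition iota ::
  "(complex \<Rightarrow> 'n::ab_group_add \<Rightarrow> 'n) \<Rightarrow> nat list \<Rightarrow> (complex mat list \<Rightarrow> 'n mat) \<Rightarrow> 'n tensor" where
  "iota sN ns = inv_into (tensor_space ns) (iota_inv sN ns)"

section \<open>Nc functions of order \<open>k\<close>\<close>

definition xtuples :: "nat \<Rightarrow> (nat \<Rightarrow> 'm mat set) \<Rightarrow> 'm mat list set" where
  "xtuples k \<Omega> = {Xs. length Xs = Suc k \<and> (\<forall>j\<le>k. Xs ! j \<in> \<Omega> j)}"

abbreviation sizes :: "'m mat list \<Rightarrow> nat list" where
  "sizes Xs \<equiv> map dim_row Xs"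

type_synonym ('m, 'n) nc_map = "'m mat list \<Rightarrow> complex mat list \<Rightarrow> 'n mat"

definition respects_dsum :: "nat \<Rightarrow> (nat \<Rightarrow> 'm::ab_group_add mat set) \<Rightarrow> ('m, 'n::ab_group_add) nc_map \<Rightarrow> bool"
  where
  "respects_dsum k \<Omega> f \<longleftrightarrow> (\<forall>Xs\<in>xtuples k \<Omega>. \<forall>Zs\<in>ztuples (sizes Xs).
     (\<forall>Y\<in>\<Omega> 0. \<forall>W\<in>carrier_mat (dim_row Y) (dim_row (Xs ! 1)).
        f (Xs[0 := dsum (Xs ! 0) Y]) (Zs[0 := (Zs ! 0) @\<^sub>r W]) =
        f Xs Zs @\<^sub>r f (Xs[0 := Y]) (Zs[0 := W])) \<and>
     (\<forall>j\<in>{1..<k}. \<forall>Y\<in>\<Omega> j.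
        \<forall>V\<in>carrier_mat (dim_row (Xs ! (j - 1))) (dim_row Y).
        \<forall>W\<in>carrier_mat (dim_row Y) (dim_row (Xs ! (j + 1))).
        f (Xs[j := dsum (Xs ! j) Y]) (Zs[j - 1 := (Zs ! (j - 1)) @\<^sub>c V, j := (Zs ! j) @\<^sub>r W]) =
        f Xs Zs + f (Xs[j := Y]) (Zs[j - 1 := V, j := W])) \<and>
     (\<forall>Y\<in>\<Omega> k. \<forall>V\<in>carrier_mat (dim_row (Xs ! (k - 1))) (dim_row Y).
        f (Xs[k := dsum (Xs ! k) Y]) (Zs[k - 1 := (Zs ! (k - 1)) @\<^sub>c V]) =
        f Xs Zs @\<^sub>c f (Xs[k := Y]) (Zs[k - 1 := V])))"

definition respects_similarity ::
  "(complex \<Rightarrow> 'm::ab_group_add \<Rightarrow> 'm) \<Rightarrow> (complex \<Rightarrow> 'n::ab_group_add \<Rightarrow> 'n) \<Rightarrow>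
   nat \<Rightarrow> (nat \<Rightarrow> 'm mat set) \<Rightarrow> ('m, 'n) nc_map \<Rightarrow> bool" where
  "respects_similarity sM sN k \<Omega> f \<longleftrightarrow> (\<forall>Xs\<in>xtuples k \<Omega>. \<forall>Zs\<in>ztuples (sizes Xs).
     (\<forall>S S'. GL_inv (dim_row (Xs ! 0)) S S' \<longrightarrow> conjug sM S (Xs ! 0) S' \<in> \<Omega> 0 \<longrightarrow>
        f (Xs[0 := conjug sM S (Xs ! 0) S']) (Zs[0 := S * (Zs ! 0)]) = lmul sN S (f Xs Zs)) \<and>
     (\<forall>j\<in>{1..<k}. \<forall>S S'. GL_inv (dim_row (Xs ! j)) S S' \<longrightarrow> conjug sM S (Xs ! j) S' \<in> \<Omega> j \<longrightarrow>
        f (Xs[j := conjug sM S (Xs ! j) S']) (Zs[j - 1 := (Zs ! (j - 1)) * S', j := S * (Zs ! j)]) =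
        f Xs Zs) \<and>
     (\<forall>S S'. GL_inv (dim_row (Xs ! k)) S S' \<longrightarrow> conjug sM S (Xs ! k) S' \<in> \<Omega> k \<longrightarrow>
        f (Xs[k := conjug sM S (Xs ! k) S']) (Zs[k - 1 := (Zs ! (k - 1)) * S']) =
        rmul sN (f Xs Zs) S'))"

definition nc_order ::
  "(complex \<Rightarrow> 'm::ab_group_add \<Rightarrow> 'm) \<Rightarrow> (complex \<Rightarrow> 'n::ab_group_add \<Rightarrow> 'n) \<Rightarrow>
   nat \<Rightarrow> (nat \<Rightarrow> 'm mat set) \<Rightarrow> ('m, 'n) nc_map set" where
  "nc_order sM sN k \<Omega> = {f \<in> (\<Pi>\<^sub>E Xs\<in>xtuples k \<Omega>. hom_space sN (sizes Xs)).
     respects_dsum k \<Omega> f \<and> respects_similarity sM sN k \<Omega> f}"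

definition nc_order_add ::
  "nat \<Rightarrow> (nat \<Rightarrow> 'm mat set) \<Rightarrow> ('m, 'n::ab_group_add) nc_map \<Rightarrow> ('m, 'n) nc_map \<Rightarrow> ('m, 'n) nc_map" where
  "nc_order_add k \<Omega> f g = (\<lambda>Xs\<in>xtuples k \<Omega>. hom_add (sizes Xs) (f Xs) (g Xs))"

definition nc_order_scale ::
  "(complex \<Rightarrow> 'n \<Rightarrow> 'n) \<Rightarrow> nat \<Rightarrow> (nat \<Rightarrow> 'm mat set) \<Rightarrow>
   complex \<Rightarrow> ('m, 'n) nc_map \<Rightarrow> ('m, 'n) nc_map" where
  "nc_order_scale sN k \<Omega> c f = (\<lambda>Xs\<in>xtuples k \<Omega>. hom_scale sN (sizes Xs) c (f Xs))"

section \<open>Tensorial nc functions of \<open>k + 1\<close> variables\<close>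

text \<open>Since the matrices in a tuple determine the sizes \<open>n\<^sub>0, \<dots>, n\<^sub>k\<close>, a family of maps indexed
  by the sizes is a single map on tuples.\<close>

definition tensorial_nc ::
  "(complex \<Rightarrow> 'm::ab_group_add \<Rightarrow> 'm) \<Rightarrow> (complex \<Rightarrow> 'n::ab_group_add \<Rightarrow> 'n) \<Rightarrow>
   nat \<Rightarrow> (nat \<Rightarrow> 'm mat set) \<Rightarrow> ('m mat list \<Rightarrow> 'n tensor) set" where
  "tensorial_nc sM sN k \<Omega> = {F \<in> (\<Pi>\<^sub>E Xs\<in>xtuples k \<Omega>. tensor_space (sizes Xs)).
     \<forall>j\<le>k. \<forall>Xs\<in>xtuples k \<Omega>.
       nc_function sM (tensor_scale sN) (tensor_space (remove_nth j (sizes Xs))) (\<Omega> j)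
         (\<lambda>Y. tensor_as_mat j (dim_row Y) (F (Xs[j := Y])))}"

definition tensorial_add ::
  "nat \<Rightarrow> (nat \<Rightarrow> 'm mat set) \<Rightarrow> ('m mat list \<Rightarrow> 'n::ab_group_add tensor) \<Rightarrow>
   ('m mat list \<Rightarrow> 'n tensor) \<Rightarrow> ('m mat list \<Rightarrow> 'n tensor)" where
  "tensorial_add k \<Omega> F G = (\<lambda>Xs\<in>xtuples k \<Omega>. F Xs + G Xs)"

definition tensorial_scale ::
  "(complex \<Rightarrow> 'n \<Rightarrow> 'n) \<Rightarrow> nat \<Rightarrow> (nat \<Rightarrow> 'm mat set) \<Rightarrow>
   complex \<Rightarrow> ('m mat list \<Rightarrow> 'n tensor) \<Rightarrow> ('m mat list \<Rightarrow> 'n tensor)" where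
  "tensorial_scale sN k \<Omega> c F = (\<lambda>Xs\<in>xtuples k \<Omega>. tensor_scale sN c (F Xs))"

definition rho ::
  "(complex \<Rightarrow> 'n::ab_group_add \<Rightarrow> 'n) \<Rightarrow> nat \<Rightarrow> (nat \<Rightarrow> 'm mat set) \<Rightarrow>
   ('m, 'n) nc_map \<Rightarrow> ('m mat list \<Rightarrow> 'n tensor)" where
  "rho sN k \<Omega> f = (\<lambda>Xs\<in>xtuples k \<Omega>. iota sN (sizes Xs) (f Xs))"

end

theory Submission
  imports Defs
begin

text \<open>
  In coordinates the inverse of \<open>iota\<close> is a contraction of tensors. Write the index of a
  coordinate of a tensor \<open>T\<close> as \<open>[(p\<^sub>0, q\<^sub>0), \<dots>, (p\<^sub>k, q\<^sub>k)]\<close>. The entry \<open>(a, b)\<close> of the image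
  of \<open>T\<close> at \<open>(Z\<^sub>1, \<dots>, Z\<^sub>k)\<close> is the sum over all indices with \<open>p\<^sub>0 = a\<close> and \<open>q\<^sub>k = b\<close> of
  \<open>Z\<^sub>1(q\<^sub>0, p\<^sub>1) \<dots> Z\<^sub>k(q\<^bsub>k - 1\<^esub>, p\<^sub>k)\<close> times the coordinate of \<open>T\<close>. The boundary conditions are
  absorbed into two further factors \<open>Z\<^sub>0 = \<delta>\<^sub>a\<close> and \<open>Z\<^bsub>k + 1\<^esub> = \<delta>\<^sub>b\<close>, so that the entry is a full
  contraction of \<open>T\<close> with a chain of \<open>k + 2\<close> factors, and the slot \<open>j\<close> of \<open>T\<close> meets exactly the
  factors \<open>j\<close> and \<open>j + 1\<close> of the chain, for the extreme values of \<open>j\<close> as well. On matrix units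
  the contraction returns single coordinates of \<open>T\<close>, which makes it a bijection onto the
  multilinear maps (\<open>contraction_bij\<close>). Its values on elementary tensors are the interlaced
  products (\<open>contraction_elem_tensor\<close>) and these tensors span, so it is \<open>iota_inv\<close>
  (\<open>iota_inv_eq_contraction\<close>).

  It remains to match the axioms one slot at a time. If the slot \<open>j\<close> of \<open>T\<close> is a block sum of those
  of \<open>T\<^sub>1\<close> and \<open>T\<^sub>2\<close>, then every contraction of \<open>T\<close> is the sum of a contraction of \<open>T\<^sub>1\<close> with the
  same chain and one of \<open>T\<^sub>2\<close> with the chain whose slot \<open>j\<close> is shifted (\<open>contract_dsum\<close>). If the slot is
  conjugated by \<open>S\<close>, the conjugation can be moved to the two adjacent factors
  (\<open>contract_conjug\<close>). As contractions determine a tensor, the block sum and the conjugation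
  condition on tensors are equivalent to these identities of contractions
  (\<open>tensor_dsum_iff_contract\<close>, \<open>tensor_conjug_iff_contract\<close>). Written in terms of the
  \<open>Z\<^sub>i\<close>, the identities are the axioms of nc functions of order \<open>k\<close>: for \<open>0 < j < k\<close> both
  adjacent factors are matrices \<open>Z\<^sub>i\<close>, while for \<open>j = 0\<close> and \<open>j = k\<close> one of them is a boundary
  factor, which turns the sum into a matrix of two blocks and the conjugation into a one-sided
  product.
\<close>

section \<open>Contraction of a tensor with a chain of factors\<close>

text \<open>Along a chain through the index \<open>ps = [(p\<^sub>0, q\<^sub>0), \<dots>, (p\<^sub>k, q\<^sub>k)]\<close> the factor \<open>l\<close> goes from
  the column index \<open>q\<^bsub>l - 1\<^esub>\<close> to the row index \<open>p\<^sub>l\<close>. At the two ends of the chain, where these do not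
  exist, the value \<open>0\<close> is a placeholder.\<close>

definition out_index :: "(nat \<times> nat) list \<Rightarrow> nat \<Rightarrow> nat" where
  "out_index ps l = (if l = 0 then 0 else snd (ps ! (l - 1)))"

definition in_index :: "(nat \<times> nat) list \<Rightarrow> nat \<Rightarrow> nat" where
  "in_index ps l = (if l = length ps then 0 else fst (ps ! l))"

text \<open>The product of the \<open>k + 2\<close> factors \<open>R 0, \<dots>, R (k + 1)\<close> at an index.\<close>

definition weight :: "(nat \<Rightarrow> nat \<Rightarrow> nat \<Rightarrow> complex) \<Rightarrow> (nat \<times> nat) list \<Rightarrow> complex" where
  "weight R ps = (\<Prod>l\<le>length ps. R l (out_index ps l) (in_index ps l))"

text \<open>The contraction of all indices of \<open>T\<close> with the chain \<open>R\<close>.\<close>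

definition contract ::
  "(complex \<Rightarrow> 'n \<Rightarrow> 'n) \<Rightarrow> nat list \<Rightarrow> (nat \<Rightarrow> nat \<Rightarrow> nat \<Rightarrow> complex) \<Rightarrow> 'n::ab_group_add tensor \<Rightarrow> 'n" where
  "contract sN ns R T = (\<Sum>ps\<in>tensor_index ns. sN (weight R ps) (T ps))"

text \<open>The chain \<open>\<delta>\<^sub>a, Z\<^sub>1, \<dots>, Z\<^sub>k, \<delta>\<^sub>b\<close> that extracts the entry \<open>(a, b)\<close>.\<close>

definition frame :: "nat \<Rightarrow> nat \<Rightarrow> complex mat list \<Rightarrow> nat \<Rightarrow> nat \<Rightarrow> nat \<Rightarrow> complex" where
  "frame a b Zs l s p =
     (if l = 0 then of_bool (p = a) else if l = Suc (length Zs) then of_bool (s = b)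
      else Zs ! (l - 1) $$ (s, p))"

text \<open>The multilinear map of matrices given by a tensor. It is the explicit form of \<open>\<iota>\<^sup>-\<^sup>1\<close>.\<close>

definition contraction ::
  "(complex \<Rightarrow> 'n \<Rightarrow> 'n) \<Rightarrow> nat list \<Rightarrow> 'n::ab_group_add tensor \<Rightarrow> complex mat list \<Rightarrow> 'n mat" where
  "contraction sN ns T = (\<lambda>Zs\<in>ztuples ns.
     mat (hd ns) (last ns) (\<lambda>(a, b). contract sN ns (frame a b Zs) T))"

text \<open>The matrix units \<open>Z\<^sub>l\<close> with the entry \<open>1\<close> at \<open>(q\<^bsub>l - 1\<^esub>, p\<^sub>l)\<close>.\<close>

definition unit_tuple :: "nat list \<Rightarrow> (nat \<times> nat) list \<Rightarrow> complex mat list" where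
  "unit_tuple ns ps = map (\<lambda>l. mat (ns ! l) (ns ! Suc l)
     (\<lambda>(s, p). of_bool (s = snd (ps ! l) \<and> p = fst (ps ! Suc l)))) [0..<length ns - 1]"

abbreviation insert_nth :: "nat \<Rightarrow> 'a \<Rightarrow> 'a list \<Rightarrow> 'a list" where
  "insert_nth j x xs \<equiv> take j xs @ x # drop j xs"

lemma frame_simps [simp]:
  "frame a b Zs 0 s p = of_bool (p = a)"
  "frame a b Zs (Suc (length Zs)) s p = of_bool (s = b)"
  "l < length Zs \<Longrightarrow> frame a b Zs (Suc l) s p = Zs ! l $$ (s, p)"
  by (auto simp: frame_def)

lemma finite_tensor_index [simp]: "finite (tensor_index ns)"
proof -
  have "tensor_index ns \<subseteq> {ps. set ps \<subseteq> {..<Suc (Max (set ns))} \<times> {..<Suc (Max (set ns))} \<and> length ps = length ns}"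
  proof safe
    fix ps a b assume ps: "ps \<in> tensor_index ns" and m: "(a, b) \<in> set ps"
    then obtain l where l: "l < length ps" "ps ! l = (a, b)" by (auto simp: in_set_conv_nth)
    then have "ns ! l \<in> set ns" "a < ns ! l" "b < ns ! l"
      using ps by (force simp: tensor_index_def)+
    moreover from this have "ns ! l \<le> Max (set ns)" by simp
    ultimately show "a < Suc (Max (set ns))" "b < Suc (Max (set ns))" by linarith+
  qed (auto simp: tensor_index_def)
  moreover have "finite {ps. set ps \<subseteq> {..<Suc (Max (set ns))} \<times> {..<Suc (Max (set ns))} \<and> length ps = length ns}"
    by (rule finite_lists_length_eq) auto
  ultimately show ?thesis by (rule finite_subset)
qed

lemma tensor_index_length: "ps \<in> tensor_index ns \<Longrightarrow> length ps = length ns"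
  by (simp add: tensor_index_def)

lemma out_index_less:
  "ps \<in> tensor_index ns \<Longrightarrow> l < length ns \<Longrightarrow> out_index ps (Suc l) < ns ! l"
  by (auto simp: tensor_index_def out_index_def)

lemma in_index_less:
  "ps \<in> tensor_index ns \<Longrightarrow> l < length ns \<Longrightarrow> in_index ps l < ns ! l"
  by (auto simp: tensor_index_def in_index_def)

lemma ztuplesD:
  assumes "Zs \<in> ztuples ns"
  shows "length Zs = length ns - 1" "\<And>i. Suc i < length ns \<Longrightarrow> Zs ! i \<in> carrier_mat (ns ! i) (ns ! Suc i)"
  using assms by (auto simp: ztuples_def)

lemma ztuples_update:
  assumes "Zs \<in> ztuples ns" "A \<in> carrier_mat (ns ! i) (ns ! Suc i)"
  shows "Zs[i := A] \<in> ztuples ns"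
proof -
  have "Zs[i := A] ! l \<in> carrier_mat (ns ! l) (ns ! Suc l)" if "l < length ns - 1" for l
    using assms that by (cases "l = i") (auto simp: ztuples_def)
  then show ?thesis using assms by (auto simp: ztuples_def)
qed

lemma weight_update:
  assumes "l \<le> length ps"
  shows "weight (R(l := X)) ps = X (out_index ps l) (in_index ps l) *
    (\<Prod>l'\<in>{..length ps} - {l}. R l' (out_index ps l') (in_index ps l'))"
proof -
  have "weight (R(l := X)) ps = (R(l := X)) l (out_index ps l) (in_index ps l) *
      (\<Prod>l'\<in>{..length ps} - {l}. (R(l := X)) l' (out_index ps l') (in_index ps l'))"
    unfolding weight_def using assms by (subst prod.remove[of _ l]) auto
  also have "(\<Prod>l'\<in>{..length ps} - {l}. (R(l := X)) l' (out_index ps l') (in_index ps l')) =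
      (\<Prod>l'\<in>{..length ps} - {l}. R l' (out_index ps l') (in_index ps l'))"
    by (rule prod.cong) auto
  finally show ?thesis by (simp only: fun_upd_same)
qed

lemma contract_cong:
  assumes len: "length ns = Suc k"
    and first: "\<And>s p. p < ns ! 0 \<Longrightarrow> R 0 s p = R' 0 s p"
    and mid: "\<And>l s p. l < k \<Longrightarrow> s < ns ! l \<Longrightarrow> p < ns ! Suc l \<Longrightarrow> R (Suc l) s p = R' (Suc l) s p"
    and final: "\<And>s p. s < ns ! k \<Longrightarrow> R (Suc k) s p = R' (Suc k) s p"
  shows "contract sN ns R T = contract sN ns R' T"
  unfolding contract_def
proof (rule sum.cong)
  fix ps assume ps: "ps \<in> tensor_index ns"
  have "R l (out_index ps l) (in_index ps l) = R' l (out_index ps l) (in_index ps l)"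
    if "l \<le> Suc k" for l
  proof (cases l)
    case 0
    then show ?thesis using first in_index_less[OF ps, of 0] len by auto
  next
    case (Suc m)
    then show ?thesis
      using that mid[of m] final in_index_less[OF ps, of l] out_index_less[OF ps, of m] len
      by (cases "m = k") auto
  qed
  then have "weight R ps = weight R' ps"
    unfolding weight_def using tensor_index_length[OF ps] len by (intro prod.cong) auto
  then show "sN (weight R ps) (T ps) = sN (weight R' ps) (T ps)" by simp
qed simp

context
  fixes sN :: "complex \<Rightarrow> 'n::ab_group_add \<Rightarrow> 'n"
  assumes vector_space_sN: "vector_space sN"
begin

interpretation N: vector_space sN by (rule vector_space_sN)

text \<open>A contraction is linear in each factor of the chain, including the two boundary factors.\<close>

lemma contract_sum_update:
  assumes l: "l \<le> length ns"
  shows "contract sN ns (R(l := \<lambda>s p. \<Sum>c\<in>C. u c * Q c s p)) T =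
    (\<Sum>c\<in>C. sN (u c) (contract sN ns (R(l := Q c)) T))"
proof -
  let ?w = "\<lambda>X ps. weight (R(l := X)) ps"
  have "?w (\<lambda>s p. \<Sum>c\<in>C. u c * Q c s p) ps = (\<Sum>c\<in>C. u c * ?w (Q c) ps)"
    if "ps \<in> tensor_index ns" for ps
    using l tensor_index_length[OF that] by (simp add: weight_update sum_distrib_right mult.assoc)
  then have "contract sN ns (R(l := \<lambda>s p. \<Sum>c\<in>C. u c * Q c s p)) T =
    (\<Sum>ps\<in>tensor_index ns. \<Sum>c\<in>C. sN (u c) (sN (?w (Q c) ps) (T ps)))"
    unfolding contract_def by (intro sum.cong) (auto simp: N.scale_sum_left)
  also have "\<dots> = (\<Sum>c\<in>C. sN (u c) (contract sN ns (R(l := Q c)) T))"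
    unfolding contract_def N.scale_sum_right by (rule sum.swap)
  finally show ?thesis .
qed

lemma contract_zero_slot:
  assumes "l \<le> length ns" "\<And>ps. ps \<in> tensor_index ns \<Longrightarrow> R l (out_index ps l) (in_index ps l) = 0"
  shows "contract sN ns R T = 0"
  unfolding contract_def
proof (rule sum.neutral, rule ballI)
  fix ps assume ps: "ps \<in> tensor_index ns"
  then have "weight R ps = 0"
    unfolding weight_def using assms(1) assms(2)[OF ps] tensor_index_length[OF ps]
    by (intro prod_zero) auto
  then show "sN (weight R ps) (T ps) = 0" by simp
qed

lemma contraction_entry:
  assumes "length ns = Suc k" "Zs \<in> ztuples ns" "a < ns ! 0" "b < ns ! k"
  shows "contraction sN ns T Zs $$ (a, b) = contract sN ns (frame a b Zs) T"
proof -
  have "ns \<noteq> []" using assms by auto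
  then show ?thesis using assms by (simp add: contraction_def hd_conv_nth last_conv_nth)
qed

lemma contraction_carrier:
  assumes "length ns = Suc k" "Zs \<in> ztuples ns"
  shows "contraction sN ns T Zs \<in> carrier_mat (ns ! 0) (ns ! k)"
proof -
  have "ns \<noteq> []" using assms by auto
  then show ?thesis using assms by (simp add: contraction_def hd_conv_nth last_conv_nth)
qed

lemma frame_update:
  assumes "i < length Zs"
  shows "frame a b (Zs[i := A]) = (frame a b Zs)(Suc i := \<lambda>s p. A $$ (s, p))"
  using assms by (auto simp: frame_def fun_eq_iff nth_list_update)

lemma contraction_multilinear:
  assumes len: "length ns = Suc k"
  shows "contraction sN ns T \<in> hom_space sN ns"
proof -
  have ne: "ns \<noteq> []" using len by auto
  have hl: "hd ns = ns ! 0" "last ns = ns ! k" using ne len by (simp_all add: hd_conv_nth last_conv_nth)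
  have multi: "(\<forall>B\<in>carrier_mat (ns ! i) (ns ! Suc i). contraction sN ns T (Zs[i := A + B]) =
        contraction sN ns T (Zs[i := A]) + contraction sN ns T (Zs[i := B])) \<and>
      (\<forall>c. contraction sN ns T (Zs[i := c \<cdot>\<^sub>m A]) = map_mat (sN c) (contraction sN ns T (Zs[i := A])))"
    if Zs: "Zs \<in> ztuples ns" and i: "i < length ns - 1"
      and A: "A \<in> carrier_mat (ns ! i) (ns ! Suc i)" for Zs i and A :: "complex mat"
  proof -
    have il: "i < length Zs" "i < k" using i ztuplesD(1)[OF Zs] len by auto
    have ZA: "Zs[i := X] \<in> ztuples ns" if "X \<in> carrier_mat (ns ! i) (ns ! Suc i)" for X
      using Zs that by (rule ztuples_update)
    have car: "contraction sN ns T (Zs[i := X]) \<in> carrier_mat (ns ! 0) (ns ! k)"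
      if "X \<in> carrier_mat (ns ! i) (ns ! Suc i)" for X
      using that by (rule contraction_carrier[OF len ZA])
    \<comment> \<open>A sum over at most two terms covers both additivity and homogeneity.\<close>
    have key: "contract sN ns (frame a b (Zs[i := X])) T =
        (\<Sum>c\<in>C. sN (u c) (contract sN ns (frame a b (Zs[i := Q c])) T))"
      if X: "\<And>s p. s < ns ! i \<Longrightarrow> p < ns ! Suc i \<Longrightarrow> X $$ (s, p) = (\<Sum>c\<in>C. u c * Q c $$ (s, p))"
      for X :: "complex mat" and a b and C :: "nat set" and u Q
    proof -
      have "contract sN ns (frame a b (Zs[i := X])) T =
        contract sN ns ((frame a b Zs)(Suc i := \<lambda>s p. \<Sum>c\<in>C. u c * Q c $$ (s, p))) T"
        by (rule contract_cong[OF len]) (use X il len in \<open>auto simp: frame_update\<close>)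
      also have "\<dots> = (\<Sum>c\<in>C. sN (u c) (contract sN ns (frame a b (Zs[i := Q c])) T))"
        by (subst contract_sum_update) (use il len in \<open>auto simp: frame_update\<close>)
      finally show ?thesis .
    qed
    have "contraction sN ns T (Zs[i := A + B]) =
        contraction sN ns T (Zs[i := A]) + contraction sN ns T (Zs[i := B])"
      if B: "B \<in> carrier_mat (ns ! i) (ns ! Suc i)" for B
    proof (rule eq_matI)
      fix a b
      assume "a < dim_row (contraction sN ns T (Zs[i := A]) + contraction sN ns T (Zs[i := B]))"
        "b < dim_col (contraction sN ns T (Zs[i := A]) + contraction sN ns T (Zs[i := B]))"
      then have ab: "a < ns ! 0" "b < ns ! k"
        using car[OF A] car[OF B] by auto
      have "contract sN ns (frame a b (Zs[i := A + B])) T =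
        (\<Sum>c\<in>{0, 1::nat}. sN 1 (contract sN ns (frame a b (Zs[i := if c = 0 then A else B])) T))"
        by (rule key) (use A B in auto)
      then show "contraction sN ns T (Zs[i := A + B]) $$ (a, b) =
        (contraction sN ns T (Zs[i := A]) + contraction sN ns T (Zs[i := B])) $$ (a, b)"
        using contraction_entry[OF len ZA ab] A B car[OF A] car[OF B] ab by simp
    qed (use car[OF A] car[OF B] car[of "A + B"] B in auto)
    moreover have "contraction sN ns T (Zs[i := c \<cdot>\<^sub>m A]) = map_mat (sN c) (contraction sN ns T (Zs[i := A]))"
      for c
    proof (rule eq_matI)
      fix a b
      assume "a < dim_row (map_mat (sN c) (contraction sN ns T (Zs[i := A])))"
        "b < dim_col (map_mat (sN c) (contraction sN ns T (Zs[i := A])))"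
      then have ab: "a < ns ! 0" "b < ns ! k"
        using car[OF A] by auto
      have "contract sN ns (frame a b (Zs[i := c \<cdot>\<^sub>m A])) T =
        (\<Sum>d\<in>{0::nat}. sN c (contract sN ns (frame a b (Zs[i := A])) T))"
        by (rule key) (use A in auto)
      then show "contraction sN ns T (Zs[i := c \<cdot>\<^sub>m A]) $$ (a, b) =
        map_mat (sN c) (contraction sN ns T (Zs[i := A])) $$ (a, b)"
        using contraction_entry[OF len ZA ab] A car[OF A] ab by simp
    qed (use car[OF A] car[of "c \<cdot>\<^sub>m A"] A in auto)
    ultimately show ?thesis by blast
  qed
  show ?thesis
    unfolding hom_space_def
  proof (intro CollectI conjI ballI allI impI)
    show "contraction sN ns T \<in> ztuples ns \<rightarrow>\<^sub>E carrier_mat (hd ns) (last ns)"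
      using contraction_carrier[OF len, of _ T] by (auto simp: hl PiE_iff extensional_def contraction_def)
  qed (use multi in auto)
qed

end

section \<open>Matrix units and interlaced products\<close>

text \<open>On a tuple of matrix units the weight singles out one index.\<close>

lemma weight_unit_tuple:
  assumes len: "length ns = Suc k" and ps: "ps \<in> tensor_index ns" and qs: "qs \<in> tensor_index ns"
  shows "weight (frame (fst (ps ! 0)) (snd (ps ! k)) (unit_tuple ns ps)) qs = of_bool (qs = ps)"
proof -
  let ?f = "\<lambda>l. frame (fst (ps ! 0)) (snd (ps ! k)) (unit_tuple ns ps) l (out_index qs l) (in_index qs l)"
  have lens: "length ps = Suc k" "length qs = Suc k" "length (unit_tuple ns ps) = k"
    using tensor_index_length[OF ps] tensor_index_length[OF qs] len by (simp_all add: unit_tuple_def)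
  have f0: "?f 0 = of_bool (fst (qs ! 0) = fst (ps ! 0))"
    by (simp add: in_index_def lens)
  have fk: "?f (Suc k) = of_bool (snd (qs ! k) = snd (ps ! k))"
    using frame_simps(2)[of _ _ "unit_tuple ns ps"] by (simp add: out_index_def lens)
  have fm: "?f (Suc m) = of_bool (snd (qs ! m) = snd (ps ! m) \<and> fst (qs ! Suc m) = fst (ps ! Suc m))"
    if "m < k" for m
    using that qs len by (simp add: lens out_index_def in_index_def unit_tuple_def tensor_index_def)
  show ?thesis
  proof (cases "qs = ps")
    case True
    have "?f l = 1" if "l \<le> Suc k" for l
    proof (cases l)
      case 0
      then show ?thesis using f0 True by simp
    next
      case (Suc m)
      then show ?thesis using fk fm[of m] True that by (cases "m = k") auto
    qed
    then show ?thesis using True unfolding weight_def lens by simp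
  next
    case False
    then obtain l where l: "l < Suc k" "qs ! l \<noteq> ps ! l"
      using lens by (auto simp: list_eq_iff_nth_eq)
    then consider "fst (qs ! l) \<noteq> fst (ps ! l)" | "snd (qs ! l) \<noteq> snd (ps ! l)"
      by (auto simp: prod_eq_iff)
    then have "\<exists>l'\<le>Suc k. ?f l' = 0"
    proof cases
      case 1
      then show ?thesis using f0 fm[of "l - 1"] l by (intro exI[of _ l]) (cases l, auto)
    next
      case 2
      then show ?thesis using fk fm[of l] l by (intro exI[of _ "Suc l"]) (cases "l = k", auto)
    qed
    then have "weight (frame (fst (ps ! 0)) (snd (ps ! k)) (unit_tuple ns ps)) qs = 0"
      unfolding weight_def lens by (intro prod_zero) auto
    then show ?thesis using False by simp
  qed
qed

lemma unit_tuple_ztuples: "unit_tuple ns ps \<in> ztuples ns"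
  by (auto simp: unit_tuple_def ztuples_def)

lemma remove_nth_insert_nth: "j \<le> length xs \<Longrightarrow> remove_nth j (insert_nth j x xs) = xs"
  by (simp add: min_def)

lemma insert_nth_remove_nth: "j < length xs \<Longrightarrow> insert_nth j (xs ! j) (remove_nth j xs) = xs"
  by (simp add: min_def id_take_nth_drop[symmetric])

lemma nth_insert_nth:
  "j \<le> length xs \<Longrightarrow> insert_nth j x xs ! l = (if l < j then xs ! l else if l = j then x else xs ! (l - 1))"
  by (auto simp: nth_append nth_Cons')

lemma nth_remove_nth:
  "j < length xs \<Longrightarrow> l < length xs - 1 \<Longrightarrow> remove_nth j xs ! l = (if l < j then xs ! l else xs ! Suc l)"
  by (auto simp: nth_append)

lemma remove_nth_tensor_index:
  assumes "j < length ns" "ps \<in> tensor_index ns"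
  shows "remove_nth j ps \<in> tensor_index (remove_nth j ns)"
proof -
  have "length ps = length ns" by (rule tensor_index_length[OF assms(2)])
  then have "fst (remove_nth j ps ! l) < remove_nth j ns ! l \<and> snd (remove_nth j ps ! l) < remove_nth j ns ! l"
    if "l < length ns - 1" for l
    using that assms by (simp only: nth_remove_nth) (auto simp: tensor_index_def)
  then show ?thesis using assms by (simp add: tensor_index_def)
qed

lemma insert_nth_in_tensor_index_iff:
  assumes j: "j < length ns"
  shows "insert_nth j (p, q) ps \<in> tensor_index ns \<longleftrightarrow>
    p < ns ! j \<and> q < ns ! j \<and> ps \<in> tensor_index (remove_nth j ns)" (is "?L \<longleftrightarrow> ?R")
proof
  assume L: ?L
  then have "length (insert_nth j (p, q) ps) = length ns" by (rule tensor_index_length)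
  then have jl: "j \<le> length ps" using j by auto
  have "ps \<in> tensor_index (remove_nth j ns)"
    using remove_nth_tensor_index[OF j L] unfolding remove_nth_insert_nth[OF jl] .
  moreover have "fst (insert_nth j (p, q) ps ! j) < ns ! j \<and> snd (insert_nth j (p, q) ps ! j) < ns ! j"
    using L j by (auto simp: tensor_index_def)
  ultimately show ?R unfolding nth_insert_nth[OF jl] by simp
next
  assume R: ?R
  then have len: "length ps = length ns - 1" using j by (simp add: tensor_index_def)
  have *: "fst (ps ! l) < remove_nth j ns ! l \<and> snd (ps ! l) < remove_nth j ns ! l" if "l < length ns - 1" for l
    using R that j by (simp add: tensor_index_def)
  have jl: "j \<le> length ps" using len j by simp
  have "fst (insert_nth j (p, q) ps ! l) < ns ! l \<and> snd (insert_nth j (p, q) ps ! l) < ns ! l"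
    if l: "l < length ns" for l
  proof -
    have "fst (ps ! (l - 1)) < ns ! l \<and> snd (ps ! (l - 1)) < ns ! l" if "j < l"
    proof -
      obtain m where m: "l = Suc m" using \<open>j < l\<close> by (cases l) auto
      show ?thesis using *[of m] nth_remove_nth[OF j, of m] l that m by simp
    qed
    moreover have "fst (ps ! l) < ns ! l \<and> snd (ps ! l) < ns ! l" if "l < j"
      using *[of l] nth_remove_nth[OF j, of l] that j by simp
    ultimately show ?thesis unfolding nth_insert_nth[OF jl] using R by auto
  qed
  then show ?L using j len by (simp add: tensor_index_def)
qed

text \<open>An index is the same as an index pair of the slot \<open>j\<close> together with an index of the
  remaining slots.\<close>

lemma sum_tensor_index_slot:
  assumes j: "j < length ns"
  shows "(\<Sum>ps\<in>tensor_index ns. f ps) =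
    (\<Sum>p<ns ! j. \<Sum>q<ns ! j. \<Sum>ps\<in>tensor_index (remove_nth j ns). f (insert_nth j (p, q) ps))"
proof -
  let ?I = "({..<ns ! j} \<times> {..<ns ! j}) \<times> tensor_index (remove_nth j ns)"
  have len: "j \<le> length ps" if "ps \<in> tensor_index (remove_nth j ns)" for ps
    using tensor_index_length[OF that] j by simp
  have bij: "bij_betw (\<lambda>(pq, ps). insert_nth j pq ps) ?I (tensor_index ns)"
  proof (rule bij_betw_byWitness[where f' = "\<lambda>ps. (ps ! j, remove_nth j ps)"])
    show "\<forall>a\<in>?I. (\<lambda>ps. (ps ! j, remove_nth j ps)) (case a of (pq, ps) \<Rightarrow> insert_nth j pq ps) = a"
      using len by (auto simp: nth_insert_nth remove_nth_insert_nth simp del: append_assoc)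
    show "\<forall>ps\<in>tensor_index ns. (case (ps ! j, remove_nth j ps) of (pq, ps) \<Rightarrow> insert_nth j pq ps) = ps"
      using j tensor_index_length by (auto simp only: insert_nth_remove_nth prod.case)
    show "(\<lambda>(pq, ps). insert_nth j pq ps) ` ?I \<subseteq> tensor_index ns"
      using insert_nth_in_tensor_index_iff[OF j] by auto
    show "(\<lambda>ps. (ps ! j, remove_nth j ps)) ` tensor_index ns \<subseteq> ?I"
    proof (rule image_subsetI)
      fix ps assume ps: "ps \<in> tensor_index ns"
      have "fst (ps ! j) < ns ! j \<and> snd (ps ! j) < ns ! j" using ps j by (simp add: tensor_index_def)
      then have "ps ! j \<in> {..<ns ! j} \<times> {..<ns ! j}" by (simp add: mem_Times_iff)
      then show "(ps ! j, remove_nth j ps) \<in> ?I" using remove_nth_tensor_index[OF j ps] by blast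
    qed
  qed
  have "(\<Sum>ps\<in>tensor_index ns. f ps) = (\<Sum>(pq, ps)\<in>?I. f (insert_nth j pq ps))"
    using sum.reindex_bij_betw[OF bij, of f] by (simp add: case_prod_unfold)
  also have "\<dots> = (\<Sum>pq\<in>{..<ns ! j} \<times> {..<ns ! j}. \<Sum>ps\<in>tensor_index (remove_nth j ns). f (insert_nth j pq ps))"
    by (rule sum.cartesian_product[symmetric])
  also have "\<dots> = (\<Sum>p<ns ! j. \<Sum>q<ns ! j. \<Sum>ps\<in>tensor_index (remove_nth j ns). f (insert_nth j (p, q) ps))"
    using sum.cartesian_product[of "\<lambda>p q. \<Sum>ps\<in>tensor_index (remove_nth j ns). f (insert_nth j (p, q) ps)"
        "{..<ns ! j}" "{..<ns ! j}"] by (simp add: case_prod_unfold)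
  finally show ?thesis .
qed

lemma mat_unit_induct:
  fixes A :: "complex mat"
  assumes A: "A \<in> carrier_mat n m" and zero: "P (0\<^sub>m n m)"
    and step: "\<And>X c s p. X \<in> carrier_mat n m \<Longrightarrow> P X \<Longrightarrow> s < n \<Longrightarrow> p < m \<Longrightarrow>
      P (X + c \<cdot>\<^sub>m mat n m (\<lambda>(s', p'). of_bool (s' = s \<and> p' = p)))"
  shows "P A"
proof -
  have "P (mat n m (\<lambda>x. if x \<in> J then A $$ x else 0))" if "finite J" "J \<subseteq> {..<n} \<times> {..<m}" for J
    using that
  proof (induction J rule: finite_induct)
    case empty
    have "mat n m (\<lambda>x. if x \<in> {} then A $$ x else 0) = 0\<^sub>m n m" by auto
    then show ?case using zero by simp
  next
    case (insert x J)
    obtain s p where x: "x = (s, p)" by (cases x)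
    have "mat n m (\<lambda>y. if y \<in> insert x J then A $$ y else 0) =
      mat n m (\<lambda>y. if y \<in> J then A $$ y else 0) +
      A $$ (s, p) \<cdot>\<^sub>m mat n m (\<lambda>(s', p'). of_bool (s' = s \<and> p' = p))"
      using insert.hyps x by (intro eq_matI) auto
    then show ?case using insert x by (simp add: step)
  qed
  from this[of "{..<n} \<times> {..<m}"] have "P (mat n m (\<lambda>x. if x \<in> {..<n} \<times> {..<m} then A $$ x else 0))"
    by simp
  moreover have "mat n m (\<lambda>x. if x \<in> {..<n} \<times> {..<m} then A $$ x else 0) = A"
    using A by (intro eq_matI) auto
  ultimately show ?thesis by simp
qed

lemma interlace_snoc:
  assumes "length As = Suc (length Zs)"
  shows "interlace (As @ [A]) (Zs @ [Z]) = interlace As Zs * Z * A"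
proof -
  obtain B Bs where "As = B # Bs" "length Bs = length Zs" using assms by (cases As) auto
  then show ?thesis by (simp add: interlace_def)
qed

lemma interlace_carrier:
  assumes "length ns = Suc k" "length As = Suc k" "\<And>l. l \<le> k \<Longrightarrow> As ! l \<in> carrier_mat (ns ! l) (ns ! l)"
    "Zs \<in> ztuples ns"
  shows "interlace As Zs \<in> carrier_mat (ns ! 0) (ns ! k)"
  using assms
proof (induction k arbitrary: ns As Zs)
  case 0
  then obtain A where "As = [A]" by (auto simp: length_Suc_conv)
  moreover have "Zs = []" using 0 by (auto simp: ztuples_def)
  ultimately show ?case using 0(3)[of 0] by (simp add: interlace_def)
next
  case (Suc k)
  have Zs: "length Zs = Suc k" using Suc.prems by (auto simp: ztuples_def)
  obtain As' A where As: "As = As' @ [A]" using Suc.prems by (cases As rule: rev_cases) auto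
  obtain Zs' Z where Zs': "Zs = Zs' @ [Z]" using Zs by (cases Zs rule: rev_cases) auto
  have "interlace As' Zs' \<in> carrier_mat (butlast ns ! 0) (butlast ns ! k)"
  proof (rule Suc.IH)
    show "As' ! l \<in> carrier_mat (butlast ns ! l) (butlast ns ! l)" if "l \<le> k" for l
      using Suc.prems(3)[of l] that Suc.prems(1,2) by (simp add: As nth_append nth_butlast)
    have "Zs' ! l \<in> carrier_mat (butlast ns ! l) (butlast ns ! Suc l)" if "l < k" for l
      using ztuplesD(2)[OF Suc.prems(4), of l] that Suc.prems(1) Zs by (simp add: Zs' nth_append nth_butlast)
    then show "Zs' \<in> ztuples (butlast ns)" using Zs Zs' Suc.prems(1) by (auto simp: ztuples_def)
  qed (use Suc.prems As in auto)
  moreover have "A \<in> carrier_mat (ns ! Suc k) (ns ! Suc k)"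
    using Suc.prems(3)[of "Suc k"] Suc.prems(2) As by (simp add: nth_append)
  moreover have "Z \<in> carrier_mat (ns ! k) (ns ! Suc k)"
    using ztuplesD(2)[OF Suc.prems(4), of k] Suc.prems(1) Zs Zs' by (simp add: nth_append)
  ultimately show ?case
    using Suc.prems(1,2) As Zs' Zs by (simp add: interlace_snoc nth_butlast)
qed

text \<open>Splitting off the last slot, or only the last boundary factor. The product over \<open>l \<le> k\<close>
  does not involve the last boundary factor, so the \<open>0\<close> in its frame is arbitrary.\<close>

lemma weight_snoc:
  assumes "length ps = Suc k" "length Zs = k"
  shows "weight (frame a b (Zs @ [Z])) (ps @ [(p, q)]) =
      (\<Prod>l\<le>k. frame a 0 Zs l (out_index ps l) (in_index ps l)) * Z $$ (snd (ps ! k), p) * of_bool (q = b)"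
    and "weight (frame a c Zs) ps =
      (\<Prod>l\<le>k. frame a 0 Zs l (out_index ps l) (in_index ps l)) * of_bool (snd (ps ! k) = c)"
proof -
  have "frame a b (Zs @ [Z]) l (out_index (ps @ [(p, q)]) l) (in_index (ps @ [(p, q)]) l) =
      frame a 0 Zs l (out_index ps l) (in_index ps l)" if "l \<le> k" for l
    using that assms by (auto simp: frame_def out_index_def in_index_def nth_append)
  moreover have "frame a b (Zs @ [Z]) (Suc k) (out_index (ps @ [(p, q)]) (Suc k)) (in_index (ps @ [(p, q)]) (Suc k)) =
      Z $$ (snd (ps ! k), p)"
    using assms by (auto simp: frame_def out_index_def in_index_def nth_append)
  moreover have "frame a b (Zs @ [Z]) (Suc (Suc k)) (out_index (ps @ [(p, q)]) (Suc (Suc k))) (in_index (ps @ [(p, q)]) (Suc (Suc k))) =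
      of_bool (q = b)"
    using assms by (auto simp: frame_def out_index_def in_index_def nth_append)
  ultimately show "weight (frame a b (Zs @ [Z])) (ps @ [(p, q)]) =
      (\<Prod>l\<le>k. frame a 0 Zs l (out_index ps l) (in_index ps l)) * Z $$ (snd (ps ! k), p) * of_bool (q = b)"
    using assms by (simp add: weight_def)
  have "frame a c Zs l (out_index ps l) (in_index ps l) =
      frame a 0 Zs l (out_index ps l) (in_index ps l)" if "l \<le> k" for l
    using that assms by (auto simp: frame_def)
  moreover have "frame a c Zs (Suc k) (out_index ps (Suc k)) (in_index ps (Suc k)) = of_bool (snd (ps ! k) = c)"
    using assms by (auto simp: frame_def out_index_def)
  ultimately show "weight (frame a c Zs) ps =
      (\<Prod>l\<le>k. frame a 0 Zs l (out_index ps l) (in_index ps l)) * of_bool (snd (ps ! k) = c)"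
    using assms by (simp add: weight_def)
qed

text \<open>The interlaced product as a contraction of \<open>A\<^sub>0 \<otimes> \<dots> \<otimes> A\<^sub>k\<close>.\<close>

lemma interlace_entry:
  assumes "length ns = Suc k" "length As = Suc k" "\<And>l. l \<le> k \<Longrightarrow> As ! l \<in> carrier_mat (ns ! l) (ns ! l)"
    "Zs \<in> ztuples ns" "a < ns ! 0" "b < ns ! k"
  shows "interlace As Zs $$ (a, b) =
    (\<Sum>ps\<in>tensor_index ns. weight (frame a b Zs) ps * (\<Prod>l<length As. As ! l $$ (ps ! l)))"
  using assms
proof (induction k arbitrary: ns As Zs b)
  case 0
  then obtain A where A: "As = [A]" by (auto simp: length_Suc_conv)
  obtain n where n: "ns = [n]" using 0 by (auto simp: length_Suc_conv)
  have Zs: "Zs = []" using 0 by (auto simp: ztuples_def)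
  have "weight (frame a b []) [(p, q)] = of_bool (p = a) * of_bool (q = b)" for p q
    using frame_simps(2)[of a b "[]"] by (simp add: weight_def out_index_def in_index_def)
  moreover have "tensor_index [] = {[]}" by (auto simp: tensor_index_def)
  ultimately have "(\<Sum>ps\<in>tensor_index ns. weight (frame a b Zs) ps * (\<Prod>l<length As. As ! l $$ (ps ! l))) =
    (\<Sum>p<n. \<Sum>q<n. of_bool (p = a) * of_bool (q = b) * A $$ (p, q))"
    by (subst sum_tensor_index_slot[of 0]) (simp_all add: n A Zs)
  also have "\<dots> = (\<Sum>p<n. if p = a then \<Sum>q<n. if q = b then A $$ (p, q) else 0 else 0)"
    by (intro sum.cong) auto
  also have "\<dots> = A $$ (a, b)"
    using 0 n by simp
  finally show ?case using A Zs by (simp add: interlace_def)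
next
  case (Suc k)
  have Zs: "length Zs = Suc k" using Suc.prems by (auto simp: ztuples_def)
  obtain As' A where As: "As = As' @ [A]" using Suc.prems by (cases As rule: rev_cases) auto
  obtain Zs' Z where Zs': "Zs = Zs' @ [Z]" using Zs by (cases Zs rule: rev_cases) auto
  obtain ns' n where ns: "ns = ns' @ [n]" using Suc.prems by (cases ns rule: rev_cases) auto
  have lens: "length As' = Suc k" "length Zs' = k" "length ns' = Suc k"
    using Suc.prems As Zs' Zs ns by auto
  have As': "As' ! l \<in> carrier_mat (ns' ! l) (ns' ! l)" if "l \<le> k" for l
    using Suc.prems(3)[of l] that lens by (simp add: As ns nth_append)
  have "Zs' ! l \<in> carrier_mat (ns' ! l) (ns' ! Suc l)" if "l < k" for l
    using ztuplesD(2)[OF Suc.prems(4), of l] that lens by (simp add: Zs' ns nth_append)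
  then have Zt: "Zs' \<in> ztuples ns'" using lens by (auto simp: ztuples_def)
  have A: "A \<in> carrier_mat n n"
    using Suc.prems(3)[of "Suc k"] lens As ns by (simp add: nth_append)
  have Z: "Z \<in> carrier_mat (ns' ! k) n"
    using ztuplesD(2)[OF Suc.prems(4), of k] lens Zs' ns by (simp add: nth_append)
  have a: "a < ns' ! 0" and b: "b < n" using Suc.prems(5,6) ns lens by (simp_all add: nth_append)
  have I: "interlace As' Zs' \<in> carrier_mat (ns' ! 0) (ns' ! k)"
    by (rule interlace_carrier[OF lens(3) lens(1) As' Zt])
  let ?W = "\<lambda>ps. \<Prod>l\<le>k. frame a 0 Zs' l (out_index ps l) (in_index ps l)"
  let ?A = "\<lambda>ps. \<Prod>l<Suc k. As' ! l $$ (ps ! l)"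
  have "interlace As Zs $$ (a, b) =
      (\<Sum>p<n. (\<Sum>c<ns' ! k. interlace As' Zs' $$ (a, c) * Z $$ (c, p)) * A $$ (p, b))"
  proof -
    have "(interlace As' Zs' * Z) $$ (a, p) = (\<Sum>c<ns' ! k. interlace As' Zs' $$ (a, c) * Z $$ (c, p))"
      if "p < n" for p
      using I Z a that by (simp add: scalar_prod_def atLeast0LessThan)
    moreover have "(interlace As' Zs' * Z) \<in> carrier_mat (ns' ! 0) n" using I Z by simp
    then have "(interlace As' Zs' * Z * A) $$ (a, b) = (\<Sum>p<n. (interlace As' Zs' * Z) $$ (a, p) * A $$ (p, b))"
      using A I Z a b by (simp add: scalar_prod_def atLeast0LessThan del: assoc_mult_mat)
    ultimately show ?thesis using lens by (simp add: As Zs' interlace_snoc del: assoc_mult_mat)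
  qed
  also have "\<dots> = (\<Sum>p<n. (\<Sum>c<ns' ! k. (\<Sum>ps\<in>tensor_index ns'. ?W ps * of_bool (snd (ps ! k) = c) * ?A ps) *
      Z $$ (c, p)) * A $$ (p, b))"
  proof -
    have "interlace As' Zs' $$ (a, c) = (\<Sum>ps\<in>tensor_index ns'. ?W ps * of_bool (snd (ps ! k) = c) * ?A ps)"
      if "c < ns' ! k" for c
    proof -
      have "interlace As' Zs' $$ (a, c) =
          (\<Sum>ps\<in>tensor_index ns'. weight (frame a c Zs') ps * (\<Prod>l<length As'. As' ! l $$ (ps ! l)))"
        by (rule Suc.IH[OF lens(3) lens(1) As' Zt a that])
      also have "\<dots> = (\<Sum>ps\<in>tensor_index ns'. ?W ps * of_bool (snd (ps ! k) = c) * ?A ps)"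
      proof (rule sum.cong[OF refl])
        fix ps assume "ps \<in> tensor_index ns'"
        then have "length ps = Suc k" using lens(3) tensor_index_length by metis
        from weight_snoc(2)[OF this lens(2)]
        show "weight (frame a c Zs') ps * (\<Prod>l<length As'. As' ! l $$ (ps ! l)) =
          ?W ps * of_bool (snd (ps ! k) = c) * ?A ps" by (simp only: lens(1))
      qed
      finally show ?thesis .
    qed
    then show ?thesis by simp
  qed
  also have "\<dots> = (\<Sum>p<n. \<Sum>ps\<in>tensor_index ns'. ?W ps * Z $$ (snd (ps ! k), p) * (?A ps * A $$ (p, b)))"
  proof (rule sum.cong[OF refl])
    fix p
    have "(\<Sum>c<ns' ! k. (\<Sum>ps\<in>tensor_index ns'. ?W ps * of_bool (snd (ps ! k) = c) * ?A ps) * Z $$ (c, p)) =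
       (\<Sum>ps\<in>tensor_index ns'. \<Sum>c<ns' ! k. ?W ps * of_bool (snd (ps ! k) = c) * ?A ps * Z $$ (c, p))"
      by (subst sum.swap) (simp only: sum_distrib_right)
    also have "\<dots> = (\<Sum>ps\<in>tensor_index ns'. ?W ps * ?A ps * Z $$ (snd (ps ! k), p))"
    proof (rule sum.cong[OF refl])
      fix ps assume "ps \<in> tensor_index ns'"
      then have "snd (ps ! k) < ns' ! k" using lens by (simp add: tensor_index_def)
      moreover have "(\<Sum>c<ns' ! k. ?W ps * of_bool (snd (ps ! k) = c) * ?A ps * Z $$ (c, p)) =
        (\<Sum>c<ns' ! k. if snd (ps ! k) = c then ?W ps * ?A ps * Z $$ (c, p) else 0)"
        by (rule sum.cong) auto
      ultimately show "(\<Sum>c<ns' ! k. ?W ps * of_bool (snd (ps ! k) = c) * ?A ps * Z $$ (c, p)) =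
        ?W ps * ?A ps * Z $$ (snd (ps ! k), p)" by simp
    qed
    finally have e: "(\<Sum>c<ns' ! k. (\<Sum>ps\<in>tensor_index ns'. ?W ps * of_bool (snd (ps ! k) = c) * ?A ps) * Z $$ (c, p)) =
       (\<Sum>ps\<in>tensor_index ns'. ?W ps * ?A ps * Z $$ (snd (ps ! k), p))" .
    show "(\<Sum>c<ns' ! k. (\<Sum>ps\<in>tensor_index ns'. ?W ps * of_bool (snd (ps ! k) = c) * ?A ps) * Z $$ (c, p))
        * A $$ (p, b) = (\<Sum>ps\<in>tensor_index ns'. ?W ps * Z $$ (snd (ps ! k), p) * (?A ps * A $$ (p, b)))"
      unfolding e unfolding sum_distrib_right by (intro sum.cong refl) (simp only: mult_ac)
  qed
  also have "\<dots> = (\<Sum>p<n. \<Sum>q<n. \<Sum>ps\<in>tensor_index ns'.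
      ?W ps * Z $$ (snd (ps ! k), p) * of_bool (q = b) * (?A ps * A $$ (p, q)))"
  proof (rule sum.cong[OF refl])
    fix p
    have "(\<Sum>q<n. \<Sum>ps\<in>tensor_index ns'. ?W ps * Z $$ (snd (ps ! k), p) * of_bool (q = b) * (?A ps * A $$ (p, q))) =
      (\<Sum>q<n. if q = b then \<Sum>ps\<in>tensor_index ns'. ?W ps * Z $$ (snd (ps ! k), p) * (?A ps * A $$ (p, q)) else 0)"
      by (rule sum.cong) auto
    also have "\<dots> = (\<Sum>ps\<in>tensor_index ns'. ?W ps * Z $$ (snd (ps ! k), p) * (?A ps * A $$ (p, b)))"
      using b by simp
    finally show "(\<Sum>ps\<in>tensor_index ns'. ?W ps * Z $$ (snd (ps ! k), p) * (?A ps * A $$ (p, b))) =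
      (\<Sum>q<n. \<Sum>ps\<in>tensor_index ns'. ?W ps * Z $$ (snd (ps ! k), p) * of_bool (q = b) * (?A ps * A $$ (p, q)))"
      by simp
  qed
  also have "\<dots> = (\<Sum>p<n. \<Sum>q<n. \<Sum>ps\<in>tensor_index ns'.
      weight (frame a b Zs) (ps @ [(p, q)]) * (\<Prod>l<length As. As ! l $$ ((ps @ [(p, q)]) ! l)))"
  proof (intro sum.cong refl)
    fix p q ps assume "ps \<in> tensor_index ns'"
    then have ps: "length ps = Suc k" using lens tensor_index_length by metis
    have "(\<Prod>l<length As. As ! l $$ ((ps @ [(p, q)]) ! l)) = ?A ps * A $$ (p, q)"
      using ps lens by (simp add: As nth_append)
    then show "?W ps * Z $$ (snd (ps ! k), p) * of_bool (q = b) * (?A ps * A $$ (p, q)) =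
      weight (frame a b Zs) (ps @ [(p, q)]) * (\<Prod>l<length As. As ! l $$ ((ps @ [(p, q)]) ! l))"
      using weight_snoc(1)[OF ps lens(2)] Zs' by simp
  qed
  also have "\<dots> = (\<Sum>ps\<in>tensor_index ns. weight (frame a b Zs) ps * (\<Prod>l<length As. As ! l $$ (ps ! l)))"
  proof -
    have k: "Suc k < length ns" "remove_nth (Suc k) ns = ns'" "ns ! Suc k = n"
      using lens by (simp_all add: ns nth_append)
    show ?thesis
      unfolding sum_tensor_index_slot[OF k(1)] k(2,3)
      using lens by (intro sum.cong refl) (auto simp: tensor_index_length)
  qed
  finally show ?case .
qed

section \<open>The explicit form of the isomorphism\<close>

context
  fixes sN :: "complex \<Rightarrow> 'n::ab_group_add \<Rightarrow> 'n"
  assumes vector_space_sN: "vector_space sN"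
begin

interpretation N: vector_space sN by (rule vector_space_sN)

lemma contract_unit_tuple:
  assumes "length ns = Suc k" and ps: "ps \<in> tensor_index ns"
  shows "contract sN ns (frame (fst (ps ! 0)) (snd (ps ! k)) (unit_tuple ns ps)) T = T ps"
proof -
  have "contract sN ns (frame (fst (ps ! 0)) (snd (ps ! k)) (unit_tuple ns ps)) T =
    (\<Sum>qs\<in>tensor_index ns. if qs = ps then T qs else 0)"
    unfolding contract_def
    by (rule sum.cong) (use weight_unit_tuple[OF assms] N.scale_zero_left N.scale_one in auto)
  then show ?thesis using ps by simp
qed

lemma hom_space_carrier:
  assumes "\<phi> \<in> hom_space sN ns" "length ns = Suc k" "Zs \<in> ztuples ns"
  shows "\<phi> Zs \<in> carrier_mat (ns ! 0) (ns ! k)"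
proof -
  have "ns \<noteq> []" using assms by auto
  then have "hd ns = ns ! 0" "last ns = ns ! k" using assms(2) by (simp_all add: hd_conv_nth last_conv_nth)
  then show ?thesis using assms by (auto simp: hom_space_def)
qed

text \<open>A multilinear map is determined by its values on tuples of matrix units. Only one entry is
  needed at each index, because the tuple of matrix units does not depend on \<open>p\<^sub>0\<close> and \<open>q\<^sub>k\<close>.\<close>

lemma hom_space_eqI:
  assumes len: "length ns = Suc k" and \<phi>: "\<phi> \<in> hom_space sN ns" and \<psi>: "\<psi> \<in> hom_space sN ns"
    and eq: "\<And>ps. ps \<in> tensor_index ns \<Longrightarrow>
      \<phi> (unit_tuple ns ps) $$ (fst (ps ! 0), snd (ps ! k)) = \<psi> (unit_tuple ns ps) $$ (fst (ps ! 0), snd (ps ! k))"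
  shows "\<phi> = \<psi>"
proof (rule extensionalityI[of _ "ztuples ns"])
  show "\<phi> \<in> extensional (ztuples ns)" "\<psi> \<in> extensional (ztuples ns)"
    using \<phi> \<psi> by (auto simp: hom_space_def PiE_iff)
  fix Zs assume Zs: "Zs \<in> ztuples ns"
  let ?U = "\<lambda>l s p. mat (ns ! l) (ns ! Suc l) (\<lambda>(s', p'). of_bool (s' = s \<and> p' = p)) :: complex mat"
  have "\<phi> Zs $$ (a, b) = \<psi> Zs $$ (a, b)" if ab: "a < ns ! 0" "b < ns ! k" for a b
  proof -
    \<comment> \<open>The matrices at positions below \<open>m\<close> are arbitrary, the other ones are matrix units.\<close>
    have "\<phi> Zs $$ (a, b) = \<psi> Zs $$ (a, b)"
      if "m \<le> k" "Zs \<in> ztuples ns"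
        "\<And>l. m \<le> l \<Longrightarrow> l < k \<Longrightarrow> \<exists>s<ns ! l. \<exists>p<ns ! Suc l. Zs ! l = ?U l s p" for m Zs
      using that
    proof (induction m arbitrary: Zs)
      case 0
      then have "\<forall>l. \<exists>s p. l < k \<longrightarrow> s < ns ! l \<and> p < ns ! Suc l \<and> Zs ! l = ?U l s p" by blast
      then obtain s p where sp: "\<And>l. l < k \<Longrightarrow> s l < ns ! l \<and> p l < ns ! Suc l \<and> Zs ! l = ?U l (s l) (p l)"
        by metis
      define ps where "ps = map (\<lambda>l. (if l = 0 then a else p (l - 1), if l = k then b else s l)) [0..<Suc k]"
      have psn: "ps ! l = (if l = 0 then a else p (l - 1), if l = k then b else s l)" if "l \<le> k" for l
        using that unfolding ps_def by (subst nth_map) (simp_all del: upt_Suc)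
      have psl: "length ps = Suc k" by (simp add: ps_def)
      have "fst (ps ! l) < ns ! l" "snd (ps ! l) < ns ! l" if "l \<le> k" for l
        using that ab sp[of l] sp[of "l - 1"] by (auto simp: psn)
      then have ps: "ps \<in> tensor_index ns" using len psl by (simp add: tensor_index_def less_Suc_eq_le)
      have "unit_tuple ns ps = Zs"
        using ztuplesD(1)[OF 0(2)] len sp by (intro nth_equalityI) (auto simp: unit_tuple_def psn)
      then show ?case using eq[OF ps] by (simp add: psn)
    next
      case (Suc m)
      let ?n = "ns ! m" and ?n' = "ns ! Suc m"
      have lenZ: "length Zs = k" using ztuplesD(1)[OF Suc.prems(2)] len by simp
      have Zm: "Zs ! m \<in> carrier_mat ?n ?n'" using ztuplesD(2)[OF Suc.prems(2), of m] len Suc.prems(1) by simp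
      let ?P = "\<lambda>X. \<phi> (Zs[m := X]) $$ (a, b) = \<psi> (Zs[m := X]) $$ (a, b)"
      have m: "m < length ns - 1" using len Suc.prems(1) by simp
      have lin: "\<chi> (Zs[m := X + c \<cdot>\<^sub>m Y]) $$ (a, b) = \<chi> (Zs[m := X]) $$ (a, b) + sN c (\<chi> (Zs[m := Y]) $$ (a, b))"
        if \<chi>: "\<chi> \<in> hom_space sN ns" and X: "X \<in> carrier_mat ?n ?n'" and Y: "Y \<in> carrier_mat ?n ?n'" for \<chi> X Y c
      proof -
        have cY: "c \<cdot>\<^sub>m Y \<in> carrier_mat ?n ?n'" using Y by simp
        have "\<chi> (Zs[m := X + c \<cdot>\<^sub>m Y]) = \<chi> (Zs[m := X]) + \<chi> (Zs[m := c \<cdot>\<^sub>m Y])"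
          using \<chi> Suc.prems(2) m X cY unfolding hom_space_def by blast
        moreover have "\<chi> (Zs[m := c \<cdot>\<^sub>m Y]) = map_mat (sN c) (\<chi> (Zs[m := Y]))"
          using \<chi> Suc.prems(2) m Y unfolding hom_space_def by blast
        ultimately show ?thesis
          using hom_space_carrier[OF \<chi> len ztuples_update[OF Suc.prems(2) X]]
            hom_space_carrier[OF \<chi> len ztuples_update[OF Suc.prems(2) Y]] ab by simp
      qed
      have "?P (Zs ! m)"
      proof (rule mat_unit_induct[OF Zm])
        have z: "(0\<^sub>m ?n ?n' :: complex mat) \<in> carrier_mat ?n ?n'" by simp
        have "\<chi> (Zs[m := 0\<^sub>m ?n ?n']) $$ (a, b) = 0" if "\<chi> \<in> hom_space sN ns" for \<chi>
          \<comment> \<open>Since \<open>0 + 1 \<cdot> 0 = 0\<close>, the value at \<open>0\<close> equals its double.\<close>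
          using lin[OF that z z, of 1] by (simp add: N.scale_one)
        then show "?P (0\<^sub>m ?n ?n')" using \<phi> \<psi> by simp
      next
        fix X :: "complex mat" and c s p
        assume X: "X \<in> carrier_mat ?n ?n'" and PX: "?P X" and sp: "s < ?n" "p < ?n'"
        have U: "?U m s p \<in> carrier_mat ?n ?n'" by simp
        have "?P (?U m s p)"
        proof (rule Suc.IH)
          show "Zs[m := ?U m s p] \<in> ztuples ns" by (rule ztuples_update[OF Suc.prems(2) U])
          show "\<exists>s'<ns ! l. \<exists>p'<ns ! Suc l. Zs[m := ?U m s p] ! l = ?U l s' p'" if "m \<le> l" "l < k" for l
          proof (cases "l = m")
            case True
            then show ?thesis using sp lenZ that by auto
          next
            case False
            then show ?thesis using Suc.prems(3)[of l] that by simp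
          qed
        qed (use Suc.prems(1) in simp)
        then show "?P (X + c \<cdot>\<^sub>m ?U m s p)"
          using lin[OF \<phi> X U] lin[OF \<psi> X U] PX by simp
      qed
      then show ?case by simp
    qed
    from this[of k Zs] Zs show ?thesis by simp
  qed
  then show "\<phi> Zs = \<psi> Zs"
    using hom_space_carrier[OF \<phi> len Zs] hom_space_carrier[OF \<psi> len Zs] by (intro eq_matI) auto
qed

lemma contraction_unit_tuple:
  assumes len: "length ns = Suc k" and ps: "ps \<in> tensor_index ns"
  shows "contraction sN ns T (unit_tuple ns ps) $$ (fst (ps ! 0), snd (ps ! k)) = T ps"
proof -
  have "fst (ps ! 0) < ns ! 0" "snd (ps ! k) < ns ! k" using ps len by (auto simp: tensor_index_def)
  then show ?thesis using contraction_entry[OF vector_space_sN len unit_tuple_ztuples] contract_unit_tuple[OF len ps] by simp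
qed

lemma contraction_bij:
  assumes len: "length ns = Suc k"
  shows "bij_betw (contraction sN ns) (tensor_space ns) (hom_space sN ns)"
proof (rule bij_betw_imageI)
  show "inj_on (contraction sN ns) (tensor_space ns)"
  proof (rule inj_onI, rule ext)
    fix T T' :: "'n tensor" and ps
    assume T: "T \<in> tensor_space ns" "T' \<in> tensor_space ns" and e: "contraction sN ns T = contraction sN ns T'"
    show "T ps = T' ps"
    proof (cases "ps \<in> tensor_index ns")
      case True
      then show ?thesis using contraction_unit_tuple[OF len True, of T] contraction_unit_tuple[OF len True, of T'] e by simp
    next
      case False
      then show ?thesis using T by (simp add: tensor_space_def)
    qed
  qed
  show "contraction sN ns ` tensor_space ns = hom_space sN ns"
  proof (intro equalityI subsetI)
    fix \<phi> assume \<phi>: "\<phi> \<in> hom_space sN ns"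
    define T where "T = (\<lambda>ps. if ps \<in> tensor_index ns then \<phi> (unit_tuple ns ps) $$ (fst (ps ! 0), snd (ps ! k)) else 0)"
    have "contraction sN ns T = \<phi>"
      by (rule hom_space_eqI[OF len contraction_multilinear[OF vector_space_sN len] \<phi>])
        (simp add: contraction_unit_tuple[OF len] T_def)
    moreover have "T \<in> tensor_space ns" by (simp add: T_def tensor_space_def)
    ultimately show "\<phi> \<in> contraction sN ns ` tensor_space ns" by blast
  qed (auto intro: contraction_multilinear[OF vector_space_sN len])
qed

lemma contract_add: "contract sN ns R (T + T') = contract sN ns R T + contract sN ns R T'"
  by (simp add: contract_def N.scale_right_distrib sum.distrib)

lemma contract_scale: "contract sN ns R (tensor_scale sN c T) = sN c (contract sN ns R T)"
  by (simp add: contract_def tensor_scale_def N.scale_sum_right mult.commute)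

lemma contraction_extensional: "contraction sN ns T \<in> extensional (ztuples ns)"
  unfolding contraction_def by (rule restrict_extensional)

lemma contraction_add: "contraction sN ns (T + T') = hom_add ns (contraction sN ns T) (contraction sN ns T')"
  unfolding contraction_def hom_add_def
  by (rule restrict_ext) (simp add: contract_add, rule eq_matI, simp_all)

lemma contraction_scale: "contraction sN ns (tensor_scale sN c T) = hom_scale sN ns c (contraction sN ns T)"
  unfolding contraction_def hom_scale_def
  by (rule restrict_ext) (simp add: contract_scale, rule eq_matI, simp_all)

lemma tensor_space_add: "T \<in> tensor_space ns \<Longrightarrow> T' \<in> tensor_space ns \<Longrightarrow> T + T' \<in> tensor_space ns"
  for T :: "'n tensor"
  by (simp add: tensor_space_def)

lemma tensor_space_scale: "T \<in> tensor_space ns \<Longrightarrow> tensor_scale sN c T \<in> tensor_space ns"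
  by (simp add: tensor_space_def tensor_scale_def)

lemma contraction_elem_tensor:
  assumes len: "length ns = Suc k" and As: "length As = length ns"
    "\<And>l. l < length ns \<Longrightarrow> As ! l \<in> carrier_mat (ns ! l) (ns ! l)" and Zs: "Zs \<in> ztuples ns"
  shows "contraction sN ns (elem_tensor sN As v) Zs = map_mat (\<lambda>x. sN x v) (interlace As Zs)"
proof -
  have As': "length As = Suc k" "\<And>l. l \<le> k \<Longrightarrow> As ! l \<in> carrier_mat (ns ! l) (ns ! l)"
    using len As by auto
  have I: "interlace As Zs \<in> carrier_mat (ns ! 0) (ns ! k)" by (rule interlace_carrier[OF len As' Zs])
  have dims: "map dim_row As = ns" using As by (intro nth_equalityI) auto
  show ?thesis
  proof (rule eq_matI)
    fix a b assume "a < dim_row (map_mat (\<lambda>x. sN x v) (interlace As Zs))" "b < dim_col (map_mat (\<lambda>x. sN x v) (interlace As Zs))"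
    then have ab: "a < ns ! 0" "b < ns ! k" using I by auto
    show "contraction sN ns (elem_tensor sN As v) Zs $$ (a, b) = map_mat (\<lambda>x. sN x v) (interlace As Zs) $$ (a, b)"
      using I ab by (simp add: contraction_entry[OF vector_space_sN len Zs ab] interlace_entry[OF len As' Zs ab] contract_def
          elem_tensor_def dims N.scale_sum_left cong: sum.cong)
  qed (use I contraction_carrier[OF vector_space_sN len Zs, of "elem_tensor sN As v"] in auto)
qed

text \<open>The elementary tensors span the space of tensors.\<close>

lemma tensor_space_induct [consumes 1, case_names generator add]:
  fixes T :: "'n tensor"
  assumes T: "T \<in> tensor_space ns"
    and generator: "\<And>As v. length As = length ns \<Longrightarrow> (\<And>l. l < length ns \<Longrightarrow> As ! l \<in> carrier_mat (ns ! l) (ns ! l)) \<Longrightarrow>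
      P (elem_tensor sN As v)"
    and add: "\<And>T T'. T \<in> tensor_space ns \<Longrightarrow> T' \<in> tensor_space ns \<Longrightarrow> P T \<Longrightarrow> P T' \<Longrightarrow> P (T + T')"
  shows "P T"
proof -
  define E where "E = (\<lambda>ps. map (\<lambda>l. mat (ns ! l) (ns ! l) (\<lambda>x. of_bool (x = ps ! l)) :: complex mat) [0..<length ns])"
  have E: "length (E ps) = length ns" "\<And>l. l < length ns \<Longrightarrow> E ps ! l \<in> carrier_mat (ns ! l) (ns ! l)" for ps
    by (simp_all add: E_def)
  have dims: "map dim_row (E ps) = ns" for ps using E by (intro nth_equalityI) (auto simp: E_def)
  have elemE: "elem_tensor sN (E ps) v = (\<lambda>qs. if qs = ps then v else 0)" if ps: "ps \<in> tensor_index ns" for ps and v :: 'n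
  proof
    fix qs
    show "elem_tensor sN (E ps) v qs = (if qs = ps then v else 0)"
    proof (cases "qs \<in> tensor_index ns")
      case True
      have e: "E ps ! l $$ (qs ! l) = of_bool (qs ! l = ps ! l)" if "l < length ns" for l
      proof -
        obtain x y where xy: "qs ! l = (x, y)" by (cases "qs ! l")
        then have "x < ns ! l" "y < ns ! l" using True that by (auto simp: tensor_index_def)
        then show ?thesis using that unfolding E_def xy by simp
      qed
      have "(\<Prod>l<length ns. E ps ! l $$ (qs ! l)) = of_bool (qs = ps)"
      proof (cases "qs = ps")
        case False
        then obtain l where "l < length ns" "qs ! l \<noteq> ps ! l"
          using tensor_index_length[OF True] tensor_index_length[OF ps] by (auto simp: list_eq_iff_nth_eq)
        then have "(\<Prod>l<length ns. E ps ! l $$ (qs ! l)) = 0" using e by (intro prod_zero) auto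
        then show ?thesis using False by simp
      qed (use e in simp)
      then show ?thesis using True by (simp add: elem_tensor_def dims E(1) N.scale_one)
    qed (use ps in \<open>auto simp: elem_tensor_def dims\<close>)
  qed
  have "P (\<lambda>ps. if ps \<in> J then T ps else 0)" if "finite J" "J \<subseteq> tensor_index ns" for J
    using that
  proof (induction J rule: finite_induct)
    case empty
    \<comment> \<open>The matrices are irrelevant here, since the vector is \<open>0\<close>.\<close>
    have "elem_tensor sN (E []) (0::'n) = (\<lambda>ps. 0)" by (simp add: elem_tensor_def fun_eq_iff)
    then show ?case using generator[OF E, of "[]" 0] by simp
  next
    case (insert ps J)
    have "(\<lambda>qs. if qs \<in> insert ps J then T qs else 0) =
        (\<lambda>qs. if qs \<in> J then T qs else 0) + elem_tensor sN (E ps) (T ps)"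
      using insert.hyps insert.prems elemE by (auto simp: fun_eq_iff)
    moreover have "P ((\<lambda>qs. if qs \<in> J then T qs else 0) + elem_tensor sN (E ps) (T ps))"
    proof (rule add)
      show "(\<lambda>qs. if qs \<in> J then T qs else 0) \<in> tensor_space ns" using insert.prems by (auto simp: tensor_space_def)
      show "elem_tensor sN (E ps) (T ps) \<in> tensor_space ns" by (simp add: tensor_space_def elem_tensor_def dims)
    qed (use insert generator[OF E] in auto)
    ultimately show ?case by simp
  qed
  from this[of "tensor_index ns"] have "P (\<lambda>ps. if ps \<in> tensor_index ns then T ps else 0)" by simp
  moreover have "(\<lambda>ps. if ps \<in> tensor_index ns then T ps else 0) = T" using T by (auto simp: tensor_space_def)
  ultimately show ?thesis by simp
qed

lemma contraction_linear_iso: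
  assumes len: "length ns = Suc k"
  shows "linear_iso (+) (tensor_scale sN) (tensor_space ns) (hom_add ns) (hom_scale sN ns) (hom_space sN ns)
    (restrict (contraction sN ns) (tensor_space ns))"
  using contraction_bij[OF len] tensor_space_add tensor_space_scale
  by (auto simp: linear_iso_def contraction_add contraction_scale bij_betw_restrict_eq)

text \<open>Uniqueness in the definition of \<open>iota_inv\<close> holds because a linear map is determined by its
  values on elementary tensors.\<close>

lemma iota_inv_eq_contraction:
  assumes len: "length ns = Suc k"
  shows "iota_inv sN ns = restrict (contraction sN ns) (tensor_space ns)"
  unfolding iota_inv_def
proof (rule the_equality)
  have elem: "elem_tensor sN As v \<in> tensor_space ns"
    if "length As = length ns \<and> (\<forall>l<length ns. As ! l \<in> carrier_mat (ns ! l) (ns ! l))" for As v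
  proof -
    have "map dim_row As = ns" using that by (intro nth_equalityI) auto
    then show ?thesis by (simp add: tensor_space_def elem_tensor_def)
  qed
  show "restrict (contraction sN ns) (tensor_space ns) \<in> extensional (tensor_space ns) \<and>
    linear_iso (+) (tensor_scale sN) (tensor_space ns) (hom_add ns) (hom_scale sN ns) (hom_space sN ns)
      (restrict (contraction sN ns) (tensor_space ns)) \<and>
    (\<forall>As v. length As = length ns \<and> (\<forall>l<length ns. As ! l \<in> carrier_mat (ns ! l) (ns ! l)) \<longrightarrow>
        (\<forall>Zs\<in>ztuples ns. restrict (contraction sN ns) (tensor_space ns) (elem_tensor sN As v) Zs =
          map_mat (\<lambda>a. sN a v) (interlace As Zs)))"
    using contraction_linear_iso[OF len] elem contraction_elem_tensor[OF len] by auto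
  fix \<kappa>
  assume \<kappa>: "\<kappa> \<in> extensional (tensor_space ns) \<and>
    linear_iso (+) (tensor_scale sN) (tensor_space ns) (hom_add ns) (hom_scale sN ns) (hom_space sN ns) \<kappa> \<and>
    (\<forall>As v. length As = length ns \<and> (\<forall>l<length ns. As ! l \<in> carrier_mat (ns ! l) (ns ! l)) \<longrightarrow>
        (\<forall>Zs\<in>ztuples ns. \<kappa> (elem_tensor sN As v) Zs = map_mat (\<lambda>a. sN a v) (interlace As Zs)))"
  show "\<kappa> = restrict (contraction sN ns) (tensor_space ns)"
  proof (rule extensionalityI[of _ "tensor_space ns"])
    fix T :: "'n tensor" assume T: "T \<in> tensor_space ns"
    then have "\<kappa> T = contraction sN ns T"
    proof (induction rule: tensor_space_induct)
      case (generator As v)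
      then have "\<kappa> (elem_tensor sN As v) \<in> hom_space sN ns"
        using \<kappa> elem[of As v] by (auto simp: linear_iso_def bij_betw_def)
      then have "\<kappa> (elem_tensor sN As v) \<in> extensional (ztuples ns)" by (auto simp: hom_space_def PiE_iff)
      then show ?case
        using \<kappa> generator contraction_elem_tensor[OF len generator(1) generator(2)]
        by (intro extensionalityI[of _ "ztuples ns"]) (auto simp: contraction_extensional)
    next
      case (add T T')
      have "\<kappa> (T + T') = hom_add ns (\<kappa> T) (\<kappa> T')" using \<kappa> add(1,2) unfolding linear_iso_def by blast
      then show ?case by (simp only: contraction_add add(3,4))
    qed
    then show "\<kappa> T = restrict (contraction sN ns) (tensor_space ns) T" using T by simp
  qed (use \<kappa> in auto)
qed

lemma iota_contraction:
  assumes len: "length ns = Suc k" and T: "T \<in> tensor_space ns"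
  shows "iota sN ns (contraction sN ns T) = T"
proof -
  have "inj_on (restrict (contraction sN ns) (tensor_space ns)) (tensor_space ns)"
    using bij_betw_imp_inj_on[OF contraction_bij[OF len]] by (simp only: inj_on_restrict_eq)
  from inv_into_f_f[OF this T] show ?thesis
    using T by (simp add: iota_def iota_inv_eq_contraction[OF len])
qed

lemma contraction_iota:
  assumes len: "length ns = Suc k" and \<phi>: "\<phi> \<in> hom_space sN ns"
  shows "iota sN ns \<phi> \<in> tensor_space ns" "contraction sN ns (iota sN ns \<phi>) = \<phi>"
proof -
  obtain T where "T \<in> tensor_space ns" "\<phi> = contraction sN ns T"
    using bij_betw_imp_surj_on[OF contraction_bij[OF len]] \<phi> by blast
  then show "iota sN ns \<phi> \<in> tensor_space ns" "contraction sN ns (iota sN ns \<phi>) = \<phi>"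
    by (simp_all add: iota_contraction[OF len])
qed

end

section \<open>Block sums and conjugations in one slot\<close>

text \<open>The chain obtained from \<open>R\<close> by shifting both indices of the slot \<open>j\<close> by \<open>n\<close>. It evaluates
  the second block of a slot whose first block has size \<open>n\<close>.\<close>

definition shift_slot ::
  "nat \<Rightarrow> nat \<Rightarrow> (nat \<Rightarrow> nat \<Rightarrow> nat \<Rightarrow> complex) \<Rightarrow> nat \<Rightarrow> nat \<Rightarrow> nat \<Rightarrow> complex" where
  "shift_slot j n R l s p =
     (if l = j then R l s (p + n) else if l = Suc j then R l (s + n) p else R l s p)"

text \<open>The chain obtained from \<open>R\<close> by multiplying the factor before the slot \<open>j\<close> by \<open>S\<close> from the
  right and the factor after it by \<open>S'\<close> from the left.\<close>

definition twist_slot ::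
  "nat \<Rightarrow> nat \<Rightarrow> complex mat \<Rightarrow> complex mat \<Rightarrow> (nat \<Rightarrow> nat \<Rightarrow> nat \<Rightarrow> complex) \<Rightarrow> nat \<Rightarrow> nat \<Rightarrow> nat \<Rightarrow> complex" where
  "twist_slot j n S S' R l s p =
     (if l = j then \<Sum>r<n. R l s r * S $$ (r, p)
      else if l = Suc j then \<Sum>t<n. S' $$ (s, t) * R l t p
      else R l s p)"

lemma out_index_insert_nth:
  assumes "j \<le> length ps"
  shows "out_index (insert_nth j x ps) l =
    (if l \<le> j then out_index ps l else if l = Suc j then snd x else out_index ps (l - 1))"
proof -
  have "l - Suc 0 < j" if "l \<noteq> 0" "l \<le> j" using that by auto
  then show ?thesis unfolding out_index_def nth_insert_nth[OF assms] by auto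
qed

lemma in_index_insert_nth:
  assumes "j \<le> length ps"
  shows "in_index (insert_nth j x ps) l =
    (if l < j then in_index ps l else if l = j then fst x else in_index ps (l - 1))"
proof -
  have len: "length (insert_nth j x ps) = Suc (length ps)" using assms by simp
  show ?thesis unfolding in_index_def len nth_insert_nth[OF assms] using assms by auto
qed

text \<open>The pair \<open>(p, q)\<close> in the slot \<open>j\<close> enters only the factors \<open>j\<close> and \<open>j + 1\<close>. The remaining
  factors are the same for all pairs, so \<open>(0, 0)\<close> stands for an arbitrary one.\<close>

lemma weight_insert_nth:
  assumes "j \<le> length ps"
  shows "weight R (insert_nth j (p, q) ps) = R j (out_index ps j) p * R (Suc j) q (in_index ps j) *
    (\<Prod>l\<in>{..Suc (length ps)} - {j, Suc j}.
      R l (out_index (insert_nth j (0, 0) ps) l) (in_index (insert_nth j (0, 0) ps) l))"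
proof -
  let ?ps = "insert_nth j (p, q) ps" and ?qs = "insert_nth j (0, 0) ps"
  let ?f = "\<lambda>l. R l (out_index ?ps l) (in_index ?ps l)"
  have len: "length (insert_nth j x ps) = Suc (length ps)" for x using assms by simp
  have "weight R ?ps = prod ?f {..Suc (length ps)}" unfolding weight_def len ..
  also have "\<dots> = ?f j * prod ?f ({..Suc (length ps)} - {j})"
    using assms by (intro prod.remove) auto
  also have "\<dots> = ?f j * (?f (Suc j) * prod ?f ({..Suc (length ps)} - {j} - {Suc j}))"
    using assms by (subst prod.remove[of "{..Suc (length ps)} - {j}" "Suc j" ?f]) auto
  finally have w: "weight R ?ps = ?f j * (?f (Suc j) * prod ?f ({..Suc (length ps)} - {j} - {Suc j}))" .
  have set: "{..Suc (length ps)} - {j} - {Suc j} = {..Suc (length ps)} - {j, Suc j}" by auto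
  have rest: "prod ?f ({..Suc (length ps)} - {j, Suc j}) =
      (\<Prod>l\<in>{..Suc (length ps)} - {j, Suc j}. R l (out_index ?qs l) (in_index ?qs l))"
  proof (rule prod.cong[OF refl])
    fix l assume l: "l \<in> {..Suc (length ps)} - {j, Suc j}"
    then show "?f l = R l (out_index ?qs l) (in_index ?qs l)"
      unfolding out_index_insert_nth[OF assms] in_index_insert_nth[OF assms] by simp
  qed
  have fj: "?f j = R j (out_index ps j) p"
    unfolding out_index_insert_nth[OF assms] in_index_insert_nth[OF assms] by simp
  have fj': "?f (Suc j) = R (Suc j) q (in_index ps j)"
    unfolding out_index_insert_nth[OF assms] in_index_insert_nth[OF assms] by simp
  show ?thesis unfolding w set rest fj fj' by (simp only: mult.assoc)
qed

lemma weight_shift_slot: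
  assumes "j \<le> length ps"
  shows "weight (shift_slot j n R) (insert_nth j (p, q) ps) = weight R (insert_nth j (p + n, q + n) ps)"
  unfolding weight_insert_nth[OF assms]
  by (intro arg_cong2[of _ _ _ _ "(*)"] prod.cong) (auto simp: shift_slot_def)

lemma weight_twist_slot:
  assumes "j \<le> length ps"
  shows "weight (twist_slot j n S S' R) (insert_nth j (r, t) ps) =
    (\<Sum>p<n. \<Sum>q<n. S $$ (p, r) * S' $$ (t, q) * weight R (insert_nth j (p, q) ps))"
proof -
  let ?C = "\<lambda>R. \<Prod>l\<in>{..Suc (length ps)} - {j, Suc j}.
      R l (out_index (insert_nth j (0, 0) ps) l) (in_index (insert_nth j (0, 0) ps) l) :: complex"
  have C: "?C (twist_slot j n S S' R) = ?C R"
    by (rule prod.cong) (auto simp: twist_slot_def)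
  have expand: "(\<Sum>p<n. R j (out_index ps j) p * S $$ (p, r)) * (\<Sum>q<n. S' $$ (t, q) * R (Suc j) q (in_index ps j)) * c =
      (\<Sum>p<n. \<Sum>q<n. (R j (out_index ps j) p * S $$ (p, r)) * (S' $$ (t, q) * R (Suc j) q (in_index ps j)) * c)" for c
    unfolding sum_product unfolding sum_distrib_right ..
  have "weight (twist_slot j n S S' R) (insert_nth j (r, t) ps) =
    (\<Sum>p<n. R j (out_index ps j) p * S $$ (p, r)) * (\<Sum>q<n. S' $$ (t, q) * R (Suc j) q (in_index ps j)) * ?C R"
    unfolding weight_insert_nth[OF assms] unfolding C by (simp add: twist_slot_def)
  also have "\<dots> = (\<Sum>p<n. \<Sum>q<n. S $$ (p, r) * S' $$ (t, q) * weight R (insert_nth j (p, q) ps))"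
    unfolding expand weight_insert_nth[OF assms] by (intro sum.cong refl) (simp only: mult_ac)
  finally show ?thesis .
qed

lemma tensor_as_mat_index [simp]:
  "p < n \<Longrightarrow> q < n \<Longrightarrow> (tensor_as_mat j n T $$ (p, q)) ps = T (insert_nth j (p, q) ps)"
  "dim_row (tensor_as_mat j n T) = n" "dim_col (tensor_as_mat j n T) = n"
  by (simp_all add: tensor_as_mat_def)

lemma mats_overD:
  assumes "M \<in> mats_over U n m"
  shows "dim_row M = n" "dim_col M = m" "\<And>p q. p < n \<Longrightarrow> q < m \<Longrightarrow> M $$ (p, q) \<in> U"
  using assms by (fastforce simp: mats_over_def elements_mat_def)+

lemma mats_overI:
  "M \<in> carrier_mat n m \<Longrightarrow> (\<And>p q. p < n \<Longrightarrow> q < m \<Longrightarrow> M $$ (p, q) \<in> U) \<Longrightarrow> M \<in> mats_over U n m"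
  by (fastforce simp: mats_over_def elements_mat_def)

lemma tensor_as_mat_mats_over:
  assumes "j < length ns" "T \<in> tensor_space ns"
  shows "tensor_as_mat j (ns ! j) T \<in> mats_over (tensor_space (remove_nth j ns)) (ns ! j) (ns ! j)"
proof (rule mats_overI)
  fix p q assume "p < ns ! j" "q < ns ! j"
  then show "tensor_as_mat j (ns ! j) T $$ (p, q) \<in> tensor_space (remove_nth j ns)"
    using assms insert_nth_in_tensor_index_iff[OF assms(1)] unfolding tensor_space_def by simp
qed (simp add: tensor_as_mat_def)

lemma tensor_as_mat_surj:
  assumes j: "j < length ns"
    and M: "M \<in> mats_over (tensor_space (remove_nth j ns)) (ns ! j) (ns ! j)"
  obtains T where "T \<in> tensor_space ns" "tensor_as_mat j (ns ! j) T = M"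
proof -
  define T where "T = (\<lambda>ps. if ps \<in> tensor_index ns then (M $$ (ps ! j)) (remove_nth j ps) else 0)"
  have "T \<in> tensor_space ns" by (simp add: T_def tensor_space_def)
  moreover have "tensor_as_mat j (ns ! j) T = M"
  proof (rule eq_matI)
    fix p q assume "p < dim_row M" "q < dim_col M"
    then have pq: "p < ns ! j" "q < ns ! j" using mats_overD[OF M] by auto
    show "tensor_as_mat j (ns ! j) T $$ (p, q) = M $$ (p, q)"
    proof
      fix ps
      show "(tensor_as_mat j (ns ! j) T $$ (p, q)) ps = (M $$ (p, q)) ps"
      proof (cases "ps \<in> tensor_index (remove_nth j ns)")
        case True
        then have jl: "j \<le> length ps" using j by (auto dest: tensor_index_length)
        have "insert_nth j (p, q) ps \<in> tensor_index ns"
          using insert_nth_in_tensor_index_iff[OF j] True pq by blast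
        then have "T (insert_nth j (p, q) ps) = (M $$ (insert_nth j (p, q) ps ! j)) (remove_nth j (insert_nth j (p, q) ps))"
          unfolding T_def by (rule if_P)
        also have "\<dots> = (M $$ (p, q)) ps"
          unfolding remove_nth_insert_nth[OF jl] unfolding nth_insert_nth[OF jl] by simp
        finally show ?thesis using pq by simp
      next
        case False
        then have "T (insert_nth j (p, q) ps) = 0"
          unfolding T_def using insert_nth_in_tensor_index_iff[OF j] by meson
        then show ?thesis using pq False mats_overD(3)[OF M pq] by (simp add: tensor_space_def)
      qed
    qed
  qed (use mats_overD[OF M] in auto)
  ultimately show ?thesis by (rule that)
qed

lemma sum_lessThan_add:
  fixes f :: "nat \<Rightarrow> 'a::comm_monoid_add"
  shows "(\<Sum>i<n + m. f i) = (\<Sum>i<n. f i) + (\<Sum>i<m. f (i + n))"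
  by (induction m) (simp_all add: add.assoc add.commute[of n])

lemma sum_pairs: "(\<Sum>p\<in>A. \<Sum>q\<in>B. h p q) = (\<Sum>x\<in>A \<times> B. h (fst x) (snd x))"
  by (simp add: sum.cartesian_product case_prod_unfold)

lemma sum_swap_pairs:
  "(\<Sum>p\<in>A. \<Sum>q\<in>B. \<Sum>r\<in>C. \<Sum>t\<in>D. g p q r t) = (\<Sum>r\<in>C. \<Sum>t\<in>D. \<Sum>p\<in>A. \<Sum>q\<in>B. g p q r t)"
  unfolding sum_pairs[where A = A and B = B] unfolding sum_pairs[where A = C and B = D] by (rule sum.swap)

lemma sum_fun_apply: "(\<Sum>i\<in>A. f i) x = (\<Sum>i\<in>A. f i x :: 'a::comm_monoid_add)"
  by (induction A rule: infinite_finite_induct) simp_all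

lemma dsum_index:
  assumes "A \<in> carrier_mat n n" "B \<in> carrier_mat m m"
  shows "p < n \<Longrightarrow> q < n \<Longrightarrow> dsum A B $$ (p, q) = A $$ (p, q)"
    "p < n \<Longrightarrow> q < m \<Longrightarrow> dsum A B $$ (p, q + n) = 0"
    "p < m \<Longrightarrow> q < n \<Longrightarrow> dsum A B $$ (p + n, q) = 0"
    "p < m \<Longrightarrow> q < m \<Longrightarrow> dsum A B $$ (p + n, q + n) = B $$ (p, q)"
    "dsum A B \<in> carrier_mat (n + m) (n + m)"
  using assms by (auto simp: dsum_def)

lemma dsum_mats_over:
  assumes A: "A \<in> mats_over U n n" and B: "B \<in> mats_over U m m" and z: "0 \<in> U"
  shows "dsum A B \<in> mats_over U (n + m) (n + m)"
proof (rule mats_overI)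
  fix p q assume "p < n + m" "q < n + m"
  then show "dsum A B $$ (p, q) \<in> U"
    using mats_overD[OF A] mats_overD[OF B] z by (auto simp: dsum_def)
qed (use mats_overD[OF A] mats_overD[OF B] in \<open>auto simp: dsum_def intro!: carrier_matI\<close>)

context
  fixes sN :: "complex \<Rightarrow> 'n::ab_group_add \<Rightarrow> 'n"
  assumes vector_space_sN: "vector_space sN"
begin

interpretation N: vector_space sN by (rule vector_space_sN)

lemma conjug_tensor_index:
  assumes "M \<in> carrier_mat n n" "S \<in> carrier_mat n n" "S' \<in> carrier_mat n n" "p < n" "q < n"
  shows "(conjug (tensor_scale sN) S M S' $$ (p, q)) ps =
    (\<Sum>r<n. \<Sum>t<n. sN (S $$ (p, r) * S' $$ (t, q)) ((M $$ (r, t)) ps))"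
proof -
  have "(conjug (tensor_scale sN) S M S' $$ (p, q)) ps =
      (\<Sum>t<n. sN (S' $$ (t, q)) (\<Sum>r<n. sN (S $$ (p, r)) ((M $$ (r, t)) ps)))"
    using assms by (simp add: rmul_def lmul_def sum_fun_apply tensor_scale_def)
  also have "\<dots> = (\<Sum>t<n. \<Sum>r<n. sN (S $$ (p, r) * S' $$ (t, q)) ((M $$ (r, t)) ps))"
    by (simp add: N.scale_sum_right mult.commute)
  also have "\<dots> = (\<Sum>r<n. \<Sum>t<n. sN (S $$ (p, r) * S' $$ (t, q)) ((M $$ (r, t)) ps))"
    by (rule sum.swap)
  finally show ?thesis .
qed

lemma conjug_mats_over:
  assumes M: "M \<in> mats_over (tensor_space ns) n n" and S: "S \<in> carrier_mat n n" "S' \<in> carrier_mat n n"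
  shows "conjug (tensor_scale sN) S M S' \<in> mats_over (tensor_space ns) n n"
proof (rule mats_overI)
  have Mc: "M \<in> carrier_mat n n" using mats_overD[OF M] by auto
  fix p q assume pq: "p < n" "q < n"
  show "conjug (tensor_scale sN) S M S' $$ (p, q) \<in> tensor_space ns"
    unfolding tensor_space_def
  proof (intro CollectI allI impI)
    fix ps assume "ps \<notin> tensor_index ns"
    then have "(M $$ (r, t)) ps = 0" if "r < n" "t < n" for r t
      using mats_overD(3)[OF M that] by (simp add: tensor_space_def)
    then show "(conjug (tensor_scale sN) S M S' $$ (p, q)) ps = 0"
      unfolding conjug_tensor_index[OF Mc S pq] by simp
  qed
qed (use S in \<open>auto simp: rmul_def lmul_def\<close>)

lemma contract_slot:
  assumes j: "j < length ns"
  shows "contract sN ns R T = (\<Sum>ps\<in>tensor_index (remove_nth j ns). \<Sum>p<ns ! j. \<Sum>q<ns ! j.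
    sN (weight R (insert_nth j (p, q) ps)) ((tensor_as_mat j (ns ! j) T $$ (p, q)) ps))"
proof -
  let ?f = "\<lambda>ps p q. sN (weight R (insert_nth j (p, q) ps)) (T (insert_nth j (p, q) ps))"
  have "contract sN ns R T = (\<Sum>p<ns ! j. \<Sum>q<ns ! j. \<Sum>ps\<in>tensor_index (remove_nth j ns). ?f ps p q)"
    unfolding contract_def by (rule sum_tensor_index_slot[OF j])
  also have "\<dots> = (\<Sum>p<ns ! j. \<Sum>ps\<in>tensor_index (remove_nth j ns). \<Sum>q<ns ! j. ?f ps p q)"
    by (intro sum.cong refl sum.swap)
  also have "\<dots> = (\<Sum>ps\<in>tensor_index (remove_nth j ns). \<Sum>p<ns ! j. \<Sum>q<ns ! j. ?f ps p q)"
    by (rule sum.swap)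
  also have "\<dots> = (\<Sum>ps\<in>tensor_index (remove_nth j ns). \<Sum>p<ns ! j. \<Sum>q<ns ! j.
    sN (weight R (insert_nth j (p, q) ps)) ((tensor_as_mat j (ns ! j) T $$ (p, q)) ps))"
    by (intro sum.cong refl) simp
  finally show ?thesis .
qed

text \<open>Of the four blocks of index pairs, the two off-diagonal ones contribute \<open>0\<close>.\<close>

lemma contract_dsum:
  assumes j: "j < length ns" and n: "ns ! j = n"
    and T: "tensor_as_mat j (n + m) T = dsum (tensor_as_mat j n T1) (tensor_as_mat j m T2)"
  shows "contract sN (ns[j := n + m]) R T =
    contract sN ns R T1 + contract sN (ns[j := m]) (shift_slot j n R) T2"
proof -
  let ?M1 = "tensor_as_mat j n T1" and ?M2 = "tensor_as_mat j m T2"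
  let ?I = "tensor_index (remove_nth j ns)"
  let ?w = "\<lambda>ps p q. weight R (insert_nth j (p, q) ps)"
  have jl: "j \<le> length ps" if "ps \<in> ?I" for ps using tensor_index_length[OF that] j by simp
  have M: "?M1 \<in> carrier_mat n n" "?M2 \<in> carrier_mat m m" by (simp_all add: tensor_as_mat_def)
  note D = dsum_index[OF M]
  have rem: "remove_nth j (ns[j := x]) = remove_nth j ns" for x by simp
  have ins: "(ns[j := x]) ! j = x" "j < length (ns[j := x])" for x using j by simp_all
  have "contract sN (ns[j := n + m]) R T = (\<Sum>ps\<in>?I. \<Sum>p<n + m. \<Sum>q<n + m.
      sN (?w ps p q) ((dsum ?M1 ?M2 $$ (p, q)) ps))"
    unfolding contract_slot[OF ins(2)] ins(1) rem T ..
  also have "\<dots> = (\<Sum>ps\<in>?I. (\<Sum>p<n. \<Sum>q<n. sN (?w ps p q) ((?M1 $$ (p, q)) ps)) +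
      (\<Sum>p<m. \<Sum>q<m. sN (?w ps (p + n) (q + n)) ((?M2 $$ (p, q)) ps)))"
    unfolding sum_lessThan_add by (rule sum.cong[OF refl]) (simp add: D del: tensor_as_mat_index(1))
  also have "\<dots> = (\<Sum>ps\<in>?I. (\<Sum>p<n. \<Sum>q<n. sN (?w ps p q) ((?M1 $$ (p, q)) ps))) +
      (\<Sum>ps\<in>?I. (\<Sum>p<m. \<Sum>q<m. sN (weight (shift_slot j n R) (insert_nth j (p, q) ps)) ((?M2 $$ (p, q)) ps)))"
    unfolding sum.distrib using jl by (simp only: weight_shift_slot cong: sum.cong)
  also have "\<dots> = contract sN ns R T1 + contract sN (ns[j := m]) (shift_slot j n R) T2"
    unfolding contract_slot[OF ins(2)] ins(1) rem unfolding contract_slot[OF j] n ..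
  finally show ?thesis .
qed

lemma contract_conjug:
  assumes j: "j < length ns" and n: "ns ! j = n" and S: "S \<in> carrier_mat n n" "S' \<in> carrier_mat n n"
    and T: "tensor_as_mat j n T' = conjug (tensor_scale sN) S (tensor_as_mat j n T) S'"
  shows "contract sN ns R T' = contract sN ns (twist_slot j n S S' R) T"
proof -
  let ?M = "tensor_as_mat j n T"
  let ?I = "tensor_index (remove_nth j ns)" and ?N = "{..<n} \<times> {..<n}"
  let ?w = "\<lambda>ps p q. weight R (insert_nth j (p, q) ps)"
  have jl: "j \<le> length ps" if "ps \<in> ?I" for ps using tensor_index_length[OF that] j by simp
  have M: "?M \<in> carrier_mat n n" by (simp add: tensor_as_mat_def)
  have "contract sN ns R T' = (\<Sum>ps\<in>?I. \<Sum>p<n. \<Sum>q<n.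
      sN (?w ps p q) (\<Sum>r<n. \<Sum>t<n. sN (S $$ (p, r) * S' $$ (t, q)) ((?M $$ (r, t)) ps)))"
    unfolding contract_slot[OF j] n T
    by (intro sum.cong refl) (simp only: conjug_tensor_index[OF M S] lessThan_iff)
  also have "\<dots> = (\<Sum>ps\<in>?I. \<Sum>r<n. \<Sum>t<n. sN (weight (twist_slot j n S S' R) (insert_nth j (r, t) ps)) ((?M $$ (r, t)) ps))"
  proof (rule sum.cong[OF refl])
    fix ps assume ps: "ps \<in> ?I"
    let ?g = "\<lambda>p q r t. sN (S $$ (p, r) * S' $$ (t, q) * ?w ps p q) ((?M $$ (r, t)) ps)"
    have "(\<Sum>p<n. \<Sum>q<n. sN (?w ps p q) (\<Sum>r<n. \<Sum>t<n. sN (S $$ (p, r) * S' $$ (t, q)) ((?M $$ (r, t)) ps))) =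
      (\<Sum>p<n. \<Sum>q<n. \<Sum>r<n. \<Sum>t<n. ?g p q r t)"
      by (simp only: N.scale_sum_right N.scale_scale) (simp only: mult_ac)
    also have "\<dots> = (\<Sum>r<n. \<Sum>t<n. \<Sum>p<n. \<Sum>q<n. ?g p q r t)"
      by (rule sum_swap_pairs)
    also have "\<dots> = (\<Sum>r<n. \<Sum>t<n. sN (weight (twist_slot j n S S' R) (insert_nth j (r, t) ps)) ((?M $$ (r, t)) ps))"
      unfolding weight_twist_slot[OF jl[OF ps]] N.scale_sum_left ..
    finally show "(\<Sum>p<n. \<Sum>q<n. sN (?w ps p q) (\<Sum>r<n. \<Sum>t<n. sN (S $$ (p, r) * S' $$ (t, q)) ((?M $$ (r, t)) ps))) =
      (\<Sum>r<n. \<Sum>t<n. sN (weight (twist_slot j n S S' R) (insert_nth j (r, t) ps)) ((?M $$ (r, t)) ps))" .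
  qed
  also have "\<dots> = contract sN ns (twist_slot j n S S' R) T"
    unfolding contract_slot[OF j] n ..
  finally show ?thesis .
qed

text \<open>The frames of matrix units recover all coordinates.\<close>

lemma tensor_eq_iff_contract_frame:
  assumes len: "length ns = Suc k" and T: "T \<in> tensor_space ns" "T' \<in> tensor_space ns"
  shows "T = T' \<longleftrightarrow> (\<forall>Zs\<in>ztuples ns. \<forall>a<ns ! 0. \<forall>b<ns ! k.
    contract sN ns (frame a b Zs) T = contract sN ns (frame a b Zs) T')"
proof (intro iffI ext)
  fix ps
  assume eq: "\<forall>Zs\<in>ztuples ns. \<forall>a<ns ! 0. \<forall>b<ns ! k.
    contract sN ns (frame a b Zs) T = contract sN ns (frame a b Zs) T'"
  show "T ps = T' ps"
  proof (cases "ps \<in> tensor_index ns")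
    case True
    then have "fst (ps ! 0) < ns ! 0" "snd (ps ! k) < ns ! k" using len by (auto simp: tensor_index_def)
    from eq[rule_format, OF unit_tuple_ztuples[of ns ps] this]
    show ?thesis unfolding contract_unit_tuple[OF vector_space_sN len True] .
  qed (use T in \<open>simp add: tensor_space_def\<close>)
qed simp

text \<open>The direction not contained in \<open>contract_dsum\<close>: the block sum on the right is the slot of some
  tensor \<open>T'\<close>. Its contractions are given by \<open>contract_dsum\<close>. If they agree with those of \<open>T\<close> for
  all frames, then \<open>T' = T\<close>.\<close>

lemma tensor_dsum_iff_contract:
  assumes len: "length ns = Suc k" and j: "j \<le> k" and n: "ns ! j = n"
    and T: "T \<in> tensor_space (ns[j := n + m])" and T1: "T1 \<in> tensor_space ns" and T2: "T2 \<in> tensor_space (ns[j := m])"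
  shows "tensor_as_mat j (n + m) T = dsum (tensor_as_mat j n T1) (tensor_as_mat j m T2) \<longleftrightarrow>
    (\<forall>Zs\<in>ztuples (ns[j := n + m]). \<forall>a<ns[j := n + m] ! 0. \<forall>b<ns[j := n + m] ! k.
      contract sN (ns[j := n + m]) (frame a b Zs) T =
      contract sN ns (frame a b Zs) T1 + contract sN (ns[j := m]) (shift_slot j n (frame a b Zs)) T2)"
    (is "?L \<longleftrightarrow> ?R")
proof -
  have jl: "j < length ns" using len j by simp
  have len': "length (ns[j := n + m]) = Suc k" and jl': "j < length (ns[j := n + m])" using len j by simp_all
  have "tensor_as_mat j n T1 \<in> mats_over (tensor_space (remove_nth j ns)) n n"
    using tensor_as_mat_mats_over[OF jl T1] n by simp
  moreover have "tensor_as_mat j m T2 \<in> mats_over (tensor_space (remove_nth j ns)) m m"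
    using tensor_as_mat_mats_over[of j "ns[j := m]", OF _ T2] jl by simp
  ultimately have "dsum (tensor_as_mat j n T1) (tensor_as_mat j m T2) \<in>
      mats_over (tensor_space (remove_nth j (ns[j := n + m]))) (ns[j := n + m] ! j) (ns[j := n + m] ! j)"
    using dsum_mats_over[of _ "tensor_space (remove_nth j ns)"] jl by (simp add: tensor_space_def)
  then obtain T' where T': "T' \<in> tensor_space (ns[j := n + m])"
    "tensor_as_mat j (ns[j := n + m] ! j) T' = dsum (tensor_as_mat j n T1) (tensor_as_mat j m T2)"
    by (rule tensor_as_mat_surj[OF jl'])
  then have T'': "tensor_as_mat j (n + m) T' = dsum (tensor_as_mat j n T1) (tensor_as_mat j m T2)"
    using jl by simp
  have "?R \<longleftrightarrow> T = T'"
    unfolding tensor_eq_iff_contract_frame[OF len' T T'(1)] contract_dsum[OF jl n T''] ..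
  moreover have "T = T'" if ?L
    unfolding tensor_eq_iff_contract_frame[OF len' T T'(1)] contract_dsum[OF jl n T''] contract_dsum[OF jl n that]
    by simp
  ultimately show ?thesis using T'' by blast
qed

lemma tensor_conjug_iff_contract:
  assumes len: "length ns = Suc k" and j: "j \<le> k" and n: "ns ! j = n"
    and S: "S \<in> carrier_mat n n" "S' \<in> carrier_mat n n"
    and T: "T \<in> tensor_space ns" and T1: "T1 \<in> tensor_space ns"
  shows "tensor_as_mat j n T1 = conjug (tensor_scale sN) S (tensor_as_mat j n T) S' \<longleftrightarrow>
    (\<forall>Zs\<in>ztuples ns. \<forall>a<ns ! 0. \<forall>b<ns ! k.
      contract sN ns (frame a b Zs) T1 = contract sN ns (twist_slot j n S S' (frame a b Zs)) T)"
    (is "?L \<longleftrightarrow> ?R")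
proof -
  have jl: "j < length ns" using len j by simp
  have "tensor_as_mat j n T \<in> mats_over (tensor_space (remove_nth j ns)) n n"
    using tensor_as_mat_mats_over[OF jl T] n by simp
  from conjug_mats_over[OF this S]
  have "conjug (tensor_scale sN) S (tensor_as_mat j n T) S' \<in>
      mats_over (tensor_space (remove_nth j ns)) (ns ! j) (ns ! j)" unfolding n .
  then obtain T' where T': "T' \<in> tensor_space ns"
    and T'': "tensor_as_mat j n T' = conjug (tensor_scale sN) S (tensor_as_mat j n T) S'"
    unfolding n[symmetric] by (rule tensor_as_mat_surj[OF jl])
  have "?R \<longleftrightarrow> T1 = T'"
    unfolding tensor_eq_iff_contract_frame[OF len T1 T'(1)] contract_conjug[OF jl n S T''] ..
  moreover have "T1 = T'" if ?L
    unfolding tensor_eq_iff_contract_frame[OF len T1 T'(1)] contract_conjug[OF jl n S T''] contract_conjug[OF jl n S that]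
    by simp
  ultimately show ?thesis using T'' by blast
qed

end

section \<open>Direct sum and similarity conditions for one slot\<close>

lemma append_rows_index:
  assumes "A \<in> carrier_mat n c" "B \<in> carrier_mat m c"
  shows "i < n \<Longrightarrow> j < c \<Longrightarrow> (A @\<^sub>r B) $$ (i, j) = A $$ (i, j)"
    "i < m \<Longrightarrow> j < c \<Longrightarrow> (A @\<^sub>r B) $$ (i + n, j) = B $$ (i, j)"
  using assms by (auto simp: append_rows_def)

lemma append_cols_index:
  assumes "A \<in> carrier_mat r n" "B \<in> carrier_mat r m"
  shows "i < r \<Longrightarrow> j < n \<Longrightarrow> (A @\<^sub>c B) $$ (i, j) = A $$ (i, j)"
    "i < r \<Longrightarrow> j < m \<Longrightarrow> (A @\<^sub>c B) $$ (i, j + n) = B $$ (i, j)"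
    "A @\<^sub>c B \<in> carrier_mat r (n + m)"
  using assms by (auto simp: append_cols_def)

lemma mat_rows_decompose:
  fixes A :: "'a::zero mat"
  assumes "A \<in> carrier_mat (n + m) c"
  obtains B C where "B \<in> carrier_mat n c" "C \<in> carrier_mat m c" "A = B @\<^sub>r C"
proof
  show "A = mat n c (\<lambda>(i, j). A $$ (i, j)) @\<^sub>r mat m c (\<lambda>(i, j). A $$ (i + n, j))"
    using assms by (intro eq_matI) (auto simp: append_rows_def)
qed auto

lemma mat_cols_decompose:
  fixes A :: "'a::zero mat"
  assumes "A \<in> carrier_mat r (n + m)"
  obtains B C where "B \<in> carrier_mat r n" "C \<in> carrier_mat r m" "A = B @\<^sub>c C"
proof
  show "A = mat r n (\<lambda>(i, j). A $$ (i, j)) @\<^sub>c mat r m (\<lambda>(i, j). A $$ (i, j + n))"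
    using assms by (intro eq_matI) (auto simp: append_cols_def)
qed auto

lemma mat_eq_iff_entries:
  assumes "A \<in> carrier_mat n m" "B \<in> carrier_mat n m"
  shows "A = B \<longleftrightarrow> (\<forall>i<n. \<forall>j<m. A $$ (i, j) = B $$ (i, j))"
  using assms by (auto intro: eq_matI)

lemma ztuples_iff:
  assumes "length ns = Suc k"
  shows "Zs \<in> ztuples ns \<longleftrightarrow> length Zs = k \<and> (\<forall>i<k. Zs ! i \<in> carrier_mat (ns ! i) (ns ! Suc i))"
  using assms by (simp add: ztuples_def)

lemma ball_surj_iff:
  assumes "\<And>x. x \<in> X \<Longrightarrow> h x \<in> Z" "\<And>z. z \<in> Z \<Longrightarrow> \<exists>x\<in>X. z = h x"
    "\<And>x. x \<in> X \<Longrightarrow> P x \<longleftrightarrow> Q (h x)"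
  shows "(\<forall>x\<in>X. P x) \<longleftrightarrow> (\<forall>z\<in>Z. Q z)"
  using assms by metis

lemma ball2_surj_iff:
  assumes "\<And>x y. x \<in> X \<Longrightarrow> y \<in> Y \<Longrightarrow> h x y \<in> Z" "\<And>z. z \<in> Z \<Longrightarrow> \<exists>x\<in>X. \<exists>y\<in>Y. z = h x y"
    "\<And>x y. x \<in> X \<Longrightarrow> y \<in> Y \<Longrightarrow> P x y \<longleftrightarrow> Q (h x y)"
  shows "(\<forall>x\<in>X. \<forall>y\<in>Y. P x y) \<longleftrightarrow> (\<forall>z\<in>Z. Q z)"
  using assms by metis

lemma ball3_surj_iff:
  assumes "\<And>x y w. x \<in> X \<Longrightarrow> y \<in> Y \<Longrightarrow> w \<in> W \<Longrightarrow> h x y w \<in> Z"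
    "\<And>z. z \<in> Z \<Longrightarrow> \<exists>x\<in>X. \<exists>y\<in>Y. \<exists>w\<in>W. z = h x y w"
    "\<And>x y w. x \<in> X \<Longrightarrow> y \<in> Y \<Longrightarrow> w \<in> W \<Longrightarrow> P x y w \<longleftrightarrow> Q (h x y w)"
  shows "(\<forall>x\<in>X. \<forall>y\<in>Y. \<forall>w\<in>W. P x y w) \<longleftrightarrow> (\<forall>z\<in>Z. Q z)"
  using assms by metis

lemma frame_last: "length Zs = k \<Longrightarrow> frame a b Zs (Suc k) s p = of_bool (s = b)"
  by auto

lemma shift_slot_simps:
  "shift_slot j n R j s p = R j s (p + n)"
  "shift_slot j n R (Suc j) s p = R (Suc j) (s + n) p"
  "l \<noteq> j \<Longrightarrow> l \<noteq> Suc j \<Longrightarrow> shift_slot j n R l s p = R l s p"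
  by (auto simp: shift_slot_def)

lemma twist_slot_simps:
  "twist_slot j n S S' R j s p = (\<Sum>r<n. R j s r * S $$ (r, p))"
  "twist_slot j n S S' R (Suc j) s p = (\<Sum>t<n. S' $$ (s, t) * R (Suc j) t p)"
  "l \<noteq> j \<Longrightarrow> l \<noteq> Suc j \<Longrightarrow> twist_slot j n S S' R l s p = R l s p"
  by (auto simp: twist_slot_def)

context
  fixes sN :: "complex \<Rightarrow> 'n::ab_group_add \<Rightarrow> 'n"
  assumes vector_space_sN: "vector_space sN"
begin

text \<open>The tuples \<open>Z'\<close> with a matrix of \<open>n + m\<close> rows in front are exactly those built from \<open>Z\<close> and
  \<open>W\<close>. The chain of \<open>Z'\<close> and the shifted chain then restrict to the chains of the two blocks, and the
  boundary factor \<open>\<delta>\<^sub>a\<close> makes one of the two contractions vanish, according to the block that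
  contains the row \<open>a\<close>.\<close>

lemma contraction_dsum_first_iff:
  assumes len: "length ns = Suc k" and k: "1 \<le> k" and n: "ns ! 0 = n"
    and T: "T \<in> tensor_space (ns[0 := n + m])" "T1 \<in> tensor_space ns" "T2 \<in> tensor_space (ns[0 := m])"
  shows "(\<forall>Zs\<in>ztuples ns. \<forall>W\<in>carrier_mat m (ns ! 1).
      contraction sN (ns[0 := n + m]) T (Zs[0 := Zs ! 0 @\<^sub>r W]) =
      contraction sN ns T1 Zs @\<^sub>r contraction sN (ns[0 := m]) T2 (Zs[0 := W])) \<longleftrightarrow>
    tensor_as_mat 0 (n + m) T = dsum (tensor_as_mat 0 n T1) (tensor_as_mat 0 m T2)"
proof -
  let ?na = "ns[0 := n + m]" and ?nb = "ns[0 := m]"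
  let ?Z = "\<lambda>Zs W. Zs[0 := Zs ! 0 @\<^sub>r W] :: complex mat list"
  let ?rhs = "\<lambda>a b Zs'. contract sN ns (frame a b Zs') T1 + contract sN ?nb (shift_slot 0 n (frame a b Zs')) T2"
  have lena: "length ?na = Suc k" and lenb: "length ?nb = Suc k" using len by simp_all
  have entries: "?na ! 0 = n + m" "?na ! k = ns ! k" "?nb ! 0 = m" "?nb ! k = ns ! k" using len k by simp_all
  have equiv: "?Z Zs W \<in> ztuples ?na"
    "(contraction sN ?na T (?Z Zs W) = contraction sN ns T1 Zs @\<^sub>r contraction sN ?nb T2 (Zs[0 := W])) \<longleftrightarrow>
      (\<forall>a<?na ! 0. \<forall>b<?na ! k. contract sN ?na (frame a b (?Z Zs W)) T = ?rhs a b (?Z Zs W))"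
    if Zs: "Zs \<in> ztuples ns" and W: "W \<in> carrier_mat m (ns ! 1)" for Zs W
  proof -
    have lZ: "length Zs = k" and Zi: "\<And>i. i < k \<Longrightarrow> Zs ! i \<in> carrier_mat (ns ! i) (ns ! Suc i)"
      using Zs ztuples_iff[OF len] by auto
    have Z0: "Zs ! 0 \<in> carrier_mat n (ns ! 1)" using Zi[of 0] k n by simp
    note rows = append_rows_index[OF Z0 W]
    show Za: "?Z Zs W \<in> ztuples ?na"
      unfolding ztuples_iff[OF lena] using lZ Zi Z0 W len by (auto simp: nth_list_update)
    have Zb: "Zs[0 := W] \<in> ztuples ?nb"
      unfolding ztuples_iff[OF lenb] using lZ Zi W len by (auto simp: nth_list_update)
    have C1: "contraction sN ns T1 Zs \<in> carrier_mat n (ns ! k)"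
      using contraction_carrier[OF vector_space_sN len Zs] n by simp
    have C2: "contraction sN ?nb T2 (Zs[0 := W]) \<in> carrier_mat m (ns ! k)"
      using contraction_carrier[OF vector_space_sN lenb Zb] entries by simp
    have Ca: "contraction sN ?na T (?Z Zs W) \<in> carrier_mat (n + m) (ns ! k)"
      using contraction_carrier[OF vector_space_sN lena Za] entries by simp
    have "(contraction sN ns T1 Zs @\<^sub>r contraction sN ?nb T2 (Zs[0 := W])) $$ (a, b) = ?rhs a b (?Z Zs W)"
      if a: "a < n + m" and b: "b < ns ! k" for a b
    proof (cases "a < n")
      case True
      have "contract sN ns (frame a b (?Z Zs W)) T1 = contract sN ns (frame a b Zs) T1"
        by (rule contract_cong[OF len])
          (use lZ n rows in \<open>auto simp: frame_last nth_list_update\<close>)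
      moreover have "contract sN ?nb (shift_slot 0 n (frame a b (?Z Zs W))) T2 = 0"
        by (rule contract_zero_slot[OF vector_space_sN, of 0]) (use True in \<open>auto simp: shift_slot_simps\<close>)
      ultimately show ?thesis
        using append_rows_index(1)[OF C1 C2 True b] contraction_entry[OF vector_space_sN len Zs, of a b T1] True b n by simp
    next
      case False
      define c where "c = a - n"
      have c: "a = c + n" "c < m" using False a by (auto simp: c_def)
      have "contract sN ns (frame a b (?Z Zs W)) T1 = 0"
        by (rule contract_zero_slot[OF vector_space_sN, of 0])
          (use False n len in_index_less[of _ ns 0] in auto)
      moreover have "contract sN ?nb (shift_slot 0 n (frame a b (?Z Zs W))) T2 = contract sN ?nb (frame c b (Zs[0 := W])) T2"
      proof (rule contract_cong[OF lenb])
        fix l s p assume "l < k" "s < ?nb ! l" "p < ?nb ! Suc l"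
        then show "shift_slot 0 n (frame a b (?Z Zs W)) (Suc l) s p = frame c b (Zs[0 := W]) (Suc l) s p"
          using lZ rows len by (cases "l = 0") (auto simp: shift_slot_simps nth_list_update)
      qed (use lZ c k in \<open>auto simp: shift_slot_simps frame_last\<close>)
      ultimately show ?thesis
        using append_rows_index(2)[OF C1 C2 c(2) b] contraction_entry[OF vector_space_sN lenb Zb, of c b T2] c b entries by simp
    qed
    then show "(contraction sN ?na T (?Z Zs W) = contraction sN ns T1 Zs @\<^sub>r contraction sN ?nb T2 (Zs[0 := W])) \<longleftrightarrow>
      (\<forall>a<?na ! 0. \<forall>b<?na ! k. contract sN ?na (frame a b (?Z Zs W)) T = ?rhs a b (?Z Zs W))"
      unfolding mat_eq_iff_entries[OF Ca carrier_append_rows[OF C1 C2]]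
      using contraction_entry[OF vector_space_sN lena Za, of _ _ T] entries by auto
  qed
  have surj: "\<exists>Zs\<in>ztuples ns. \<exists>W\<in>carrier_mat m (ns ! 1). Zs' = ?Z Zs W" if "Zs' \<in> ztuples ?na" for Zs'
  proof -
    have lZ: "length Zs' = k" and Zi: "\<And>i. i < k \<Longrightarrow> Zs' ! i \<in> carrier_mat (?na ! i) (?na ! Suc i)"
      using that ztuples_iff[OF lena] by auto
    have "Zs' ! 0 \<in> carrier_mat (n + m) (ns ! 1)" using Zi[of 0] k entries by simp
    then obtain B W where BW: "B \<in> carrier_mat n (ns ! 1)" "W \<in> carrier_mat m (ns ! 1)" "Zs' ! 0 = B @\<^sub>r W"
      by (rule mat_rows_decompose)
    have "Zs' = ?Z (Zs'[0 := B]) W"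
      using BW(3)[symmetric] lZ k by simp
    moreover have "Zs'[0 := B] ! i \<in> carrier_mat (ns ! i) (ns ! Suc i)" if "i < k" for i
      using Zi[OF that] BW(1) n lZ that by (cases i) auto
    then have "Zs'[0 := B] \<in> ztuples ns"
      unfolding ztuples_iff[OF len] using lZ by auto
    ultimately show ?thesis using BW(2) by blast
  qed
  show ?thesis
    unfolding tensor_dsum_iff_contract[OF vector_space_sN len le0 n T]
    by (rule ball2_surj_iff[where h = ?Z]) (fact equiv(1), fact surj, fact equiv(2))
qed

text \<open>For a slot in the middle both adjacent factors are split, and the two contractions add up.\<close>

lemma contraction_dsum_middle_iff:
  assumes len: "length ns = Suc k" and j: "Suc i < k" and n: "ns ! Suc i = n"
    and T: "T \<in> tensor_space (ns[Suc i := n + m])" "T1 \<in> tensor_space ns" "T2 \<in> tensor_space (ns[Suc i := m])"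
  shows "(\<forall>Zs\<in>ztuples ns. \<forall>V\<in>carrier_mat (ns ! i) m. \<forall>W\<in>carrier_mat m (ns ! Suc (Suc i)).
      contraction sN (ns[Suc i := n + m]) T (Zs[i := Zs ! i @\<^sub>c V, Suc i := Zs ! Suc i @\<^sub>r W]) =
      contraction sN ns T1 Zs + contraction sN (ns[Suc i := m]) T2 (Zs[i := V, Suc i := W])) \<longleftrightarrow>
    tensor_as_mat (Suc i) (n + m) T = dsum (tensor_as_mat (Suc i) n T1) (tensor_as_mat (Suc i) m T2)"
proof -
  let ?na = "ns[Suc i := n + m]" and ?nb = "ns[Suc i := m]"
  let ?Z = "\<lambda>Zs V W. Zs[i := Zs ! i @\<^sub>c V, Suc i := Zs ! Suc i @\<^sub>r W] :: complex mat list"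
  let ?rhs = "\<lambda>a b Zs'. contract sN ns (frame a b Zs') T1 + contract sN ?nb (shift_slot (Suc i) n (frame a b Zs')) T2"
  have lena: "length ?na = Suc k" and lenb: "length ?nb = Suc k" using len by simp_all
  have j': "Suc i \<le> k" using j by simp
  have entries: "?na ! 0 = ns ! 0" "?na ! k = ns ! k" "?nb ! 0 = ns ! 0" "?nb ! k = ns ! k" using len j by simp_all
  have equiv: "?Z Zs V W \<in> ztuples ?na"
    "(contraction sN ?na T (?Z Zs V W) = contraction sN ns T1 Zs + contraction sN ?nb T2 (Zs[i := V, Suc i := W])) \<longleftrightarrow>
      (\<forall>a<?na ! 0. \<forall>b<?na ! k. contract sN ?na (frame a b (?Z Zs V W)) T = ?rhs a b (?Z Zs V W))"
    if Zs: "Zs \<in> ztuples ns" and V: "V \<in> carrier_mat (ns ! i) m" and W: "W \<in> carrier_mat m (ns ! Suc (Suc i))" for Zs V W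
  proof -
    have lZ: "length Zs = k" and Zi: "\<And>l. l < k \<Longrightarrow> Zs ! l \<in> carrier_mat (ns ! l) (ns ! Suc l)"
      using Zs ztuples_iff[OF len] by auto
    have Z0: "Zs ! i \<in> carrier_mat (ns ! i) n" using Zi[of i] j n by simp
    have Z1: "Zs ! Suc i \<in> carrier_mat n (ns ! Suc (Suc i))" using Zi[of "Suc i"] j n by simp
    note rows = append_rows_index[OF Z1 W] and cols = append_cols_index[OF Z0 V]
    have "?Z Zs V W ! l \<in> carrier_mat (?na ! l) (?na ! Suc l)" if "l < k" for l
    proof -
      consider "l = i" | "l = Suc i" | "l \<noteq> i" "l \<noteq> Suc i" by blast
      then show ?thesis
        by cases (use that Zi[OF that] lZ len cols(3) carrier_append_rows[OF Z1 W] in auto)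
    qed
    then show Za: "?Z Zs V W \<in> ztuples ?na"
      unfolding ztuples_iff[OF lena] using lZ by auto
    have "Zs[i := V, Suc i := W] ! l \<in> carrier_mat (?nb ! l) (?nb ! Suc l)" if "l < k" for l
    proof -
      consider "l = i" | "l = Suc i" | "l \<noteq> i" "l \<noteq> Suc i" by blast
      then show ?thesis
        by cases (use that Zi[OF that] lZ len V W in auto)
    qed
    then have Zb: "Zs[i := V, Suc i := W] \<in> ztuples ?nb"
      unfolding ztuples_iff[OF lenb] using lZ by auto
    have C1: "contraction sN ns T1 Zs \<in> carrier_mat (ns ! 0) (ns ! k)"
      by (rule contraction_carrier[OF vector_space_sN len Zs])
    have C2: "contraction sN ?nb T2 (Zs[i := V, Suc i := W]) \<in> carrier_mat (ns ! 0) (ns ! k)"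
      using contraction_carrier[OF vector_space_sN lenb Zb] entries by simp
    have Ca: "contraction sN ?na T (?Z Zs V W) \<in> carrier_mat (ns ! 0) (ns ! k)"
      using contraction_carrier[OF vector_space_sN lena Za] entries by simp
    have "(contraction sN ns T1 Zs + contraction sN ?nb T2 (Zs[i := V, Suc i := W])) $$ (a, b) = ?rhs a b (?Z Zs V W)"
      if a: "a < ns ! 0" and b: "b < ns ! k" for a b
    proof -
      have "contract sN ns (frame a b (?Z Zs V W)) T1 = contract sN ns (frame a b Zs) T1"
      proof (rule contract_cong[OF len])
        fix l s p assume l: "l < k" "s < ns ! l" "p < ns ! Suc l"
        consider "l = i" | "l = Suc i" | "l \<noteq> i" "l \<noteq> Suc i" by blast
        then show "frame a b (?Z Zs V W) (Suc l) s p = frame a b Zs (Suc l) s p"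
          by cases (use lZ l j n rows cols in auto)
      qed (use lZ in \<open>auto simp: frame_last\<close>)
      moreover have "contract sN ?nb (shift_slot (Suc i) n (frame a b (?Z Zs V W))) T2 =
          contract sN ?nb (frame a b (Zs[i := V, Suc i := W])) T2"
      proof (rule contract_cong[OF lenb])
        fix l s p assume l: "l < k" "s < ?nb ! l" "p < ?nb ! Suc l"
        consider "l = i" | "l = Suc i" | "l \<noteq> i" "l \<noteq> Suc i" by blast
        then show "shift_slot (Suc i) n (frame a b (?Z Zs V W)) (Suc l) s p = frame a b (Zs[i := V, Suc i := W]) (Suc l) s p"
          by cases (use lZ l j len rows cols in \<open>auto simp: shift_slot_simps\<close>)
      qed (use lZ j in \<open>auto simp: shift_slot_simps frame_last\<close>)
      ultimately show ?thesis
        using C1 C2 a b contraction_entry[OF vector_space_sN len Zs, of a b T1]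
          contraction_entry[OF vector_space_sN lenb Zb, of a b T2] entries by simp
    qed
    then show "(contraction sN ?na T (?Z Zs V W) = contraction sN ns T1 Zs + contraction sN ?nb T2 (Zs[i := V, Suc i := W])) \<longleftrightarrow>
      (\<forall>a<?na ! 0. \<forall>b<?na ! k. contract sN ?na (frame a b (?Z Zs V W)) T = ?rhs a b (?Z Zs V W))"
      unfolding mat_eq_iff_entries[OF Ca add_carrier_mat[OF C2]]
      using contraction_entry[OF vector_space_sN lena Za, of _ _ T] entries by auto
  qed
  have surj: "\<exists>Zs\<in>ztuples ns. \<exists>V\<in>carrier_mat (ns ! i) m. \<exists>W\<in>carrier_mat m (ns ! Suc (Suc i)). Zs' = ?Z Zs V W"
    if "Zs' \<in> ztuples ?na" for Zs'
  proof -
    have lZ: "length Zs' = k" and Zi: "\<And>i. i < k \<Longrightarrow> Zs' ! i \<in> carrier_mat (?na ! i) (?na ! Suc i)"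
      using that ztuples_iff[OF lena] by auto
    have "Zs' ! i \<in> carrier_mat (ns ! i) (n + m)" using Zi[of i] j len by simp
    then obtain A V where AV: "A \<in> carrier_mat (ns ! i) n" "V \<in> carrier_mat (ns ! i) m" "Zs' ! i = A @\<^sub>c V"
      by (rule mat_cols_decompose)
    have "Zs' ! Suc i \<in> carrier_mat (n + m) (ns ! Suc (Suc i))" using Zi[of "Suc i"] j len by simp
    then obtain B W where BW: "B \<in> carrier_mat n (ns ! Suc (Suc i))" "W \<in> carrier_mat m (ns ! Suc (Suc i))"
      "Zs' ! Suc i = B @\<^sub>r W"
      by (rule mat_rows_decompose)
    have "?Z (Zs'[i := A, Suc i := B]) V W = Zs'"
      using AV(3)[symmetric] BW(3)[symmetric] lZ j by (intro nth_equalityI) (auto simp: nth_list_update)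
    moreover have "Zs'[i := A, Suc i := B] ! l \<in> carrier_mat (ns ! l) (ns ! Suc l)" if "l < k" for l
    proof -
      consider "l = i" | "l = Suc i" | "l \<noteq> i" "l \<noteq> Suc i" by blast
      then show ?thesis
        by cases (use that Zi[OF that] lZ n AV(1) BW(1) in auto)
    qed
    then have "Zs'[i := A, Suc i := B] \<in> ztuples ns"
      unfolding ztuples_iff[OF len] using lZ by auto
    ultimately show ?thesis using AV(2) BW(2)
      by (intro bexI[where x = "Zs'[i := A, Suc i := B]"] bexI[where x = V] bexI[where x = W]) simp_all
  qed
  show ?thesis
    unfolding tensor_dsum_iff_contract[OF vector_space_sN len j' n T]
    by (rule ball3_surj_iff[where h = ?Z]) (fact equiv(1), fact surj, fact equiv(2))
qed

lemma contraction_dsum_last_iff: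
  assumes len: "length ns = Suc (Suc i)" and n: "ns ! Suc i = n"
    and T: "T \<in> tensor_space (ns[Suc i := n + m])" "T1 \<in> tensor_space ns" "T2 \<in> tensor_space (ns[Suc i := m])"
  shows "(\<forall>Zs\<in>ztuples ns. \<forall>V\<in>carrier_mat (ns ! i) m.
      contraction sN (ns[Suc i := n + m]) T (Zs[i := Zs ! i @\<^sub>c V]) =
      contraction sN ns T1 Zs @\<^sub>c contraction sN (ns[Suc i := m]) T2 (Zs[i := V])) \<longleftrightarrow>
    tensor_as_mat (Suc i) (n + m) T = dsum (tensor_as_mat (Suc i) n T1) (tensor_as_mat (Suc i) m T2)"
proof -
  let ?k = "Suc i"
  let ?na = "ns[Suc i := n + m]" and ?nb = "ns[Suc i := m]"
  let ?Z = "\<lambda>Zs V. Zs[i := Zs ! i @\<^sub>c V] :: complex mat list"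
  let ?rhs = "\<lambda>a b Zs'. contract sN ns (frame a b Zs') T1 + contract sN ?nb (shift_slot ?k n (frame a b Zs')) T2"
  have lena: "length ?na = Suc ?k" and lenb: "length ?nb = Suc ?k" using len by simp_all
  have entries: "?na ! 0 = ns ! 0" "?na ! ?k = n + m" "?nb ! 0 = ns ! 0" "?nb ! ?k = m" using len by simp_all
  have equiv: "?Z Zs V \<in> ztuples ?na"
    "(contraction sN ?na T (?Z Zs V) = contraction sN ns T1 Zs @\<^sub>c contraction sN ?nb T2 (Zs[i := V])) \<longleftrightarrow>
      (\<forall>a<?na ! 0. \<forall>b<?na ! ?k. contract sN ?na (frame a b (?Z Zs V)) T = ?rhs a b (?Z Zs V))"
    if Zs: "Zs \<in> ztuples ns" and V: "V \<in> carrier_mat (ns ! i) m" for Zs V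
  proof -
    have lZ: "length Zs = ?k" and Zi: "\<And>l. l < ?k \<Longrightarrow> Zs ! l \<in> carrier_mat (ns ! l) (ns ! Suc l)"
      using Zs ztuples_iff[OF len] by auto
    have Z0: "Zs ! i \<in> carrier_mat (ns ! i) n" using Zi[of i] n by simp
    note cols = append_cols_index[OF Z0 V]
    have "?Z Zs V ! l \<in> carrier_mat (?na ! l) (?na ! Suc l)" if "l < ?k" for l
      by (cases "l = i") (use that Zi[OF that] lZ len cols(3) in auto)
    then show Za: "?Z Zs V \<in> ztuples ?na"
      unfolding ztuples_iff[OF lena] using lZ by auto
    have "Zs[i := V] ! l \<in> carrier_mat (?nb ! l) (?nb ! Suc l)" if "l < ?k" for l
      by (cases "l = i") (use that Zi[OF that] lZ len V in auto)
    then have Zb: "Zs[i := V] \<in> ztuples ?nb"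
      unfolding ztuples_iff[OF lenb] using lZ by auto
    have C1: "contraction sN ns T1 Zs \<in> carrier_mat (ns ! 0) n"
      using contraction_carrier[OF vector_space_sN len Zs] n by simp
    have C2: "contraction sN ?nb T2 (Zs[i := V]) \<in> carrier_mat (ns ! 0) m"
      using contraction_carrier[OF vector_space_sN lenb Zb] entries by simp
    have Ca: "contraction sN ?na T (?Z Zs V) \<in> carrier_mat (ns ! 0) (n + m)"
      using contraction_carrier[OF vector_space_sN lena Za] entries by simp
    have "(contraction sN ns T1 Zs @\<^sub>c contraction sN ?nb T2 (Zs[i := V])) $$ (a, b) = ?rhs a b (?Z Zs V)"
      if a: "a < ns ! 0" and b: "b < n + m" for a b
    proof (cases "b < n")
      case True
      have "contract sN ns (frame a b (?Z Zs V)) T1 = contract sN ns (frame a b Zs) T1"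
      proof (rule contract_cong[OF len])
        fix l s p assume l: "l < ?k" "s < ns ! l" "p < ns ! Suc l"
        then show "frame a b (?Z Zs V) (Suc l) s p = frame a b Zs (Suc l) s p"
          using lZ n cols by (cases "l = i") auto
      qed (use lZ in \<open>auto simp: frame_last\<close>)
      moreover have "contract sN ?nb (shift_slot ?k n (frame a b (?Z Zs V))) T2 = 0"
        by (rule contract_zero_slot[OF vector_space_sN, of "Suc ?k"])
          (use True lZ len in \<open>auto simp: shift_slot_simps frame_last\<close>)
      ultimately show ?thesis
        using append_cols_index(1)[OF C1 C2 a True] contraction_entry[OF vector_space_sN len Zs, of a b T1] True a n by simp
    next
      case False
      define c where "c = b - n"
      have c: "b = c + n" "c < m" using False b by (auto simp: c_def)
      have "contract sN ns (frame a b (?Z Zs V)) T1 = 0"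
        by (rule contract_zero_slot[OF vector_space_sN, of "Suc ?k"])
          (use False n len lZ out_index_less[of _ ns ?k] in \<open>auto simp: frame_last\<close>)
      moreover have "contract sN ?nb (shift_slot ?k n (frame a b (?Z Zs V))) T2 = contract sN ?nb (frame a c (Zs[i := V])) T2"
      proof (rule contract_cong[OF lenb])
        fix l s p assume "l < ?k" "s < ?nb ! l" "p < ?nb ! Suc l"
        then show "shift_slot ?k n (frame a b (?Z Zs V)) (Suc l) s p = frame a c (Zs[i := V]) (Suc l) s p"
          using lZ cols len by (cases "l = i") (auto simp: shift_slot_simps)
      qed (use lZ c in \<open>auto simp: shift_slot_simps frame_last\<close>)
      ultimately show ?thesis
        using append_cols_index(2)[OF C1 C2 a c(2)] contraction_entry[OF vector_space_sN lenb Zb, of a c T2] c a entries by simp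
    qed
    then show "(contraction sN ?na T (?Z Zs V) = contraction sN ns T1 Zs @\<^sub>c contraction sN ?nb T2 (Zs[i := V])) \<longleftrightarrow>
      (\<forall>a<?na ! 0. \<forall>b<?na ! ?k. contract sN ?na (frame a b (?Z Zs V)) T = ?rhs a b (?Z Zs V))"
      unfolding mat_eq_iff_entries[OF Ca append_cols_index(3)[OF C1 C2]]
      using contraction_entry[OF vector_space_sN lena Za, of _ _ T] entries by auto
  qed
  have surj: "\<exists>Zs\<in>ztuples ns. \<exists>V\<in>carrier_mat (ns ! i) m. Zs' = ?Z Zs V" if "Zs' \<in> ztuples ?na" for Zs'
  proof -
    have lZ: "length Zs' = ?k" and Zi: "\<And>l. l < ?k \<Longrightarrow> Zs' ! l \<in> carrier_mat (?na ! l) (?na ! Suc l)"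
      using that ztuples_iff[OF lena] by auto
    have "Zs' ! i \<in> carrier_mat (ns ! i) (n + m)" using Zi[of i] len by simp
    then obtain B V where BV: "B \<in> carrier_mat (ns ! i) n" "V \<in> carrier_mat (ns ! i) m" "Zs' ! i = B @\<^sub>c V"
      by (rule mat_cols_decompose)
    have "Zs' = ?Z (Zs'[i := B]) V"
      using BV(3)[symmetric] lZ by simp
    moreover have "Zs'[i := B] ! l \<in> carrier_mat (ns ! l) (ns ! Suc l)" if "l < ?k" for l
      by (cases "l = i") (use Zi[OF that] BV(1) n lZ that in auto)
    then have "Zs'[i := B] \<in> ztuples ns"
      unfolding ztuples_iff[OF len] using lZ by auto
    ultimately show ?thesis using BV(2) by blast
  qed
  show ?thesis
    unfolding tensor_dsum_iff_contract[OF vector_space_sN len order_refl n T]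
    by (rule ball2_surj_iff[where h = ?Z]) (fact equiv(1), fact surj, fact equiv(2))
qed

text \<open>The inverse \<open>S'\<close> in the twisted chain cancels the factor \<open>S\<close> of \<open>S Z\<^sub>1\<close>, whereas the boundary
  factor \<open>\<delta>\<^sub>a\<close> becomes the row \<open>a\<close> of \<open>S\<close>. That row yields the left multiplication by \<open>S\<close>.\<close>

lemma contraction_conjug_first_iff:
  assumes len: "length ns = Suc k" and k: "1 \<le> k" and n: "ns ! 0 = n"
    and S: "GL_inv n S S'"
    and T: "T \<in> tensor_space ns" and T': "T' \<in> tensor_space ns"
  shows "(\<forall>Zs\<in>ztuples ns. contraction sN ns T' (Zs[0 := S * Zs ! 0]) = lmul sN S (contraction sN ns T Zs)) \<longleftrightarrow>
    tensor_as_mat 0 n T' = conjug (tensor_scale sN) S (tensor_as_mat 0 n T) S'"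
proof -
  let ?Z = "\<lambda>Zs. Zs[0 := S * Zs ! 0] :: complex mat list"
  have Sc: "S \<in> carrier_mat n n" "S' \<in> carrier_mat n n" and inv: "S * S' = 1\<^sub>m n" "S' * S = 1\<^sub>m n"
    using S by (auto simp: GL_inv_def inverts_mat_def)
  have equiv: "?Z Zs \<in> ztuples ns"
    "(contraction sN ns T' (?Z Zs) = lmul sN S (contraction sN ns T Zs)) \<longleftrightarrow>
      (\<forall>a<ns ! 0. \<forall>b<ns ! k. contract sN ns (frame a b (?Z Zs)) T' =
        contract sN ns (twist_slot 0 n S S' (frame a b (?Z Zs))) T)"
    if Zs: "Zs \<in> ztuples ns" for Zs
  proof -
    have lZ: "length Zs = k" and Zi: "\<And>i. i < k \<Longrightarrow> Zs ! i \<in> carrier_mat (ns ! i) (ns ! Suc i)"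
      using Zs ztuples_iff[OF len] by auto
    have Z0: "Zs ! 0 \<in> carrier_mat n (ns ! 1)" using Zi[of 0] k n by simp
    show Za: "?Z Zs \<in> ztuples ns"
      by (rule ztuples_update[OF Zs]) (use Z0 Sc n in auto)
    have C: "contraction sN ns T Zs \<in> carrier_mat n (ns ! k)"
      using contraction_carrier[OF vector_space_sN len Zs] n by simp
    have Ca: "contraction sN ns T' (?Z Zs) \<in> carrier_mat n (ns ! k)"
      using contraction_carrier[OF vector_space_sN len Za] n by simp
    have Cl: "lmul sN S (contraction sN ns T Zs) \<in> carrier_mat n (ns ! k)"
      using C Sc by (simp add: lmul_def)
    have cancel: "(\<Sum>t<n. S' $$ (s, t) * (S * Zs ! 0) $$ (t, p)) = Zs ! 0 $$ (s, p)"
      if "s < n" "p < ns ! 1" for s p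
    proof -
      have "S' * (S * Zs ! 0) = S' * S * Zs ! 0" using Sc Z0 by (simp add: assoc_mult_mat[of _ n n _ n])
      then have "(S' * (S * Zs ! 0)) $$ (s, p) = Zs ! 0 $$ (s, p)" using inv(2) Z0 by simp
      then show ?thesis using that Sc Z0 by (simp add: scalar_prod_def atLeast0LessThan)
    qed
    have "lmul sN S (contraction sN ns T Zs) $$ (a, b) = contract sN ns (twist_slot 0 n S S' (frame a b (?Z Zs))) T"
      if a: "a < n" and b: "b < ns ! k" for a b
    proof -
      have "contract sN ns (twist_slot 0 n S S' (frame a b (?Z Zs))) T =
        contract sN ns ((frame 0 b Zs)(0 := \<lambda>s p. \<Sum>c<n. S $$ (a, c) * of_bool (p = c))) T"
      proof (rule contract_cong[OF len])
        fix s p assume "p < ns ! 0"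
        then show "twist_slot 0 n S S' (frame a b (?Z Zs)) 0 s p =
          ((frame 0 b Zs)(0 := \<lambda>s p. \<Sum>c<n. S $$ (a, c) * of_bool (p = c))) 0 s p"
          using a n by (simp add: twist_slot_simps of_bool_def if_distrib if_distribR cong: if_cong)
      next
        fix l s p assume "l < k" "s < ns ! l" "p < ns ! Suc l"
        then show "twist_slot 0 n S S' (frame a b (?Z Zs)) (Suc l) s p =
          ((frame 0 b Zs)(0 := \<lambda>s p. \<Sum>c<n. S $$ (a, c) * of_bool (p = c))) (Suc l) s p"
          using lZ n cancel by (cases "l = 0") (auto simp: twist_slot_simps)
      qed (use lZ k in \<open>auto simp: twist_slot_simps frame_last\<close>)
      also have "\<dots> = (\<Sum>c<n. sN (S $$ (a, c)) (contract sN ns ((frame 0 b Zs)(0 := \<lambda>s p. of_bool (p = c))) T))"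
        by (rule contract_sum_update[OF vector_space_sN]) simp
      also have "\<dots> = (\<Sum>c<n. sN (S $$ (a, c)) (contraction sN ns T Zs $$ (c, b)))"
      proof (rule sum.cong[OF refl])
        fix c assume "c \<in> {..<n}"
        moreover have "(frame 0 b Zs)(0 := \<lambda>s p. of_bool (p = c)) = frame c b Zs"
          by (auto simp: frame_def fun_eq_iff)
        ultimately show "sN (S $$ (a, c)) (contract sN ns ((frame 0 b Zs)(0 := \<lambda>s p. of_bool (p = c))) T) =
          sN (S $$ (a, c)) (contraction sN ns T Zs $$ (c, b))"
          using contraction_entry[OF vector_space_sN len Zs, of c b T] b n by simp
      qed
      also have "\<dots> = lmul sN S (contraction sN ns T Zs) $$ (a, b)"
        using C Sc a b by (simp add: lmul_def)
      finally show ?thesis by simp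
    qed
    then show "(contraction sN ns T' (?Z Zs) = lmul sN S (contraction sN ns T Zs)) \<longleftrightarrow>
      (\<forall>a<ns ! 0. \<forall>b<ns ! k. contract sN ns (frame a b (?Z Zs)) T' =
        contract sN ns (twist_slot 0 n S S' (frame a b (?Z Zs))) T)"
      unfolding mat_eq_iff_entries[OF Ca Cl]
      using contraction_entry[OF vector_space_sN len Za, of _ _ T'] n by auto
  qed
  have surj: "\<exists>Zs\<in>ztuples ns. Zs' = ?Z Zs" if Zs': "Zs' \<in> ztuples ns" for Zs'
  proof
    have lZ: "length Zs' = k" and Zi: "\<And>i. i < k \<Longrightarrow> Zs' ! i \<in> carrier_mat (ns ! i) (ns ! Suc i)"
      using Zs' ztuples_iff[OF len] by auto
    have Z0: "Zs' ! 0 \<in> carrier_mat n (ns ! 1)" using Zi[of 0] k n by simp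
    have "S * (S' * Zs' ! 0) = S * S' * Zs' ! 0" using Sc Z0 by (simp add: assoc_mult_mat[of _ n n _ n])
    then have "S * (S' * Zs' ! 0) = Zs' ! 0" using inv(1) Z0 by simp
    then show "Zs' = ?Z (Zs'[0 := S' * Zs' ! 0])" using lZ k by simp
    show "Zs'[0 := S' * Zs' ! 0] \<in> ztuples ns"
      by (rule ztuples_update[OF Zs']) (use Z0 Sc n in auto)
  qed
  show ?thesis
    unfolding tensor_conjug_iff_contract[OF vector_space_sN len le0 n Sc T T']
    by (rule ball_surj_iff[where h = ?Z]) (fact equiv(1), fact surj, fact equiv(2))
qed

lemma contraction_conjug_middle_iff:
  assumes len: "length ns = Suc k" and j: "Suc i < k" and n: "ns ! Suc i = n"
    and S: "GL_inv n S S'"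
    and T: "T \<in> tensor_space ns" and T': "T' \<in> tensor_space ns"
  shows "(\<forall>Zs\<in>ztuples ns. contraction sN ns T' (Zs[i := Zs ! i * S', Suc i := S * Zs ! Suc i]) = contraction sN ns T Zs) \<longleftrightarrow>
    tensor_as_mat (Suc i) n T' = conjug (tensor_scale sN) S (tensor_as_mat (Suc i) n T) S'"
proof -
  let ?Z = "\<lambda>Zs. Zs[i := Zs ! i * S', Suc i := S * Zs ! Suc i] :: complex mat list"
  have j': "Suc i \<le> k" using j by simp
  have Sc: "S \<in> carrier_mat n n" "S' \<in> carrier_mat n n" and inv: "S * S' = 1\<^sub>m n" "S' * S = 1\<^sub>m n"
    using S by (auto simp: GL_inv_def inverts_mat_def)
  have comps: "length Zs = k" "Zs ! i \<in> carrier_mat (ns ! i) n" "Zs ! Suc i \<in> carrier_mat n (ns ! Suc (Suc i))"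
    if "Zs \<in> ztuples ns" for Zs
    using that j n unfolding ztuples_iff[OF len] by auto
  have update: "Zs[i := A, Suc i := B] \<in> ztuples ns"
    if "Zs \<in> ztuples ns" "A \<in> carrier_mat (ns ! i) n" "B \<in> carrier_mat n (ns ! Suc (Suc i))" for Zs A B
    using that n by (intro ztuples_update) auto
  have equiv: "?Z Zs \<in> ztuples ns"
    "(contraction sN ns T' (?Z Zs) = contraction sN ns T Zs) \<longleftrightarrow>
      (\<forall>a<ns ! 0. \<forall>b<ns ! k. contract sN ns (frame a b (?Z Zs)) T' =
        contract sN ns (twist_slot (Suc i) n S S' (frame a b (?Z Zs))) T)"
    if Zs: "Zs \<in> ztuples ns" for Zs
  proof -
    note Z = comps[OF Zs]
    show Za: "?Z Zs \<in> ztuples ns"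
      by (rule update[OF Zs]) (use Z Sc in auto)
    note C = contraction_carrier[OF vector_space_sN len Zs, of T]
    note Ca = contraction_carrier[OF vector_space_sN len Za, of T']
    have cancel1: "(\<Sum>r<n. (Zs ! i * S') $$ (s, r) * S $$ (r, p)) = Zs ! i $$ (s, p)"
      if "s < ns ! i" "p < n" for s p
    proof -
      have "Zs ! i * S' * S = Zs ! i" using Sc Z inv(2) by (simp add: assoc_mult_mat[of _ _ n _ n])
      then have "(Zs ! i * S' * S) $$ (s, p) = Zs ! i $$ (s, p)" by simp
      then show ?thesis using that Sc Z by (simp add: scalar_prod_def atLeast0LessThan del: assoc_mult_mat)
    qed
    have cancel2: "(\<Sum>t<n. S' $$ (s, t) * (S * Zs ! Suc i) $$ (t, p)) = Zs ! Suc i $$ (s, p)"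
      if "s < n" "p < ns ! Suc (Suc i)" for s p
    proof -
      have "S' * (S * Zs ! Suc i) = S' * S * Zs ! Suc i" using Sc Z by (simp add: assoc_mult_mat[of _ n n _ n])
      then have "(S' * (S * Zs ! Suc i)) $$ (s, p) = Zs ! Suc i $$ (s, p)" using inv(2) Z by simp
      then show ?thesis using that Sc Z by (simp add: scalar_prod_def atLeast0LessThan)
    qed
    have "contraction sN ns T Zs $$ (a, b) = contract sN ns (twist_slot (Suc i) n S S' (frame a b (?Z Zs))) T"
      if a: "a < ns ! 0" and b: "b < ns ! k" for a b
    proof -
      have "contract sN ns (twist_slot (Suc i) n S S' (frame a b (?Z Zs))) T = contract sN ns (frame a b Zs) T"
      proof (rule contract_cong[OF len])
        fix l s p assume l: "l < k" "s < ns ! l" "p < ns ! Suc l"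
        consider "l = i" | "l = Suc i" | "l \<noteq> i" "l \<noteq> Suc i" by blast
        then show "twist_slot (Suc i) n S S' (frame a b (?Z Zs)) (Suc l) s p = frame a b Zs (Suc l) s p"
          by cases (use Z l j n cancel1 cancel2 in \<open>auto simp: twist_slot_simps\<close>)
      qed (use Z j in \<open>auto simp: twist_slot_simps frame_last\<close>)
      then show ?thesis using contraction_entry[OF vector_space_sN len Zs a b, of T] by simp
    qed
    then show "(contraction sN ns T' (?Z Zs) = contraction sN ns T Zs) \<longleftrightarrow>
      (\<forall>a<ns ! 0. \<forall>b<ns ! k. contract sN ns (frame a b (?Z Zs)) T' =
        contract sN ns (twist_slot (Suc i) n S S' (frame a b (?Z Zs))) T)"
      unfolding mat_eq_iff_entries[OF Ca C]
      using contraction_entry[OF vector_space_sN len Za, of _ _ T'] by auto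
  qed
  have surj: "\<exists>Zs\<in>ztuples ns. Zs' = ?Z Zs" if Zs': "Zs' \<in> ztuples ns" for Zs'
  proof
    note Z = comps[OF Zs']
    have "S * (S' * Zs' ! Suc i) = S * S' * Zs' ! Suc i" using Sc Z by (simp add: assoc_mult_mat[of _ n n _ n])
    then have "S * (S' * Zs' ! Suc i) = Zs' ! Suc i" using inv(1) Z by simp
    moreover have "Zs' ! i * S * S' = Zs' ! i" using Sc Z inv(1) by (simp add: assoc_mult_mat[of _ _ n _ n])
    ultimately show "Zs' = ?Z (Zs'[i := Zs' ! i * S, Suc i := S' * Zs' ! Suc i])"
      using Z j by (intro nth_equalityI) (auto simp: nth_list_update simp del: assoc_mult_mat)
    show "Zs'[i := Zs' ! i * S, Suc i := S' * Zs' ! Suc i] \<in> ztuples ns"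
      by (rule update[OF Zs']) (use Z Sc in auto)
  qed
  show ?thesis
    unfolding tensor_conjug_iff_contract[OF vector_space_sN len j' n Sc T T']
    by (rule ball_surj_iff[where h = ?Z]) (fact equiv(1), fact surj, fact equiv(2))
qed

text \<open>Here the boundary factor \<open>\<delta>\<^sub>b\<close> becomes the column \<open>b\<close> of \<open>S'\<close>.\<close>

lemma contraction_conjug_last_iff:
  assumes len: "length ns = Suc (Suc i)" and n: "ns ! Suc i = n"
    and S: "GL_inv n S S'"
    and T: "T \<in> tensor_space ns" and T': "T' \<in> tensor_space ns"
  shows "(\<forall>Zs\<in>ztuples ns. contraction sN ns T' (Zs[i := Zs ! i * S']) = rmul sN (contraction sN ns T Zs) S') \<longleftrightarrow>
    tensor_as_mat (Suc i) n T' = conjug (tensor_scale sN) S (tensor_as_mat (Suc i) n T) S'"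
proof -
  let ?k = "Suc i"
  let ?Z = "\<lambda>Zs. Zs[i := Zs ! i * S'] :: complex mat list"
  have Sc: "S \<in> carrier_mat n n" "S' \<in> carrier_mat n n" and inv: "S * S' = 1\<^sub>m n" "S' * S = 1\<^sub>m n"
    using S by (auto simp: GL_inv_def inverts_mat_def)
  have equiv: "?Z Zs \<in> ztuples ns"
    "(contraction sN ns T' (?Z Zs) = rmul sN (contraction sN ns T Zs) S') \<longleftrightarrow>
      (\<forall>a<ns ! 0. \<forall>b<ns ! ?k. contract sN ns (frame a b (?Z Zs)) T' =
        contract sN ns (twist_slot ?k n S S' (frame a b (?Z Zs))) T)"
    if Zs: "Zs \<in> ztuples ns" for Zs
  proof -
    have lZ: "length Zs = ?k" and Zi: "\<And>l. l < ?k \<Longrightarrow> Zs ! l \<in> carrier_mat (ns ! l) (ns ! Suc l)"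
      using Zs ztuples_iff[OF len] by auto
    have Z0: "Zs ! i \<in> carrier_mat (ns ! i) n" using Zi[of i] n by simp
    show Za: "?Z Zs \<in> ztuples ns"
      by (rule ztuples_update[OF Zs]) (use Z0 Sc n in auto)
    have C: "contraction sN ns T Zs \<in> carrier_mat (ns ! 0) n"
      using contraction_carrier[OF vector_space_sN len Zs] n by simp
    have Ca: "contraction sN ns T' (?Z Zs) \<in> carrier_mat (ns ! 0) n"
      using contraction_carrier[OF vector_space_sN len Za] n by simp
    have Cr: "rmul sN (contraction sN ns T Zs) S' \<in> carrier_mat (ns ! 0) n"
      using C Sc by (simp add: rmul_def)
    have cancel: "(\<Sum>r<n. (Zs ! i * S') $$ (s, r) * S $$ (r, p)) = Zs ! i $$ (s, p)"
      if "s < ns ! i" "p < n" for s p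
    proof -
      have "Zs ! i * S' * S = Zs ! i" using Sc Z0 inv(2) by (simp add: assoc_mult_mat[of _ _ n _ n])
      then have "(Zs ! i * S' * S) $$ (s, p) = Zs ! i $$ (s, p)" by simp
      then show ?thesis using that Sc Z0 by (simp add: scalar_prod_def atLeast0LessThan del: assoc_mult_mat)
    qed
    have "rmul sN (contraction sN ns T Zs) S' $$ (a, b) = contract sN ns (twist_slot ?k n S S' (frame a b (?Z Zs))) T"
      if a: "a < ns ! 0" and b: "b < n" for a b
    proof -
      have "contract sN ns (twist_slot ?k n S S' (frame a b (?Z Zs))) T =
        contract sN ns ((frame a 0 Zs)(Suc ?k := \<lambda>s p. \<Sum>c<n. S' $$ (c, b) * of_bool (s = c))) T"
      proof (rule contract_cong[OF len])
        fix s p assume "s < ns ! ?k"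
        then show "twist_slot ?k n S S' (frame a b (?Z Zs)) (Suc ?k) s p =
          ((frame a 0 Zs)(Suc ?k := \<lambda>s p. \<Sum>c<n. S' $$ (c, b) * of_bool (s = c))) (Suc ?k) s p"
          using b n lZ by (simp add: twist_slot_simps frame_last of_bool_def if_distrib if_distribR cong: if_cong)
      next
        fix l s p assume "l < ?k" "s < ns ! l" "p < ns ! Suc l"
        then show "twist_slot ?k n S S' (frame a b (?Z Zs)) (Suc l) s p =
          ((frame a 0 Zs)(Suc ?k := \<lambda>s p. \<Sum>c<n. S' $$ (c, b) * of_bool (s = c))) (Suc l) s p"
          using lZ n cancel by (cases "l = i") (auto simp: twist_slot_simps)
      qed (simp add: twist_slot_simps)
      also have "\<dots> = (\<Sum>c<n. sN (S' $$ (c, b)) (contract sN ns ((frame a 0 Zs)(Suc ?k := \<lambda>s p. of_bool (s = c))) T))"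
        by (rule contract_sum_update[OF vector_space_sN]) (simp add: len)
      also have "\<dots> = (\<Sum>c<n. sN (S' $$ (c, b)) (contraction sN ns T Zs $$ (a, c)))"
      proof (rule sum.cong[OF refl])
        fix c assume "c \<in> {..<n}"
        moreover have "(frame a 0 Zs)(Suc ?k := \<lambda>s p. of_bool (s = c)) = frame a c Zs"
          using lZ by (auto simp: frame_def fun_eq_iff)
        ultimately show "sN (S' $$ (c, b)) (contract sN ns ((frame a 0 Zs)(Suc ?k := \<lambda>s p. of_bool (s = c))) T) =
          sN (S' $$ (c, b)) (contraction sN ns T Zs $$ (a, c))"
          using contraction_entry[OF vector_space_sN len Zs, of a c T] a n by simp
      qed
      also have "\<dots> = rmul sN (contraction sN ns T Zs) S' $$ (a, b)"
        using C Sc a b by (simp add: rmul_def)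
      finally show ?thesis by simp
    qed
    then show "(contraction sN ns T' (?Z Zs) = rmul sN (contraction sN ns T Zs) S') \<longleftrightarrow>
      (\<forall>a<ns ! 0. \<forall>b<ns ! ?k. contract sN ns (frame a b (?Z Zs)) T' =
        contract sN ns (twist_slot ?k n S S' (frame a b (?Z Zs))) T)"
      unfolding mat_eq_iff_entries[OF Ca Cr]
      using contraction_entry[OF vector_space_sN len Za, of _ _ T'] n by auto
  qed
  have surj: "\<exists>Zs\<in>ztuples ns. Zs' = ?Z Zs" if Zs': "Zs' \<in> ztuples ns" for Zs'
  proof
    have lZ: "length Zs' = ?k" and Z0: "Zs' ! i \<in> carrier_mat (ns ! i) n"
      using Zs' ztuples_iff[OF len] n by auto
    have "Zs' ! i * S * S' = Zs' ! i" using Sc Z0 inv(1) by (simp add: assoc_mult_mat[of _ _ n _ n])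
    then show "Zs' = ?Z (Zs'[i := Zs' ! i * S])" using lZ by (simp del: assoc_mult_mat)
    show "Zs'[i := Zs' ! i * S] \<in> ztuples ns"
      by (rule ztuples_update[OF Zs']) (use Z0 Sc n in auto)
  qed
  show ?thesis
    unfolding tensor_conjug_iff_contract[OF vector_space_sN len order_refl n Sc T T']
    by (rule ball_surj_iff[where h = ?Z]) (fact equiv(1), fact surj, fact equiv(2))
qed

end

section \<open>The isomorphism of spaces of nc functions\<close>

text \<open>\<open>F\<close> respects direct sums in the variable \<open>j\<close>, for the summands \<open>Xs ! j\<close> and \<open>Y\<close>.\<close>

definition slot_dsum ::
  "('m::ab_group_add mat list \<Rightarrow> 'n::ab_group_add tensor) \<Rightarrow> nat \<Rightarrow> 'm mat list \<Rightarrow> 'm mat \<Rightarrow> bool" where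
  "slot_dsum F j Xs Y \<longleftrightarrow>
     tensor_as_mat j (dim_row (Xs ! j) + dim_row Y) (F (Xs[j := dsum (Xs ! j) Y])) =
     dsum (tensor_as_mat j (dim_row (Xs ! j)) (F Xs)) (tensor_as_mat j (dim_row Y) (F (Xs[j := Y])))"

text \<open>\<open>F\<close> respects the similarity by \<open>S\<close> in the variable \<open>j\<close> at \<open>Xs\<close>, where \<open>S'\<close> is the inverse of \<open>S\<close>.\<close>

definition slot_similarity ::
  "(complex \<Rightarrow> 'm::ab_group_add \<Rightarrow> 'm) \<Rightarrow> (complex \<Rightarrow> 'n::ab_group_add \<Rightarrow> 'n) \<Rightarrow>
   ('m mat list \<Rightarrow> 'n tensor) \<Rightarrow> nat \<Rightarrow> 'm mat list \<Rightarrow> complex mat \<Rightarrow> complex mat \<Rightarrow> bool" where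
  "slot_similarity sM sN F j Xs S S' \<longleftrightarrow>
     tensor_as_mat j (dim_row (Xs ! j)) (F (Xs[j := conjug sM S (Xs ! j) S'])) =
     conjug (tensor_scale sN) S (tensor_as_mat j (dim_row (Xs ! j)) (F Xs)) S'"

text \<open>The inverse of \<open>rho\<close>.\<close>

definition contraction_family ::
  "(complex \<Rightarrow> 'n::ab_group_add \<Rightarrow> 'n) \<Rightarrow> nat \<Rightarrow> (nat \<Rightarrow> 'm mat set) \<Rightarrow>
   ('m mat list \<Rightarrow> 'n tensor) \<Rightarrow> ('m, 'n) nc_map" where
  "contraction_family sN k \<Omega> F = (\<lambda>Xs\<in>xtuples k \<Omega>. contraction sN (sizes Xs) (F Xs))"

lemma dim_row_dsum [simp]: "dim_row (dsum X Y) = dim_row X + dim_row Y"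
  by (simp add: dsum_def)

lemma xtuples_update:
  "Xs \<in> xtuples k \<Omega> \<Longrightarrow> j \<le> k \<Longrightarrow> Y \<in> \<Omega> j \<Longrightarrow> Xs[j := Y] \<in> xtuples k \<Omega>"
  by (auto simp: xtuples_def nth_list_update)

lemma xtuplesD:
  assumes "Xs \<in> xtuples k \<Omega>"
  shows "length Xs = Suc k" "length (sizes Xs) = Suc k" "j \<le> k \<Longrightarrow> Xs ! j \<in> \<Omega> j"
    "j \<le> k \<Longrightarrow> sizes Xs ! j = dim_row (Xs ! j)"
  using assms by (auto simp: xtuples_def)

lemma slots_split:
  fixes k :: nat
  shows "(\<forall>j\<le>k. P j) \<longleftrightarrow> P 0 \<and> (\<forall>j\<in>{1..<k}. P j) \<and> P k"
proof -
  have "j = 0 \<or> j \<in> {1..<k} \<or> j = k" if "j \<le> k" for j using that by auto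
  then show ?thesis by (metis atLeastLessThan_iff le0 less_imp_le order_refl)
qed

context
  fixes k :: nat
    and sM :: "complex \<Rightarrow> 'm::ab_group_add \<Rightarrow> 'm"
    and sN :: "complex \<Rightarrow> 'n::ab_group_add \<Rightarrow> 'n"
    and M :: "nat \<Rightarrow> 'm set"
    and \<Omega> :: "nat \<Rightarrow> 'm mat set"
  assumes k: "k \<ge> 1"
    and vector_space_sN: "vector_space sN"
    and nc_sets: "\<forall>j\<le>k. nc_set (M j) (\<Omega> j)"
begin

lemma nc_set_square: "j \<le> k \<Longrightarrow> X \<in> \<Omega> j \<Longrightarrow> X \<in> carrier_mat (dim_row X) (dim_row X)"
  using nc_sets by (fastforce simp: nc_set_def nc_space_def mats_over_def)

lemma nc_set_dsum: "j \<le> k \<Longrightarrow> X \<in> \<Omega> j \<Longrightarrow> Y \<in> \<Omega> j \<Longrightarrow> dsum X Y \<in> \<Omega> j"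
  using nc_sets by (auto simp: nc_set_def)

context
  fixes F :: "'m mat list \<Rightarrow> 'n tensor"
  assumes F: "F \<in> (\<Pi>\<^sub>E Xs\<in>xtuples k \<Omega>. tensor_space (sizes Xs))"
begin

lemma F_tensor_space: "Xs \<in> xtuples k \<Omega> \<Longrightarrow> F Xs \<in> tensor_space (sizes Xs)"
  using F by auto

lemma F_update_tensor_space:
  assumes "Xs \<in> xtuples k \<Omega>" "j \<le> k" "Y \<in> \<Omega> j" "dim_row Y = n"
  shows "F (Xs[j := Y]) \<in> tensor_space ((sizes Xs)[j := n])"
  using F_tensor_space[OF xtuples_update[OF assms(1-3)]] assms(4) by (simp add: map_update)

lemma contraction_family_update:
  assumes "Xs \<in> xtuples k \<Omega>" "j \<le> k" "Y \<in> \<Omega> j" "dim_row Y = n"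
  shows "contraction_family sN k \<Omega> F (Xs[j := Y]) = contraction sN ((sizes Xs)[j := n]) (F (Xs[j := Y]))"
  using xtuples_update[OF assms(1-3)] assms(4) by (simp add: contraction_family_def map_update)

text \<open>Since the tuple \<open>Xs\<close> is arbitrary, it is enough to state the conditions of a nc function of the
  variable \<open>j\<close> at the component \<open>Xs ! j\<close>. The condition on the space of values holds automatically.\<close>

lemma tensorial_nc_iff_slots:
  "F \<in> tensorial_nc sM sN k \<Omega> \<longleftrightarrow>
    (\<forall>j\<le>k. \<forall>Xs\<in>xtuples k \<Omega>. (\<forall>Y\<in>\<Omega> j. slot_dsum F j Xs Y) \<and>
      (\<forall>S S'. GL_inv (dim_row (Xs ! j)) S S' \<longrightarrow> conjug sM S (Xs ! j) S' \<in> \<Omega> j \<longrightarrow>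
        slot_similarity sM sN F j Xs S S'))" (is "_ \<longleftrightarrow> ?R")
proof -
  let ?f = "\<lambda>j Xs Y. tensor_as_mat j (dim_row Y) (F (Xs[j := Y]))"
  let ?nc = "\<lambda>j Xs. nc_function sM (tensor_scale sN) (tensor_space (remove_nth j (sizes Xs))) (\<Omega> j) (?f j Xs)"
  have "F \<in> tensorial_nc sM sN k \<Omega> \<longleftrightarrow> (\<forall>j\<le>k. \<forall>Xs\<in>xtuples k \<Omega>. ?nc j Xs)"
    using F unfolding tensorial_nc_def by blast
  also have "\<dots> \<longleftrightarrow> ?R"
  proof (intro iffI allI impI ballI)
    fix j Xs
    assume nc: "\<forall>j\<le>k. \<forall>Xs\<in>xtuples k \<Omega>. ?nc j Xs" and j: "j \<le> k" and Xs: "Xs \<in> xtuples k \<Omega>"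
    then have nc: "?nc j Xs" by blast
    have X: "Xs ! j \<in> \<Omega> j" by (rule xtuplesD(3)[OF Xs j])
    have X': "Xs ! j \<in> \<Omega> j \<inter> carrier_mat (dim_row (Xs ! j)) (dim_row (Xs ! j))"
      using nc_set_square[OF j X] X by blast
    show "(\<forall>Y\<in>\<Omega> j. slot_dsum F j Xs Y) \<and>
      (\<forall>S S'. GL_inv (dim_row (Xs ! j)) S S' \<longrightarrow> conjug sM S (Xs ! j) S' \<in> \<Omega> j \<longrightarrow>
        slot_similarity sM sN F j Xs S S')"
    proof (intro conjI ballI allI impI)
      fix Y assume "Y \<in> \<Omega> j"
      then have "?f j Xs (dsum (Xs ! j) Y) = dsum (?f j Xs (Xs ! j)) (?f j Xs Y)"
        using nc X unfolding nc_function_def by blast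
      then show "slot_dsum F j Xs Y" by (simp add: slot_dsum_def)
    next
      fix S S' assume S: "GL_inv (dim_row (Xs ! j)) S S'" and "conjug sM S (Xs ! j) S' \<in> \<Omega> j"
      then have "?f j Xs (conjug sM S (Xs ! j) S') = conjug (tensor_scale sN) S (?f j Xs (Xs ! j)) S'"
        using nc X' unfolding nc_function_def by blast
      moreover have "dim_row (conjug sM S (Xs ! j) S') = dim_row (Xs ! j)"
        using S by (auto simp: rmul_def lmul_def GL_inv_def)
      ultimately show "slot_similarity sM sN F j Xs S S'" by (simp add: slot_similarity_def)
    qed
  next
    fix j Xs
    assume R: ?R and j: "j \<le> k" and Xs: "Xs \<in> xtuples k \<Omega>"
    have jl: "j < length Xs" using xtuplesD(1)[OF Xs] j by simp
    have up: "Xs[j := X] \<in> xtuples k \<Omega>" "Xs[j := X] ! j = X" "Xs[j := X, j := Y] = Xs[j := Y]"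
      if "X \<in> \<Omega> j" for X Y
      using xtuples_update[OF Xs j that] jl by simp_all
    show "?nc j Xs"
      unfolding nc_function_def
    proof (intro conjI allI ballI impI)
      fix n X assume X: "X \<in> \<Omega> j \<inter> carrier_mat n n"
      have "tensor_as_mat j ((sizes (Xs[j := X])) ! j) (F (Xs[j := X])) \<in>
        mats_over (tensor_space (remove_nth j (sizes (Xs[j := X])))) (sizes (Xs[j := X]) ! j) (sizes (Xs[j := X]) ! j)"
        using X jl up by (intro tensor_as_mat_mats_over F_tensor_space) auto
      moreover have "sizes (Xs[j := X]) = (sizes Xs)[j := n]" "(sizes Xs)[j := n] ! j = n"
        "remove_nth j ((sizes Xs)[j := n]) = remove_nth j (sizes Xs)"
        using X jl by (auto simp: map_update)
      ultimately show "?f j Xs X \<in> mats_over (tensor_space (remove_nth j (sizes Xs))) n n"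
        using X by auto
    next
      fix X Y assume X: "X \<in> \<Omega> j" and Y: "Y \<in> \<Omega> j"
      have "slot_dsum F j (Xs[j := X]) Y" using R j up(1)[OF X] Y by blast
      then show "?f j Xs (dsum X Y) = dsum (?f j Xs X) (?f j Xs Y)"
        unfolding slot_dsum_def up(2)[OF X] up(3)[OF X] by simp
    next
      fix n X S S'
      assume X: "X \<in> \<Omega> j \<inter> carrier_mat n n" and S: "GL_inv n S S'" and C: "conjug sM S X S' \<in> \<Omega> j"
      have X': "X \<in> \<Omega> j" "dim_row X = n" using X by auto
      have "GL_inv (dim_row (Xs[j := X] ! j)) S S'" "conjug sM S (Xs[j := X] ! j) S' \<in> \<Omega> j"
        unfolding up(2)[OF X'(1)] using S C X'(2) by simp_all
      then have "slot_similarity sM sN F j (Xs[j := X]) S S'" using R j up(1)[OF X'(1)] by blast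
      moreover have "dim_row (conjug sM S X S') = dim_row X"
        using S X' by (auto simp: rmul_def lmul_def GL_inv_def)
      ultimately show "?f j Xs (conjug sM S X S') = conjug (tensor_scale sN) S (?f j Xs X) S'"
        unfolding slot_similarity_def up(2)[OF X'(1)] up(3)[OF X'(1)] by simp
    qed
  qed
  finally show ?thesis .
qed

lemma respects_dsum_iff_slots:
  "respects_dsum k \<Omega> (contraction_family sN k \<Omega> F) \<longleftrightarrow>
    (\<forall>j\<le>k. \<forall>Xs\<in>xtuples k \<Omega>. \<forall>Y\<in>\<Omega> j. slot_dsum F j Xs Y)"
proof -
  let ?f = "contraction_family sN k \<Omega> F"
  have f: "?f Xs = contraction sN (sizes Xs) (F Xs)" if "Xs \<in> xtuples k \<Omega>" for Xs
    using that by (simp add: contraction_family_def)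
  have "slot_dsum F 0 Xs Y \<longleftrightarrow> (\<forall>Zs\<in>ztuples (sizes Xs). \<forall>W\<in>carrier_mat (dim_row Y) (dim_row (Xs ! 1)).
      ?f (Xs[0 := dsum (Xs ! 0) Y]) (Zs[0 := (Zs ! 0) @\<^sub>r W]) = ?f Xs Zs @\<^sub>r ?f (Xs[0 := Y]) (Zs[0 := W]))"
    if Xs: "Xs \<in> xtuples k \<Omega>" and Y: "Y \<in> \<Omega> 0" for Xs Y
  proof -
    have D: "dsum (Xs ! 0) Y \<in> \<Omega> 0" by (rule nc_set_dsum) (use xtuplesD(3)[OF Xs] Y in auto)
    show ?thesis
      using contraction_dsum_first_iff[OF vector_space_sN xtuplesD(2)[OF Xs] k xtuplesD(4)[OF Xs]
          F_update_tensor_space[OF Xs le0 D dim_row_dsum] F_tensor_space[OF Xs] F_update_tensor_space[OF Xs le0 Y refl]]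
      unfolding slot_dsum_def contraction_family_update[OF Xs le0 D dim_row_dsum]
        contraction_family_update[OF Xs le0 Y refl] f[OF Xs] xtuplesD(4)[OF Xs k] by simp
  qed
  moreover have "slot_dsum F j Xs Y \<longleftrightarrow> (\<forall>Zs\<in>ztuples (sizes Xs).
      \<forall>V\<in>carrier_mat (dim_row (Xs ! (j - 1))) (dim_row Y).
      \<forall>W\<in>carrier_mat (dim_row Y) (dim_row (Xs ! (j + 1))).
      ?f (Xs[j := dsum (Xs ! j) Y]) (Zs[j - 1 := (Zs ! (j - 1)) @\<^sub>c V, j := (Zs ! j) @\<^sub>r W]) =
      ?f Xs Zs + ?f (Xs[j := Y]) (Zs[j - 1 := V, j := W]))"
    if Xs: "Xs \<in> xtuples k \<Omega>" and j: "j \<in> {1..<k}" and Y: "Y \<in> \<Omega> j" for Xs j Y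
  proof -
    obtain i where i: "j = Suc i" "Suc i < k" using j by (cases j) auto
    have jk: "j \<le> k" using j by simp
    have D: "dsum (Xs ! j) Y \<in> \<Omega> j" by (rule nc_set_dsum) (use xtuplesD(3)[OF Xs] Y jk in auto)
    have n: "sizes Xs ! Suc i = dim_row (Xs ! Suc i)" "sizes Xs ! i = dim_row (Xs ! i)"
      "sizes Xs ! Suc (Suc i) = dim_row (Xs ! Suc (Suc i))"
      using xtuplesD(4)[OF Xs] i by simp_all
    show ?thesis
      using contraction_dsum_middle_iff[OF vector_space_sN xtuplesD(2)[OF Xs] i(2) n(1)
          F_update_tensor_space[OF Xs jk D dim_row_dsum, unfolded i(1)] F_tensor_space[OF Xs]
          F_update_tensor_space[OF Xs jk Y refl, unfolded i(1)]]
      unfolding slot_dsum_def contraction_family_update[OF Xs jk D dim_row_dsum]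
        contraction_family_update[OF Xs jk Y refl] f[OF Xs] unfolding i(1) n by simp
  qed
  moreover have "slot_dsum F k Xs Y \<longleftrightarrow> (\<forall>Zs\<in>ztuples (sizes Xs).
      \<forall>V\<in>carrier_mat (dim_row (Xs ! (k - 1))) (dim_row Y).
      ?f (Xs[k := dsum (Xs ! k) Y]) (Zs[k - 1 := (Zs ! (k - 1)) @\<^sub>c V]) =
      ?f Xs Zs @\<^sub>c ?f (Xs[k := Y]) (Zs[k - 1 := V]))"
    if Xs: "Xs \<in> xtuples k \<Omega>" and Y: "Y \<in> \<Omega> k" for Xs Y
  proof -
    obtain i where i: "k = Suc i" using k by (cases k) auto
    have D: "dsum (Xs ! k) Y \<in> \<Omega> k" by (rule nc_set_dsum) (use xtuplesD(3)[OF Xs] Y in auto)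
    have n: "sizes Xs ! Suc i = dim_row (Xs ! Suc i)" "sizes Xs ! i = dim_row (Xs ! i)"
      using xtuplesD(4)[OF Xs] i by simp_all
    show ?thesis
      using contraction_dsum_last_iff[OF vector_space_sN xtuplesD(2)[OF Xs, unfolded i] n(1)
          F_update_tensor_space[OF Xs order_refl D dim_row_dsum, unfolded i] F_tensor_space[OF Xs]
          F_update_tensor_space[OF Xs order_refl Y refl, unfolded i]]
      unfolding slot_dsum_def contraction_family_update[OF Xs order_refl D dim_row_dsum]
        contraction_family_update[OF Xs order_refl Y refl] f[OF Xs] unfolding i n by simp
  qed
  ultimately show ?thesis
    unfolding respects_dsum_def slots_split by (auto 0 3)
qed

lemma respects_similarity_iff_slots:
  "respects_similarity sM sN k \<Omega> (contraction_family sN k \<Omega> F) \<longleftrightarrow>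
    (\<forall>j\<le>k. \<forall>Xs\<in>xtuples k \<Omega>. \<forall>S S'. GL_inv (dim_row (Xs ! j)) S S' \<longrightarrow> conjug sM S (Xs ! j) S' \<in> \<Omega> j \<longrightarrow>
        slot_similarity sM sN F j Xs S S')"
proof -
  let ?f = "contraction_family sN k \<Omega> F"
  have f: "?f Xs = contraction sN (sizes Xs) (F Xs)" if "Xs \<in> xtuples k \<Omega>" for Xs
    using that by (simp add: contraction_family_def)
  have upd: "F (Xs[j := conjug sM S (Xs ! j) S']) \<in> tensor_space (sizes Xs)"
    "?f (Xs[j := conjug sM S (Xs ! j) S']) = contraction sN (sizes Xs) (F (Xs[j := conjug sM S (Xs ! j) S']))"
    if Xs: "Xs \<in> xtuples k \<Omega>" and j: "j \<le> k" and S: "GL_inv (dim_row (Xs ! j)) S S'"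
      and C: "conjug sM S (Xs ! j) S' \<in> \<Omega> j" for Xs j S S'
  proof -
    have d: "dim_row (conjug sM S (Xs ! j) S') = dim_row (Xs ! j)"
      using S by (auto simp: rmul_def lmul_def GL_inv_def)
    have s: "(sizes Xs)[j := dim_row (Xs ! j)] = sizes Xs"
      using xtuplesD(4)[OF Xs j] by (metis list_update_id)
    show "F (Xs[j := conjug sM S (Xs ! j) S']) \<in> tensor_space (sizes Xs)"
      using F_update_tensor_space[OF Xs j C d] unfolding s .
    show "?f (Xs[j := conjug sM S (Xs ! j) S']) = contraction sN (sizes Xs) (F (Xs[j := conjug sM S (Xs ! j) S']))"
      using contraction_family_update[OF Xs j C d] unfolding s .
  qed
  have "slot_similarity sM sN F 0 Xs S S' \<longleftrightarrow> (\<forall>Zs\<in>ztuples (sizes Xs).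
      ?f (Xs[0 := conjug sM S (Xs ! 0) S']) (Zs[0 := S * (Zs ! 0)]) = lmul sN S (?f Xs Zs))"
    if Xs: "Xs \<in> xtuples k \<Omega>" and S: "GL_inv (dim_row (Xs ! 0)) S S'"
      and C: "conjug sM S (Xs ! 0) S' \<in> \<Omega> 0" for Xs S S'
    using contraction_conjug_first_iff[OF vector_space_sN xtuplesD(2)[OF Xs] k xtuplesD(4)[OF Xs le0] S
        F_tensor_space[OF Xs] upd(1)[OF Xs le0 S C]]
    unfolding slot_similarity_def upd(2)[OF Xs le0 S C] f[OF Xs] by simp
  moreover have "slot_similarity sM sN F j Xs S S' \<longleftrightarrow> (\<forall>Zs\<in>ztuples (sizes Xs).
      ?f (Xs[j := conjug sM S (Xs ! j) S']) (Zs[j - 1 := (Zs ! (j - 1)) * S', j := S * (Zs ! j)]) = ?f Xs Zs)"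
    if Xs: "Xs \<in> xtuples k \<Omega>" and j: "j \<in> {1..<k}" and S: "GL_inv (dim_row (Xs ! j)) S S'"
      and C: "conjug sM S (Xs ! j) S' \<in> \<Omega> j" for Xs j S S'
  proof -
    obtain i where i: "j = Suc i" "Suc i < k" using j by (cases j) auto
    have jk: "j \<le> k" using j by simp
    show ?thesis
      using contraction_conjug_middle_iff[OF vector_space_sN xtuplesD(2)[OF Xs] i(2) xtuplesD(4)[OF Xs jk, unfolded i(1)]
          S[unfolded i(1)] F_tensor_space[OF Xs] upd(1)[OF Xs jk S C, unfolded i(1)]]
      unfolding slot_similarity_def upd(2)[OF Xs jk S C] f[OF Xs] unfolding i(1) by simp
  qed
  moreover have "slot_similarity sM sN F k Xs S S' \<longleftrightarrow> (\<forall>Zs\<in>ztuples (sizes Xs).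
      ?f (Xs[k := conjug sM S (Xs ! k) S']) (Zs[k - 1 := (Zs ! (k - 1)) * S']) = rmul sN (?f Xs Zs) S')"
    if Xs: "Xs \<in> xtuples k \<Omega>" and S: "GL_inv (dim_row (Xs ! k)) S S'"
      and C: "conjug sM S (Xs ! k) S' \<in> \<Omega> k" for Xs S S'
  proof -
    obtain i where i: "k = Suc i" using k by (cases k) auto
    show ?thesis
      using contraction_conjug_last_iff[OF vector_space_sN xtuplesD(2)[OF Xs, unfolded i]
          xtuplesD(4)[OF Xs order_refl, unfolded i] S[unfolded i] F_tensor_space[OF Xs]
          upd(1)[OF Xs order_refl S C, unfolded i]]
      unfolding slot_similarity_def upd(2)[OF Xs order_refl S C] f[OF Xs] unfolding i by simp
  qed
  ultimately show ?thesis
    unfolding respects_similarity_def slots_split by (auto 0 3)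
qed

lemma contraction_family_nc_order_iff:
  "contraction_family sN k \<Omega> F \<in> nc_order sM sN k \<Omega> \<longleftrightarrow> F \<in> tensorial_nc sM sN k \<Omega>"
proof -
  have "contraction_family sN k \<Omega> F \<in> (\<Pi>\<^sub>E Xs\<in>xtuples k \<Omega>. hom_space sN (sizes Xs))"
    using contraction_multilinear[OF vector_space_sN xtuplesD(2)]
    by (auto simp: contraction_family_def)
  then have "contraction_family sN k \<Omega> F \<in> nc_order sM sN k \<Omega> \<longleftrightarrow>
      respects_dsum k \<Omega> (contraction_family sN k \<Omega> F) \<and> respects_similarity sM sN k \<Omega> (contraction_family sN k \<Omega> F)"
    by (simp add: nc_order_def)
  then show ?thesis
    unfolding respects_dsum_iff_slots respects_similarity_iff_slots tensorial_nc_iff_slots by blast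
qed

lemma rho_contraction_family: "rho sN k \<Omega> (contraction_family sN k \<Omega> F) = F"
proof (rule extensionalityI[of _ "xtuples k \<Omega>"])
  fix Xs assume Xs: "Xs \<in> xtuples k \<Omega>"
  then show "rho sN k \<Omega> (contraction_family sN k \<Omega> F) Xs = F Xs"
    using iota_contraction[OF vector_space_sN xtuplesD(2)[OF Xs] F_tensor_space[OF Xs]]
    by (simp add: rho_def contraction_family_def)
qed (use F in \<open>auto simp: rho_def PiE_iff\<close>)

end

lemma contraction_family_rho:
  assumes f: "f \<in> nc_order sM sN k \<Omega>"
  shows "rho sN k \<Omega> f \<in> (\<Pi>\<^sub>E Xs\<in>xtuples k \<Omega>. tensor_space (sizes Xs))"
    "contraction_family sN k \<Omega> (rho sN k \<Omega> f) = f"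
proof -
  have hom: "f Xs \<in> hom_space sN (sizes Xs)" if "Xs \<in> xtuples k \<Omega>" for Xs
    using f that by (auto simp: nc_order_def)
  show "rho sN k \<Omega> f \<in> (\<Pi>\<^sub>E Xs\<in>xtuples k \<Omega>. tensor_space (sizes Xs))"
    using contraction_iota(1)[OF vector_space_sN xtuplesD(2) hom] by (auto simp: rho_def)
  show "contraction_family sN k \<Omega> (rho sN k \<Omega> f) = f"
  proof (rule extensionalityI[of _ "xtuples k \<Omega>"])
    fix Xs assume Xs: "Xs \<in> xtuples k \<Omega>"
    then show "contraction_family sN k \<Omega> (rho sN k \<Omega> f) Xs = f Xs"
      using contraction_iota(2)[OF vector_space_sN xtuplesD(2)[OF Xs] hom[OF Xs]]
      by (simp add: rho_def contraction_family_def)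
  qed (use f in \<open>auto simp: contraction_family_def nc_order_def PiE_iff\<close>)
qed

lemma rho_tensorial_nc:
  assumes "f \<in> nc_order sM sN k \<Omega>"
  shows "rho sN k \<Omega> f \<in> tensorial_nc sM sN k \<Omega>"
  using contraction_family_nc_order_iff[OF contraction_family_rho(1)[OF assms]]
  unfolding contraction_family_rho(2)[OF assms] using assms by blast

lemma rho_bij: "bij_betw (rho sN k \<Omega>) (nc_order sM sN k \<Omega>) (tensorial_nc sM sN k \<Omega>)"
proof (rule bij_betw_byWitness[where f' = "contraction_family sN k \<Omega>"])
  have PiE: "F \<in> (\<Pi>\<^sub>E Xs\<in>xtuples k \<Omega>. tensor_space (sizes Xs))" if "F \<in> tensorial_nc sM sN k \<Omega>" for F
    using that unfolding tensorial_nc_def by blast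
  show "\<forall>f\<in>nc_order sM sN k \<Omega>. contraction_family sN k \<Omega> (rho sN k \<Omega> f) = f"
    using contraction_family_rho(2) by blast
  show "\<forall>F\<in>tensorial_nc sM sN k \<Omega>. rho sN k \<Omega> (contraction_family sN k \<Omega> F) = F"
    using rho_contraction_family PiE by blast
  show "rho sN k \<Omega> ` nc_order sM sN k \<Omega> \<subseteq> tensorial_nc sM sN k \<Omega>"
    using rho_tensorial_nc by blast
  show "contraction_family sN k \<Omega> ` tensorial_nc sM sN k \<Omega> \<subseteq> nc_order sM sN k \<Omega>"
    using contraction_family_nc_order_iff PiE by blast
qed

lemma rho_add:
  assumes f: "f \<in> nc_order sM sN k \<Omega>" and g: "g \<in> nc_order sM sN k \<Omega>"
  shows "rho sN k \<Omega> (nc_order_add k \<Omega> f g) = tensorial_add k \<Omega> (rho sN k \<Omega> f) (rho sN k \<Omega> g)"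
  unfolding rho_def tensorial_add_def
proof (rule restrict_ext)
  fix Xs assume Xs: "Xs \<in> xtuples k \<Omega>"
  note len = xtuplesD(2)[OF Xs]
  have hom: "f Xs \<in> hom_space sN (sizes Xs)" "g Xs \<in> hom_space sN (sizes Xs)"
    using f g Xs by (auto simp: nc_order_def)
  note If = contraction_iota[OF vector_space_sN len hom(1)] and Ig = contraction_iota[OF vector_space_sN len hom(2)]
  have "iota sN (sizes Xs) (hom_add (sizes Xs) (f Xs) (g Xs)) = iota sN (sizes Xs) (f Xs) + iota sN (sizes Xs) (g Xs)"
    using iota_contraction[OF vector_space_sN len tensor_space_add[OF vector_space_sN If(1) Ig(1)]]
    unfolding contraction_add[OF vector_space_sN] If(2) Ig(2) .
  then show "iota sN (sizes Xs) (nc_order_add k \<Omega> f g Xs) =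
      restrict (\<lambda>Xs. iota sN (sizes Xs) (f Xs)) (xtuples k \<Omega>) Xs + restrict (\<lambda>Xs. iota sN (sizes Xs) (g Xs)) (xtuples k \<Omega>) Xs"
    using Xs by (simp only: nc_order_add_def restrict_apply' if_True)
qed

lemma rho_scale:
  assumes f: "f \<in> nc_order sM sN k \<Omega>"
  shows "rho sN k \<Omega> (nc_order_scale sN k \<Omega> c f) = tensorial_scale sN k \<Omega> c (rho sN k \<Omega> f)"
  unfolding rho_def tensorial_scale_def
proof (rule restrict_ext)
  fix Xs assume Xs: "Xs \<in> xtuples k \<Omega>"
  note len = xtuplesD(2)[OF Xs]
  have hom: "f Xs \<in> hom_space sN (sizes Xs)" using f Xs by (auto simp: nc_order_def)
  note If = contraction_iota[OF vector_space_sN len hom]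
  have "iota sN (sizes Xs) (hom_scale sN (sizes Xs) c (f Xs)) = tensor_scale sN c (iota sN (sizes Xs) (f Xs))"
    using iota_contraction[OF vector_space_sN len tensor_space_scale[OF vector_space_sN If(1)]]
    unfolding contraction_scale[OF vector_space_sN] If(2) .
  then show "iota sN (sizes Xs) (nc_order_scale sN k \<Omega> c f Xs) =
      tensor_scale sN c (restrict (\<lambda>Xs. iota sN (sizes Xs) (f Xs)) (xtuples k \<Omega>) Xs)"
    using Xs by (simp only: nc_order_scale_def restrict_apply')
qed

end

theorem proposition10p13:
  fixes k :: nat
    and sM :: "complex \<Rightarrow> 'm::ab_group_add \<Rightarrow> 'm"
    and sN :: "complex \<Rightarrow> 'n::ab_group_add \<Rightarrow> 'n"
    and M :: "nat \<Rightarrow> 'm set"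
    and \<Omega> :: "nat \<Rightarrow> 'm mat set"
  assumes "k \<ge> 1"
    and "vector_space sM"
    and "\<forall>j\<le>k. Modules.module.subspace sM (M j)"
    and "vector_space sN"
    and "\<forall>j\<le>k. nc_set (M j) (\<Omega> j)"
  shows "(\<forall>f\<in>nc_order sM sN k \<Omega>. rho sN k \<Omega> f \<in> tensorial_nc sM sN k \<Omega>) \<and>
    linear_iso
      (nc_order_add k \<Omega>) (nc_order_scale sN k \<Omega>) (nc_order sM sN k \<Omega>)
      (tensorial_add k \<Omega>) (tensorial_scale sN k \<Omega>) (tensorial_nc sM sN k \<Omega>)
      (rho sN k \<Omega>)"
  using rho_tensorial_nc[OF assms(1,4,5)] rho_bij[OF assms(1,4,5)] rho_add[OF assms(1,4,5)]
    rho_scale[OF assms(1,4,5)]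
  unfolding linear_iso_def by blast

end
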